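(* Let $k$ be a fixed positive integer. For each $n$, let $P_n,K_n$ be integers with $1\le K_n\le P_n$, and consider the uniform random intersection graph $G_u(n,P_n,K_n)$. Define the sequence $\alpha_n$ by $$\frac{K_n^2}{P_n}=\frac{\ln n+(k-1)\ln\ln n+\alpha_n}{n}.$$ If $K_n=\Omega\big(\sqrt{\ln n}\big)$, then $$\lim_{n\to\infty}\mathbb{P}[G_u(n,P_n,K_n)\text{ is }k\text{-connected}]=\begin{cases}0,&\text{if }\lim_{n\to\infty}\alpha_n=-\infty,\\ 1,&\text{if }\lim_{n\to\infty}\alpha_n=\infty,\\ e^{-\frac{e^{-\alpha^*}}{(k-1)!}},&\text{if }\lim_{n\to\infty}\alpha_n=\alpha^*\in(-\infty,\infty),\end{cases}$$ and $$\lim_{n\to\infty}\mathbb{P}[G_u(n,P_n,K_n)\text{ has minimum node degree at least }k]=\begin{cases}0,&\text{if }\lim_{n\to\infty}\alpha_n=-\infty,\\ 1,&\text{if }\lim_{n\to\infty}\alpha_n=\infty,\\ e^{-\frac{e^{-\alpha^*}}{(k-1)!}},&\text{if }\lim_{n\to\infty}\alpha_n=\alpha^*\in(-\infty,\infty).\end{cases}$$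
   Context: Uniform random intersection graph $G_u(n,P_n,K_n)$: node set $\{v_1,\dots,v_n\}$; there is a pool of $P_n$ distinct objects; independently for each node $v_i$, an object set $S_i$ is chosen uniformly at random among all $K_n$-element subsets of the pool. Two distinct nodes $v_i,v_j$ are joined by an undirected edge iff $S_i\cap S_j\neq\emptyset$. A graph is $k$-connected if every pair of nodes is joined by at least $k$ internally node-disjoint paths (equivalently, it cannot be disconnected by deleting at most $k-1$ nodes or edges). All parameters are sequences indexed by $n$, limits are as $n\to\infty$, $k$ does not depend on $n$, and $o,\omega,O,\Omega$ are standard Landau notation. *)

theory Defs
  imports "HOL-Probability.Probability" "HOL-Library.Landau_Symbols"
begin

text \<open>
  A finite simple undirected graph is given by its node set \<open>V\<close> and its set \<open>E\<close> of edges,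
  each edge being a two-element set of nodes.
\<close>

definition path_between :: "'a set \<Rightarrow> 'a set set \<Rightarrow> 'a \<Rightarrow> 'a list \<Rightarrow> 'a \<Rightarrow> bool" where
  "path_between V E u p v \<longleftrightarrow>
     p \<noteq> [] \<and> hd p = u \<and> last p = v \<and> set p \<subseteq> V \<and> distinct p \<and>
     successively (\<lambda>x y. {x, y} \<in> E) p"

text \<open>
  The paths form a set of node sequences, so a direct edge between \<open>u\<close> and \<open>v\<close>, which has no
  internal nodes, is counted only once.
\<close>

definition k_connected :: "nat \<Rightarrow> 'a set \<Rightarrow> 'a set set \<Rightarrow> bool" where
  "k_connected k V E \<longleftrightarrow>
     (\<forall>u\<in>V. \<forall>v\<in>V. u \<noteq> v \<longrightarrow>
        (\<exists>Q. finite Q \<and> card Q \<ge> k \<and> (\<forall>p\<in>Q. path_between V E u p v) \<and>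
             pairwise (\<lambda>p q. (set p - {u, v}) \<inter> (set q - {u, v}) = {}) Q))"

definition node_degree :: "'a set \<Rightarrow> 'a set set \<Rightarrow> 'a \<Rightarrow> nat" where
  "node_degree V E v = card {u \<in> V. u \<noteq> v \<and> {u, v} \<in> E}"

definition min_degree :: "'a set \<Rightarrow> 'a set set \<Rightarrow> nat" where
  "min_degree V E = Min (node_degree V E ` V)"

definition intersection_edges :: "nat \<Rightarrow> (nat \<Rightarrow> nat set) \<Rightarrow> nat set set" where
  "intersection_edges n S = {{i, j} | i j. i < n \<and> j < n \<and> i \<noteq> j \<and> S i \<inter> S j \<noteq> {}}"

text \<open>
  Distribution of the edge set of \<open>G\<^sub>u(n, P, K)\<close> on the nodes \<open>{..<n}\<close> with object pool
  \<open>{..<P}\<close>; it is meaningful for \<open>K \<le> P\<close>, when there are \<open>K\<close>-element subsets of the pool.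
\<close>

definition uniform_rig :: "nat \<Rightarrow> nat \<Rightarrow> nat \<Rightarrow> nat set set pmf" where
  "uniform_rig n P K =
     map_pmf (intersection_edges n)
       (Pi_pmf {..<n} {} (\<lambda>_. pmf_of_set {A. A \<subseteq> {..<P} \<and> card A = K}))"

end

theory Submission
  imports Defs "HOL-Real_Asymp.Real_Asymp"
begin

text \<open>
  Write \<open>\<theta> = K\<^sup>2 / P\<close>. Given the object sets of a set \<open>A\<close> of \<open>r\<close> nodes, with union \<open>U\<close>, the other
  nodes hit \<open>U\<close> independently, and they miss it with probability at most \<open>exp (- |U| K / P)\<close>. The
  defect \<open>r K - |U|\<close> has moment generating function at most \<open>exp ((t - 1) \<theta> r\<^sup>2)\<close>, so \<open>U\<close> is
  nearly as large as possible.

  Minimum degree: for a fixed number \<open>j\<close> of nodes, the probability that all of them have degree \<open>d\<close>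
  is asymptotically the \<open>j\<close>-th power of the Poisson weight \<open>(n \<theta>)\<^sup>d exp (- n \<theta>) / d!\<close>. Bonferroni's
  inequalities then give the Poisson limit, and the second moment method gives the limit \<open>0\<close>.

  Connectivity: by Menger's theorem, a graph of minimum degree at least \<open>k\<close> that is not
  \<open>k\<close>-connected has a set \<open>A\<close> of at most half of the nodes that spans an edge and has fewer than \<open>k\<close>
  outer neighbours. The edge forces a positive defect, which costs a power of \<open>n\<close> in the union bound
  over small \<open>A\<close>; large \<open>A\<close> are excluded because their sets \<open>U\<close> are too large to be avoided.

  All this needs \<open>n \<theta> = O(ln n)\<close>. For larger \<open>n \<theta>\<close>, a larger pool whose objects are merged in
  classes serves as a comparison.
\<close>

section \<open>Menger's theorem\<close>

definition walk_between :: "('a \<times> 'a) set \<Rightarrow> 'a set \<Rightarrow> 'a set \<Rightarrow> 'a list \<Rightarrow> bool" where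
  "walk_between R A B p \<longleftrightarrow>
     p \<noteq> [] \<and> hd p \<in> A \<and> last p \<in> B \<and> successively (\<lambda>x y. (x, y) \<in> R) p"

definition separates :: "('a \<times> 'a) set \<Rightarrow> 'a set \<Rightarrow> 'a set \<Rightarrow> 'a set \<Rightarrow> bool" where
  "separates R A B T \<longleftrightarrow> (\<forall>p. walk_between R A B p \<longrightarrow> set p \<inter> T \<noteq> {})"

definition disjoint_paths ::
  "('a \<times> 'a) set \<Rightarrow> 'i set \<Rightarrow> ('i \<Rightarrow> 'a set) \<Rightarrow> ('i \<Rightarrow> 'a set) \<Rightarrow> ('i \<Rightarrow> 'a list) \<Rightarrow> bool" where
  "disjoint_paths R I A B F \<longleftrightarrow>
     (\<forall>i\<in>I. walk_between R (A i) (B i) (F i) \<and> distinct (F i)) \<and>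
     disjoint_family_on (\<lambda>i. set (F i)) I"

lemma walk_between_mono: "walk_between R A B p \<Longrightarrow> R \<subseteq> R' \<Longrightarrow> walk_between R' A B p"
  by (auto simp: walk_between_def elim!: successively_mono)

lemma walk_between_converse [simp]: "walk_between (R\<inverse>) B A (rev p) \<longleftrightarrow> walk_between R A B p"
  by (auto simp: walk_between_def hd_rev last_rev)

lemma separates_converse: "separates (R\<inverse>) B A T \<longleftrightarrow> separates R A B T"
proof -
  have "walk_between (R\<inverse>) B A p \<longleftrightarrow> walk_between R A B (rev p)" for p
    using walk_between_converse[of R B A "rev p"] by simp
  then show ?thesis unfolding separates_def by (metis rev_rev_ident set_rev)
qed

lemma separates_remove_edge_source:
  assumes "separates R A B Z" "x \<in> Z" "separates (R - {(x, y)}) A Z T"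
  shows "separates R A B T"
  unfolding separates_def
proof (intro allI impI)
  fix p assume p: "walk_between R A B p"
  then have "\<exists>z\<in>set p. z \<in> Z" using assms(1) by (auto simp: separates_def)
  then obtain p1 z p2 where split: "p = p1 @ z # p2" "z \<in> Z" "\<forall>u\<in>set p1. u \<notin> Z"
    using split_list_first_prop[of p "\<lambda>u. u \<in> Z"] by blast
  have "successively (\<lambda>u v. (u, v) \<in> R) ((p1 @ [z]) @ p2)"
    using p split(1) by (simp add: walk_between_def)
  then have "successively (\<lambda>u v. (u, v) \<in> R) (p1 @ [z])"
    unfolding successively_append_iff by blast
  moreover have "x \<notin> set p1" using split(3) assms(2) by blast
  ultimately have "successively (\<lambda>u v. (u, v) \<in> R - {(x, y)}) (p1 @ [z])"
    by (auto simp: successively_conv_nth nth_append in_set_conv_nth split: if_splits)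
  then have "walk_between (R - {(x, y)}) A Z (p1 @ [z])"
    using p split by (cases p1) (auto simp: walk_between_def)
  then have "set (p1 @ [z]) \<inter> T \<noteq> {}" using assms(3) unfolding separates_def by blast
  then show "set p \<inter> T \<noteq> {}" using split(1) by auto
qed

lemma separates_remove_edge_target:
  assumes "separates R A B Z" "y \<in> Z" "separates (R - {(x, y)}) Z B T"
  shows "separates R A B T"
proof -
  have "(R - {(x, y)})\<inverse> = R\<inverse> - {(y, x)}" by auto
  then have "separates (R\<inverse> - {(y, x)}) B Z T" using assms(3) by (metis separates_converse)
  with assms(1,2) show ?thesis by (metis separates_converse separates_remove_edge_source)
qed

lemma separates_insert_edge_end:
  assumes "separates (R - {(x, y)}) A B S" "z \<in> {x, y}"
  shows "separates R A B (insert z S)"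
  unfolding separates_def
proof (intro allI impI)
  fix p assume p: "walk_between R A B p"
  show "set p \<inter> insert z S \<noteq> {}"
  proof (cases "z \<in> set p")
    case False
    then have "successively (\<lambda>u v. (u, v) \<in> R - {(x, y)}) p"
      using p assms(2) unfolding walk_between_def successively_conv_nth
      by (auto dest: Suc_lessD)
    then have "walk_between (R - {(x, y)}) A B p" using p by (simp add: walk_between_def)
    then show ?thesis using assms(1) by (auto simp: separates_def)
  qed auto
qed

lemma disjoint_paths_mono: "disjoint_paths R I A B F \<Longrightarrow> R \<subseteq> R' \<Longrightarrow> disjoint_paths R' I A B F"
  by (auto simp: disjoint_paths_def intro: walk_between_mono)

lemma disjoint_paths_rev:
  "disjoint_paths R I A B F \<Longrightarrow> disjoint_paths (R\<inverse>) I B A (\<lambda>i. rev (F i))"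
  by (simp add: disjoint_paths_def)

lemma disjoint_paths_reindex:
  assumes "disjoint_paths R J A B F" "bij_betw h I J"
  shows "disjoint_paths R I (A \<circ> h) (B \<circ> h) (F \<circ> h)"
  using assms unfolding disjoint_paths_def disjoint_family_on_def bij_betw_def inj_on_def
  by simp blast

lemma disjoint_paths_index_by_target:
  assumes paths: "disjoint_paths R I (\<lambda>_. A) (\<lambda>_. X) F"
    and fin: "finite I" "finite X" and card: "card I = card X"
  shows "\<exists>G. disjoint_paths R X (\<lambda>_. A) (\<lambda>s. {s}) G"
proof -
  have walk: "walk_between R A X (F i)" if "i \<in> I" for i
    using paths that by (simp add: disjoint_paths_def)
  have end_in: "last (F i) \<in> set (F i)" "last (F i) \<in> X" if "i \<in> I" for i
    using walk[OF that] by (auto simp: walk_between_def)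
  have "inj_on (\<lambda>i. last (F i)) I"
    using end_in(1) paths unfolding inj_on_def disjoint_paths_def disjoint_family_on_def
    by (metis Int_iff empty_iff)
  moreover from this have "(\<lambda>i. last (F i)) ` I = X"
    using end_in(2) fin card by (intro card_subset_eq) (auto simp: card_image)
  ultimately have bij: "bij_betw (\<lambda>i. last (F i)) I X" by (simp add: bij_betw_def)
  define h where "h = inv_into I (\<lambda>i. last (F i))"
  have "bij_betw h X I" unfolding h_def by (rule bij_betw_inv_into[OF bij])
  moreover have "last (F (h s)) = s" if "s \<in> X" for s
    unfolding h_def using bij_betw_inv_into_right[OF bij that] .
  ultimately have "disjoint_paths R X (\<lambda>_. A) (\<lambda>s. {s}) (F \<circ> h)"
    using disjoint_paths_reindex[OF paths, of h X]
    by (auto simp: disjoint_paths_def walk_between_def)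
  then show ?thesis by blast
qed

lemma disjoint_paths_index_by_source:
  assumes "disjoint_paths R I (\<lambda>_. X) (\<lambda>_. B) F"
    and "finite I" "finite X" "card I = card X"
  shows "\<exists>G. disjoint_paths R X (\<lambda>s. {s}) (\<lambda>_. B) G"
proof -
  obtain G where "disjoint_paths (R\<inverse>) X (\<lambda>_. B) (\<lambda>s. {s}) G"
    using disjoint_paths_index_by_target[OF disjoint_paths_rev[OF assms(1)] assms(2-4)] ..
  from disjoint_paths_rev[OF this] show ?thesis by auto
qed

lemma disjoint_paths_target_unique:
  assumes "disjoint_paths R X (\<lambda>_. A) (\<lambda>s. {s}) F" "s \<in> X" "t \<in> X" "t \<in> set (F s)"
  shows "t = s"
proof -
  have "t \<in> set (F t)"
    using assms(1,3) last_in_set by (fastforce simp: disjoint_paths_def walk_between_def)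
  then show ?thesis using assms unfolding disjoint_paths_def disjoint_family_on_def by blast
qed

lemma disjoint_paths_source_unique:
  assumes "disjoint_paths R X (\<lambda>s. {s}) (\<lambda>_. B) G" "s \<in> X" "t \<in> X" "t \<in> set (G s)"
  shows "t = s"
  using disjoint_paths_target_unique[OF disjoint_paths_rev[OF assms(1)] assms(2,3)] assms(4)
  by simp

lemma disjoint_paths_append:
  assumes F: "disjoint_paths R X (\<lambda>_. A) (\<lambda>s. {s}) F"
    and G: "disjoint_paths R X (\<lambda>s. {s}) (\<lambda>_. B) G"
    and meet: "\<And>s t z. \<lbrakk>s \<in> X; t \<in> X; z \<in> set (F s); z \<in> set (G t)\<rbrakk> \<Longrightarrow> z = s \<and> z = t"
  shows "disjoint_paths R X (\<lambda>_. A) (\<lambda>_. B) (\<lambda>s. F s @ tl (G s))"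
  unfolding disjoint_paths_def
proof (intro conjI ballI)
  fix s assume s: "s \<in> X"
  have walks: "walk_between R A {s} (F s)" "walk_between R {s} B (G s)"
    and distinct: "distinct (F s)" "distinct (G s)"
    using F G s by (auto simp: disjoint_paths_def)
  obtain g where g: "G s = s # g" using walks(2) by (cases "G s") (auto simp: walk_between_def)
  have last_F: "F s \<noteq> []" "last (F s) = s" using walks(1) by (auto simp: walk_between_def)
  show "walk_between R A B (F s @ tl (G s))"
    using walks g last_F by (cases g) (auto simp: walk_between_def successively_append_iff)
  have "set (F s) \<inter> set g = {}" using meet[OF s s] distinct(2) g by auto
  then show "distinct (F s @ tl (G s))" using distinct g by simp
next
  show "disjoint_family_on (\<lambda>s. set (F s @ tl (G s))) X"
    unfolding disjoint_family_on_def
  proof (intro ballI impI)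
    fix s t assume st: "s \<in> X" "t \<in> X" "s \<noteq> t"
    have "set (F s) \<inter> set (F t) = {}" "set (G s) \<inter> set (G t) = {}"
      using F G st by (auto simp: disjoint_paths_def disjoint_family_on_def)
    moreover have "set (F s) \<inter> set (G t) = {}" "set (F t) \<inter> set (G s) = {}"
      using meet st by blast+
    moreover have "set (tl (G u)) \<subseteq> set (G u)" for u by (cases "G u") auto
    ultimately show "set (F s @ tl (G s)) \<inter> set (F t @ tl (G t)) = {}"
      unfolding set_append by blast
  qed
qed

lemma walks_meet_in_separator:
  assumes sep: "separates R A B S"
    and p: "walk_between R A {s} p" "distinct p" "set p \<inter> S \<subseteq> {s}"
    and q: "walk_between R {t} B q" "distinct q" "set q \<inter> S \<subseteq> {t}"
    and z: "z \<in> set p" "z \<in> set q"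
  shows "z \<in> S"
proof -
  obtain p1 p2 where p_split: "p = p1 @ z # p2" using z(1) by (metis split_list)
  obtain q1 q2 where q_split: "q = q1 @ z # q2" using z(2) by (metis split_list)
  have "successively (\<lambda>u v. (u, v) \<in> R) (p1 @ [z])"
    using p(1) p_split by (auto simp: walk_between_def successively_append_iff)
  moreover have "successively (\<lambda>u v. (u, v) \<in> R) (z # q2)"
    using q(1) q_split by (auto simp: walk_between_def successively_append_iff)
  ultimately have "successively (\<lambda>u v. (u, v) \<in> R) (p1 @ z # q2)"
    by (auto simp: successively_append_iff)
  then have "walk_between R A B (p1 @ z # q2)"
    using p(1) q(1) p_split q_split by (cases p1) (auto simp: walk_between_def)
  then obtain y where y: "y \<in> S" "y \<in> set (p1 @ z # q2)"
    using sep unfolding separates_def by blast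
  show ?thesis
  proof (cases "y \<in> set (p1 @ [z])")
    case True
    then have "y = last p" using p(1,3) y(1) p_split by (auto simp: walk_between_def)
    then have "p2 = []"
      using True p(2) p_split last_in_set[of p2] by (cases "p2 = []") auto
    then show ?thesis using \<open>y = last p\<close> y(1) p_split by simp
  next
    case False
    then have "y \<in> set q2" using y(2) by auto
    moreover from this have "y = hd q" using q(1,3) y(1) q_split by (auto simp: walk_between_def)
    ultimately have False using q(2) q_split by (cases q1) auto
    then show ?thesis ..
  qed
qed

lemma menger_no_edges:
  assumes "finite A" "\<And>T. finite T \<Longrightarrow> separates {} A B T \<Longrightarrow> k \<le> card T"
  shows "\<exists>F. disjoint_paths {} {..<k} (\<lambda>_. A) (\<lambda>_. B) F"
proof -
  have "separates {} A B (A \<inter> B)"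
    unfolding separates_def
  proof (intro allI impI)
    fix p assume p: "walk_between {} A B p"
    then obtain a p' where p_eq: "p = a # p'" by (cases p) (auto simp: walk_between_def)
    then have "p' = []" using p by (cases p') (auto simp: walk_between_def)
    then show "set p \<inter> (A \<inter> B) \<noteq> {}" using p p_eq by (auto simp: walk_between_def)
  qed
  then have "k \<le> card (A \<inter> B)" using assms by blast
  then obtain Z where Z: "Z \<subseteq> A \<inter> B" "card Z = k" "finite Z"
    using obtain_subset_with_card_n by metis
  then obtain h where "bij_betw h {..<k} Z"
    by (metis finite_same_card_bij finite_lessThan card_lessThan)
  then have "disjoint_paths {} {..<k} (\<lambda>_. A) (\<lambda>_. B) (\<lambda>i. [h i])"
    using Z(1) by (fastforce simp: disjoint_paths_def walk_between_def disjoint_family_on_def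
        bij_betw_def inj_on_def)
  then show ?thesis by blast
qed

lemma disjoint_paths_prepend_edge:
  assumes edge: "(x, y) \<in> R" and y: "y \<notin> S"
    and G: "disjoint_paths R (insert y S) (\<lambda>s. {s}) (\<lambda>_. B) G"
    and x: "\<And>t. t \<in> insert y S \<Longrightarrow> x \<notin> set (G t)"
  shows "disjoint_paths R (insert x S) (\<lambda>s. {s}) (\<lambda>_. B) (\<lambda>s. if s = x then x # G y else G s)"
    (is "disjoint_paths _ _ _ _ ?G")
  unfolding disjoint_paths_def
proof (intro conjI ballI)
  fix s assume s: "s \<in> insert x S"
  have "walk_between R {t} B (G t) \<and> distinct (G t)" if "t \<in> insert y S" for t
    using G that unfolding disjoint_paths_def by blast
  then show "walk_between R {s} B (?G s)" "distinct (?G s)"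
    using s edge x by (auto simp: walk_between_def successively_Cons)
next
  show "disjoint_family_on (\<lambda>s. set (?G s)) (insert x S)"
    unfolding disjoint_family_on_def
  proof (intro ballI impI)
    fix s t assume st: "s \<in> insert x S" "t \<in> insert x S" "s \<noteq> t"
    have "set (G u) \<inter> set (G v) = {}" if "u \<in> insert y S" "v \<in> insert y S" "u \<noteq> v" for u v
      using G that unfolding disjoint_paths_def disjoint_family_on_def by blast
    moreover have "s \<noteq> y" "t \<noteq> y" if "s \<noteq> x" "t \<noteq> x" using st y that by auto
    ultimately show "set (?G s) \<inter> set (?G t) = {}"
      using st y x by (cases "s = x"; cases "t = x") auto
  qed
qed

lemma disjoint_paths_meet_in_separator:
  assumes sep: "separates R A B S"
    and F: "disjoint_paths R (insert x S) (\<lambda>_. A) (\<lambda>s. {s}) F"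
    and G: "disjoint_paths R (insert y S) (\<lambda>s. {s}) (\<lambda>_. B) G"
    and s: "s \<in> insert x S" and t: "t \<in> insert y S" and z: "z \<in> set (F s)" "z \<in> set (G t)"
  shows "z \<in> S \<and> z = s \<and> z = t"
proof -
  have "set (F s) \<inter> S \<subseteq> {s}" "set (G t) \<inter> S \<subseteq> {t}"
    using disjoint_paths_target_unique[OF F s] disjoint_paths_source_unique[OF G t] by auto
  moreover have "walk_between R A {s} (F s)" "distinct (F s)"
    "walk_between R {t} B (G t)" "distinct (G t)"
    using F G s t unfolding disjoint_paths_def by blast+
  ultimately have "z \<in> S" using walks_meet_in_separator[OF sep] z by metis
  then show ?thesis
    using disjoint_paths_target_unique[OF F s _ z(1)] disjoint_paths_source_unique[OF G t _ z(2)]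
    by blast
qed

lemma disjoint_paths_join_edge:
  assumes edge: "(x, y) \<in> R" and S: "x \<notin> S" "y \<notin> S" "separates (R - {(x, y)}) A B S"
    and F: "disjoint_paths (R - {(x, y)}) (insert x S) (\<lambda>_. A) (\<lambda>s. {s}) F"
    and G: "disjoint_paths (R - {(x, y)}) (insert y S) (\<lambda>s. {s}) (\<lambda>_. B) G"
  shows "\<exists>H. disjoint_paths R (insert x S) (\<lambda>_. A) (\<lambda>_. B) H"
proof -
  note meet = disjoint_paths_meet_in_separator[OF S(3) F G]
  have "x \<in> set (F x)"
    using F last_in_set by (fastforce simp: disjoint_paths_def walk_between_def)
  then have "x \<notin> set (G t)" if "t \<in> insert y S" for t
    using meet[of x t x] that S(1) by blast
  note prepended =
    disjoint_paths_prepend_edge[OF edge S(2) disjoint_paths_mono[OF G Diff_subset] this]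
  have "disjoint_paths R (insert x S) (\<lambda>_. A) (\<lambda>_. B)
      (\<lambda>s. F s @ tl (if s = x then x # G y else G s))"
  proof (rule disjoint_paths_append[OF disjoint_paths_mono[OF F Diff_subset] prepended])
    fix s t z
    assume st: "s \<in> insert x S" "t \<in> insert x S"
      and z: "z \<in> set (F s)" "z \<in> set (if t = x then x # G y else G t)"
    show "z = s \<and> z = t"
    proof (cases "t = x")
      case True
      then show ?thesis
        using z meet[OF st(1) insertI1 z(1)] S(2) disjoint_paths_target_unique[OF F st(1)] by auto
    next
      case False
      then show ?thesis using z meet[OF st(1) _ z(1)] st(2) by auto
    qed
  qed
  then show ?thesis by blast
qed

lemma disjoint_paths_through_separator_edge:
  assumes edge: "(x, y) \<in> R" and S: "finite S" "x \<notin> S" "y \<notin> S" "separates (R - {(x, y)}) A B S"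
    and card: "card (insert x S) = k" "card (insert y S) = k"
    and F: "disjoint_paths (R - {(x, y)}) {..<k} (\<lambda>_. A) (\<lambda>_. insert x S) F"
    and G: "disjoint_paths (R - {(x, y)}) {..<k} (\<lambda>_. insert y S) (\<lambda>_. B) G"
  shows "\<exists>H. disjoint_paths R {..<k} (\<lambda>_. A) (\<lambda>_. B) H"
proof -
  have fin: "finite (insert x S)" "finite (insert y S)" using S(1) by simp_all
  obtain F' where "disjoint_paths (R - {(x, y)}) (insert x S) (\<lambda>_. A) (\<lambda>s. {s}) F'"
    using disjoint_paths_index_by_target[OF F finite_lessThan fin(1)] card(1) by auto
  moreover obtain G' where "disjoint_paths (R - {(x, y)}) (insert y S) (\<lambda>s. {s}) (\<lambda>_. B) G'"
    using disjoint_paths_index_by_source[OF G finite_lessThan fin(2)] card(2) by auto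
  ultimately obtain H where H: "disjoint_paths R (insert x S) (\<lambda>_. A) (\<lambda>_. B) H"
    using disjoint_paths_join_edge[OF edge S(2-4)] by blast
  obtain h where "bij_betw h {..<k} (insert x S)"
    using finite_same_card_bij[OF finite_lessThan fin(1), of k] card(1) by auto
  from disjoint_paths_reindex[OF H this] show ?thesis by (auto simp: comp_def)
qed

text \<open>
  Goering's proof, by induction on the number of edges: if deleting an edge \<open>(x, y)\<close> creates a
  separator \<open>S\<close> with fewer than \<open>k\<close> nodes, then \<open>S \<union> {x}\<close> and \<open>S \<union> {y}\<close> are separators with
  exactly \<open>k\<close> nodes, and the paths that the induction provides from \<open>A\<close> to \<open>S \<union> {x}\<close> and
  from \<open>S \<union> {y}\<close> to \<open>B\<close> can only meet in \<open>S\<close>, so that they can be glued together.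
\<close>

lemma menger_critical_edge:
  assumes edge: "(x, y) \<in> R" and A: "finite A"
    and ge: "\<And>T. finite T \<Longrightarrow> separates R A B T \<Longrightarrow> k \<le> card T"
    and S: "finite S" "separates (R - {(x, y)}) A B S" "card S < k"
    and IH: "\<And>A B. finite A \<Longrightarrow>
      (\<And>T. finite T \<Longrightarrow> separates (R - {(x, y)}) A B T \<Longrightarrow> k \<le> card T) \<Longrightarrow>
      \<exists>F. disjoint_paths (R - {(x, y)}) {..<k} (\<lambda>_. A) (\<lambda>_. B) F"
  shows "\<exists>H. disjoint_paths R {..<k} (\<lambda>_. A) (\<lambda>_. B) H"
proof -
  have sep: "separates R A B (insert x S)" "separates R A B (insert y S)"
    using separates_insert_edge_end[OF S(2)] by simp_all
  then have card_S: "x \<notin> S" "y \<notin> S" "card (insert x S) = k" "card (insert y S) = k"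
    using ge[OF _ sep(1)] ge[OF _ sep(2)] S(1,3) by (auto simp: card_insert_if split: if_splits)
  have "\<exists>F. disjoint_paths (R - {(x, y)}) {..<k} (\<lambda>_. A) (\<lambda>_. insert x S) F"
    using separates_remove_edge_source[OF sep(1) insertI1] by (intro IH A ge)
  moreover have "\<exists>G. disjoint_paths (R - {(x, y)}) {..<k} (\<lambda>_. insert y S) (\<lambda>_. B) G"
    using separates_remove_edge_target[OF sep(2) insertI1] S(1) by (intro IH ge) simp_all
  ultimately show ?thesis
    using disjoint_paths_through_separator_edge[OF edge S(1) card_S(1,2) S(2) card_S(3,4)] by blast
qed

theorem menger:
  assumes "finite R" "irrefl R" "finite A"
    and "\<And>T. finite T \<Longrightarrow> separates R A B T \<Longrightarrow> k \<le> card T"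
  shows "\<exists>F. disjoint_paths R {..<k} (\<lambda>_. A) (\<lambda>_. B) F"
  using assms
proof (induction "card R" arbitrary: R A B rule: less_induct)
  case less
  show ?case
  proof (cases "R = {}")
    case True
    then show ?thesis using menger_no_edges less.prems(3,4) by blast
  next
    case False
    then obtain x y where edge: "(x, y) \<in> R" by auto
    have removed: "card (R - {(x, y)}) < card R" "finite (R - {(x, y)})" "irrefl (R - {(x, y)})"
      using less.prems(1,2) card_Diff1_less[OF less.prems(1) edge] by (auto simp: irrefl_def)
    show ?thesis
    proof (cases "\<forall>T. finite T \<longrightarrow> separates (R - {(x, y)}) A B T \<longrightarrow> k \<le> card T")
      case True
      then obtain F where "disjoint_paths (R - {(x, y)}) {..<k} (\<lambda>_. A) (\<lambda>_. B) F"
        using less.hyps[OF removed less.prems(3), of B] by blast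
      then have "disjoint_paths R {..<k} (\<lambda>_. A) (\<lambda>_. B) F" by (rule disjoint_paths_mono) auto
      then show ?thesis by blast
    next
      case False
      then obtain S where "finite S" "separates (R - {(x, y)}) A B S" "card S < k" by auto
      then show ?thesis
        using menger_critical_edge[OF edge less.prems(3,4) _ _ _ less.hyps[OF removed]] by blast
    qed
  qed
qed

section \<open>Connectivity and small vertex cuts\<close>

lemma k_connected_mono:
  assumes "k_connected k V E" "E \<subseteq> E'"
  shows "k_connected k V E'"
proof -
  have "path_between V E' u p v" if "path_between V E u p v" for u p v
    using that assms(2) unfolding path_between_def
    by (auto elim!: successively_mono)
  with assms(1) show ?thesis unfolding k_connected_def by meson
qed

lemma path_between_ConsE:
  assumes "path_between V E u p v" "u \<noteq> v"
  obtains x r where "p = u # x # r" "x \<in> V" "x \<noteq> u" "{u, x} \<in> E" "x = v \<longrightarrow> r = []"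
proof -
  obtain p' where "p = u # p'" using assms by (cases p) (auto simp: path_between_def)
  moreover obtain x r where "p' = x # r"
    using assms calculation by (cases p') (auto simp: path_between_def)
  moreover from calculation have "x = v \<longrightarrow> r = []"
    using assms last_in_set[of r] by (auto simp: path_between_def split: if_splits)
  ultimately show thesis using assms that[of x r] by (auto simp: path_between_def)
qed

lemma k_connected_imp_node_degree:
  assumes "finite V" "card V \<ge> 2" and conn: "k_connected k V E" and v: "v \<in> V"
  shows "node_degree V E v \<ge> k"
proof -
  have "\<not> V \<subseteq> {v}" using card_mono[of "{v}" V] assms(2) by auto
  then obtain w where w: "w \<in> V" "v \<noteq> w" by auto
  obtain Q where Q: "finite Q" "card Q \<ge> k" "\<forall>p\<in>Q. path_between V E v p w"
    and disjoint: "pairwise (\<lambda>p q. (set p - {v, w}) \<inter> (set q - {v, w}) = {}) Q"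
    using conn v w unfolding k_connected_def by (metis (no_types, lifting))
  have "inj_on (\<lambda>p. p ! 1) Q"
  proof (rule inj_onI)
    fix p q assume pq: "p \<in> Q" "q \<in> Q" "p ! 1 = q ! 1"
    obtain x r where p: "p = v # x # r" "x \<noteq> v" "x = w \<longrightarrow> r = []"
      using path_between_ConsE[of V E v p w] Q(3) pq(1) w(2) by metis
    obtain y s where q: "q = v # y # s" "y \<noteq> v" "y = w \<longrightarrow> s = []"
      using path_between_ConsE[of V E v q w] Q(3) pq(2) w(2) by metis
    have xy: "x = y" using pq(3) p q by simp
    show "p = q"
    proof (cases "x = w")
      case False
      then have "x \<in> (set p - {v, w}) \<inter> (set q - {v, w})" using p q xy by auto
      then show ?thesis using disjoint pq unfolding pairwise_def by blast
    qed (use p q xy in simp)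
  qed
  moreover have "p ! 1 \<in> {u \<in> V. u \<noteq> v \<and> {u, v} \<in> E}" if p: "p \<in> Q" for p
  proof -
    have "path_between V E v p w" using Q(3) p by blast
    then show ?thesis using w(2) by (elim path_between_ConsE) (auto simp: insert_commute)
  qed
  ultimately have "card Q \<le> card {u \<in> V. u \<noteq> v \<and> {u, v} \<in> E}"
    using assms(1) by (intro card_inj_on_le) auto
  then show ?thesis using Q(2) unfolding node_degree_def by simp
qed

definition boundary :: "'a set \<Rightarrow> 'a set set \<Rightarrow> 'a set \<Rightarrow> 'a set" where
  "boundary V E A = {w \<in> V - A. \<exists>a\<in>A. {a, w} \<in> E}"

definition adjacency :: "'a set \<Rightarrow> 'a set set \<Rightarrow> ('a \<times> 'a) set" where
  "adjacency W E = {(x, y). x \<in> W \<and> y \<in> W \<and> x \<noteq> y \<and> {x, y} \<in> E}"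

definition neighbours :: "'a set \<Rightarrow> 'a set set \<Rightarrow> 'a \<Rightarrow> 'a set" where
  "neighbours W E u = {x \<in> W. {u, x} \<in> E}"

lemma successively_set_subset:
  assumes "successively (\<lambda>x y. (x, y) \<in> R) p" "p \<noteq> []" "hd p \<in> W" "R \<subseteq> W \<times> W"
  shows "set p \<subseteq> W"
  using assms
proof (induction p)
  case (Cons a p)
  then have "p \<noteq> [] \<longrightarrow> (a, hd p) \<in> R \<and> successively (\<lambda>x y. (x, y) \<in> R) p"
    by (auto simp: successively_Cons)
  then have "p \<noteq> [] \<longrightarrow> set p \<subseteq> W" using Cons.IH Cons.prems(4) by blast
  then show ?case using Cons.prems(3) by (cases p) auto
qed simp

lemma path_between_of_walk:
  assumes walk: "walk_between (adjacency (V - {u, v}) E) (neighbours (V - {u, v}) E u)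
      (neighbours (V - {u, v}) E v) p" and "distinct p"
    and uv: "u \<in> V" "v \<in> V" "u \<noteq> v"
  shows "path_between V E u (u # p @ [v]) v"
proof -
  have inner: "set p \<subseteq> V - {u, v}"
    using walk by (intro successively_set_subset[of "adjacency (V - {u, v}) E"])
      (auto simp: walk_between_def adjacency_def neighbours_def)
  have "successively (\<lambda>x y. {x, y} \<in> E) p"
    using walk unfolding walk_between_def
    by (elim conjE, elim successively_mono) (auto simp: adjacency_def)
  then have "successively (\<lambda>x y. {x, y} \<in> E) (u # p @ [v])"
    using walk by (auto simp: successively_Cons successively_append_iff walk_between_def
        neighbours_def insert_commute)
  then show ?thesis using inner assms(2) uv by (auto simp: path_between_def)
qed

lemma internally_disjoint_paths_of_disjoint_paths:
  assumes uv: "u \<in> V" "v \<in> V" "u \<noteq> v"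
    and F: "disjoint_paths (adjacency (V - {u, v}) E) {..<m} (\<lambda>_. neighbours (V - {u, v}) E u)
      (\<lambda>_. neighbours (V - {u, v}) E v) F"
  shows "\<exists>Q. finite Q \<and> card Q = m + of_bool ({u, v} \<in> E) \<and> (\<forall>p\<in>Q. path_between V E u p v) \<and>
    pairwise (\<lambda>p q. (set p - {u, v}) \<inter> (set q - {u, v}) = {}) Q"
proof -
  define direct where "direct = (if {u, v} \<in> E then {[u, v]} else {})"
  define Q where "Q = (\<lambda>i. u # F i @ [v]) ` {..<m} \<union> direct"
  have F_ne: "F i \<noteq> []" if "i < m" for i
    using F that by (auto simp: disjoint_paths_def walk_between_def)
  have disjoint: "set (F i) \<inter> set (F j) = {}" if "i < m" "j < m" "i \<noteq> j" for i j
    using F that by (auto simp: disjoint_paths_def disjoint_family_on_def)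
  have "inj_on (\<lambda>i. u # F i @ [v]) {..<m}"
  proof (rule inj_onI, rule ccontr)
    fix i j assume "i \<in> {..<m}" "j \<in> {..<m}" "u # F i @ [v] = u # F j @ [v]" "i \<noteq> j"
    then show False using disjoint[of i j] F_ne[of i] by auto
  qed
  moreover have "(\<lambda>i. u # F i @ [v]) ` {..<m} \<inter> direct = {}"
    using F_ne by (auto simp: direct_def)
  ultimately have "finite Q" "card Q = m + of_bool ({u, v} \<in> E)"
    by (auto simp: Q_def direct_def card_image card_Un_disjoint)
  moreover have "path_between V E u p v" if p: "p \<in> Q" for p
  proof (cases "p \<in> direct")
    case True
    then show ?thesis using uv by (auto simp: direct_def path_between_def split: if_splits)
  next
    case False
    then obtain i where "i < m" "p = u # F i @ [v]" using p unfolding Q_def by blast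
    then show ?thesis using F uv by (auto simp: disjoint_paths_def intro: path_between_of_walk)
  qed
  moreover have "pairwise (\<lambda>p q. (set p - {u, v}) \<inter> (set q - {u, v}) = {}) Q"
    unfolding pairwise_def Q_def
  proof (intro ballI impI, elim UnE imageE)
    fix p q i j assume "p = u # F i @ [v]" "q = u # F j @ [v]" "i \<in> {..<m}" "j \<in> {..<m}" "p \<noteq> q"
    moreover from this have "set (F i) \<inter> set (F j) = {}" by (intro disjoint) auto
    ultimately show "(set p - {u, v}) \<inter> (set q - {u, v}) = {}" by auto
  qed (auto simp: direct_def split: if_splits)
  ultimately show ?thesis by (intro exI[of _ Q]) blast
qed

lemma not_k_connected_imp_separator:
  assumes "finite V" "\<not> k_connected k V E"
  shows "\<exists>u\<in>V. \<exists>v\<in>V. u \<noteq> v \<and> (\<exists>T. finite T \<and> card T + of_bool ({u, v} \<in> E) < k \<and>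
    separates (adjacency (V - {u, v}) E) (neighbours (V - {u, v}) E u) (neighbours (V - {u, v}) E v) T)"
proof (rule ccontr)
  assume no_separator: "\<not> ?thesis"
  have "\<exists>Q. finite Q \<and> card Q \<ge> k \<and> (\<forall>p\<in>Q. path_between V E u p v) \<and>
      pairwise (\<lambda>p q. (set p - {u, v}) \<inter> (set q - {u, v}) = {}) Q"
    if uv: "u \<in> V" "v \<in> V" "u \<noteq> v" for u v
  proof -
    let ?R = "adjacency (V - {u, v}) E"
    have "?R \<subseteq> V \<times> V" by (auto simp: adjacency_def)
    then have "finite ?R" using assms(1) finite_subset by blast
    moreover have "irrefl ?R" by (auto simp: adjacency_def irrefl_def)
    moreover have "finite (neighbours (V - {u, v}) E u)"
      using assms(1) by (simp add: neighbours_def)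
    moreover have "k - of_bool ({u, v} \<in> E) \<le> card T"
      if "finite T" "separates ?R (neighbours (V - {u, v}) E u) (neighbours (V - {u, v}) E v) T"
        for T
      using no_separator uv that by fastforce
    ultimately obtain F where "disjoint_paths ?R {..<k - of_bool ({u, v} \<in> E)}
        (\<lambda>_. neighbours (V - {u, v}) E u) (\<lambda>_. neighbours (V - {u, v}) E v) F"
      using menger[of ?R "neighbours (V - {u, v}) E u" "neighbours (V - {u, v}) E v"] by blast
    from internally_disjoint_paths_of_disjoint_paths[OF uv this]
    obtain Q where "finite Q" "card Q = k - of_bool ({u, v} \<in> E) + of_bool ({u, v} \<in> E)"
      "\<forall>p\<in>Q. path_between V E u p v"
      "pairwise (\<lambda>p q. (set p - {u, v}) \<inter> (set q - {u, v}) = {}) Q" by blast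
    moreover from this have "k \<le> card Q" by simp
    ultimately show ?thesis by blast
  qed
  then show False using assms(2) unfolding k_connected_def by blast
qed

lemma separates_imp_closed_set:
  assumes sep: "separates R A B T"
  shows "\<exists>C. A - T \<subseteq> C \<and> C \<subseteq> A \<union> Range R \<and> C \<inter> B = {} \<and> R `` C \<subseteq> C \<union> T"
proof -
  define C where "C = (R \<inter> UNIV \<times> (- T))\<^sup>* `` (A - T)"
  have walk: "\<exists>p. walk_between R A {z} p \<and> set p \<inter> T = {}"
    if "(a, z) \<in> (R \<inter> UNIV \<times> (- T))\<^sup>*" "a \<in> A - T" for a z
    using that
  proof (induction rule: rtrancl_induct)
    case base
    then show ?case by (intro exI[of _ "[a]"]) (simp add: walk_between_def)
  next
    case (step y z)
    then obtain p where "walk_between R A {y} p" "set p \<inter> T = {}" by blast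
    then show ?case using step.hyps(2)
      by (intro exI[of _ "p @ [z]"]) (auto simp: walk_between_def successively_append_iff)
  qed
  have "C \<inter> B = {}"
  proof (rule ccontr)
    assume "C \<inter> B \<noteq> {}"
    then obtain z where "z \<in> C" "z \<in> B" by blast
    then obtain p where "walk_between R A {z} p" "set p \<inter> T = {}"
      using walk unfolding C_def by blast
    moreover from this \<open>z \<in> B\<close> have "walk_between R A B p" by (auto simp: walk_between_def)
    ultimately show False using sep by (auto simp: separates_def)
  qed
  moreover have "C \<subseteq> A \<union> Range R" unfolding C_def by (auto elim: rtranclE)
  moreover have "R `` C \<subseteq> C \<union> T" unfolding C_def by (auto intro: rtrancl_into_rtrancl)
  moreover have "A - T \<subseteq> C" unfolding C_def by blast
  ultimately show ?thesis by blast
qed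

lemma boundary_closed_set_subset:
  assumes C: "C \<subseteq> V - {u, v}" "C \<inter> neighbours (V - {u, v}) E v = {}"
    "adjacency (V - {u, v}) E `` C \<subseteq> C \<union> T"
  shows "boundary V E C \<subseteq> insert u T - {v}"
proof
  fix w assume "w \<in> boundary V E C"
  then obtain a where a: "a \<in> C" "{a, w} \<in> E" and w: "w \<in> V" "w \<notin> C"
    by (auto simp: boundary_def)
  have "w \<noteq> v" using C(1,2) a by (auto simp: neighbours_def insert_commute)
  moreover have "w \<in> T" if "w \<noteq> u"
  proof -
    have "(a, w) \<in> adjacency (V - {u, v}) E"
      using a C(1) w \<open>w \<noteq> v\<close> that by (auto simp: adjacency_def)
    then show ?thesis using C(3) a(1) w(2) by blast
  qed
  ultimately show "w \<in> insert u T - {v}" by blast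
qed

lemma node_degree_le_if_neighbours_subset:
  assumes "finite T" "neighbours (V - {u, v}) E u \<subseteq> T"
  shows "node_degree V E u \<le> Suc (card T)"
proof -
  have "{w \<in> V. w \<noteq> u \<and> {w, u} \<in> E} \<subseteq> insert v T"
    using assms(2) by (auto simp: neighbours_def insert_commute)
  then have "node_degree V E u \<le> card (insert v T)"
    unfolding node_degree_def using assms(1) by (intro card_mono) auto
  also have "\<dots> \<le> Suc (card T)" by (rule card_insert_le_m1) auto
  finally show ?thesis .
qed

text \<open>
  If \<open>{u, v}\<close> is not an edge, then \<open>X = C \<union> {u}\<close> has its boundary in \<open>T\<close>. Otherwise \<open>X = C\<close>, whose
  boundary may also contain \<open>u\<close>, but then \<open>T\<close> has one node less.
\<close>

lemma not_k_connected_imp_cut: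
  assumes fin: "finite V" and deg: "\<forall>v\<in>V. node_degree V E v \<ge> k"
    and nconn: "\<not> k_connected k V E"
  shows "\<exists>X v. X \<subseteq> V \<and> X \<noteq> {} \<and> v \<in> V - X - boundary V E X \<and> card (boundary V E X) < k"
proof -
  obtain u v T where uv: "u \<in> V" "v \<in> V" "u \<noteq> v"
    and T: "finite T" "card T + of_bool ({u, v} \<in> E) < k"
    and sep: "separates (adjacency (V - {u, v}) E) (neighbours (V - {u, v}) E u)
      (neighbours (V - {u, v}) E v) T"
    using not_k_connected_imp_separator[OF fin nconn] by blast
  have "neighbours (V - {u, v}) E u \<union> Range (adjacency (V - {u, v}) E) \<subseteq> V - {u, v}"
    by (auto simp: neighbours_def adjacency_def)
  with separates_imp_closed_set[OF sep]
  obtain C where C: "neighbours (V - {u, v}) E u - T \<subseteq> C" "C \<subseteq> V - {u, v}"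
      "C \<inter> neighbours (V - {u, v}) E v = {}" "adjacency (V - {u, v}) E `` C \<subseteq> C \<union> T"
    by (meson order_trans)
  note boundary_C = boundary_closed_set_subset[OF C(2-4)]
  show ?thesis
  proof (cases "{u, v} \<in> E")
    case True
    have "card (boundary V E C) \<le> card (insert u T)"
      using boundary_C T(1) by (intro card_mono) auto
    also have "\<dots> \<le> Suc (card T)" by (rule card_insert_le_m1) auto
    finally have "card (boundary V E C) < k" using T(2) True by simp
    moreover have "\<not> neighbours (V - {u, v}) E u \<subseteq> T"
      using node_degree_le_if_neighbours_subset[OF T(1)] deg uv(1) T(2) True by fastforce
    then have "C \<noteq> {}" using C(1) by blast
    ultimately show ?thesis using C(2) boundary_C uv by (intro exI[of _ C] exI[of _ v]) auto
  next
    case False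
    have "boundary V E (insert u C) \<subseteq> T" "v \<notin> boundary V E (insert u C)"
      using boundary_C C(1) False by (auto simp: boundary_def neighbours_def)
    moreover from this have "card (boundary V E (insert u C)) < k"
      using T card_mono[of T "boundary V E (insert u C)"] False by simp
    ultimately show ?thesis
      using C(2) uv by (intro exI[of _ "insert u C"] exI[of _ v]) auto
  qed
qed

lemma boundary_complement_subset: "boundary V E (V - X - boundary V E X) \<subseteq> boundary V E X"
proof
  fix w assume "w \<in> boundary V E (V - X - boundary V E X)"
  then obtain y where y: "y \<in> V - X - boundary V E X" "{y, w} \<in> E" and w: "w \<in> V"
    "w \<notin> V - X - boundary V E X" by (auto simp: boundary_def)
  have "w \<notin> X"
  proof
    assume "w \<in> X"
    moreover have "{w, y} \<in> E" using y(2) by (simp add: insert_commute)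
    ultimately have "y \<in> boundary V E X" using y(1) by (auto simp: boundary_def)
    then show False using y(1) by blast
  qed
  then show "w \<in> boundary V E X" using w by blast
qed

lemma small_boundary_contains_edge:
  assumes fin: "finite V" and deg: "\<forall>v\<in>V. node_degree V E v \<ge> k"
    and A: "A \<subseteq> V" "A \<noteq> {}" "card (boundary V E A) < k"
  shows "\<exists>a\<in>A. \<exists>b\<in>A. a \<noteq> b \<and> {a, b} \<in> E"
proof (rule ccontr)
  assume no_edge: "\<not> ?thesis"
  obtain a where a: "a \<in> A" using A by auto
  have "{u \<in> V. u \<noteq> a \<and> {u, a} \<in> E} \<subseteq> boundary V E A"
    using no_edge a by (auto simp: boundary_def insert_commute)
  then have "node_degree V E a \<le> card (boundary V E A)"
    unfolding node_degree_def using fin by (intro card_mono) (auto simp: boundary_def)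
  then show False using deg a A by fastforce
qed

lemma not_k_connected_imp_small_boundary:
  assumes fin: "finite V" and deg: "\<forall>v\<in>V. node_degree V E v \<ge> k"
    and "\<not> k_connected k V E"
  shows "\<exists>A\<subseteq>V. 2 * card A \<le> card V \<and> card (boundary V E A) < k \<and>
           (\<exists>a\<in>A. \<exists>b\<in>A. a \<noteq> b \<and> {a, b} \<in> E)"
proof -
  obtain X v where X: "X \<subseteq> V" "X \<noteq> {}" "v \<in> V - X - boundary V E X" "card (boundary V E X) < k"
    using not_k_connected_imp_cut[OF assms] by blast
  define Y where "Y = V - X - boundary V E X"
  have Y: "Y \<subseteq> V" "Y \<noteq> {}" using X by (auto simp: Y_def)
  have "finite (boundary V E X)" using fin by (simp add: boundary_def)
  then have "card (boundary V E Y) \<le> card (boundary V E X)"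
    unfolding Y_def by (rule card_mono[OF _ boundary_complement_subset])
  then have boundary_Y: "card (boundary V E Y) < k" using X(4) by simp
  have "card X + card Y = card (X \<union> Y)"
    using fin X(1) Y(1)
    by (intro card_Un_disjoint[symmetric]) (auto simp: Y_def intro: finite_subset)
  also have "\<dots> \<le> card V" using fin X Y by (intro card_mono) auto
  finally have "2 * card X \<le> card V \<or> 2 * card Y \<le> card V" by linarith
  then show ?thesis
    using small_boundary_contains_edge[OF fin deg] X Y boundary_Y by metis
qed

lemma min_degree_ge_iff:
  assumes "finite V" "V \<noteq> {}"
  shows "min_degree V E \<ge> k \<longleftrightarrow> (\<forall>v\<in>V. node_degree V E v \<ge> k)"
  unfolding min_degree_def using assms by (subst Min_ge_iff) auto

section \<open>Products of probability mass functions\<close>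

abbreviation (input) prob :: "'a pmf \<Rightarrow> 'a set \<Rightarrow> real" where
  "prob p A \<equiv> measure_pmf.prob p A"

abbreviation (input) expect :: "'a pmf \<Rightarrow> ('a \<Rightarrow> real) \<Rightarrow> real" where
  "expect p f \<equiv> measure_pmf.expectation p f"

lemma expect_mono:
  assumes "finite (set_pmf p)" "\<And>x. x \<in> set_pmf p \<Longrightarrow> f x \<le> g x"
  shows "expect p f \<le> expect p g"
  using assms
  by (intro integral_mono_AE) (auto simp: AE_measure_pmf_iff integrable_measure_pmf_finite)

lemma prob_eq_expect: "prob p A = expect p (\<lambda>x. of_bool (x \<in> A))"
proof -
  have "(\<lambda>x. of_bool (x \<in> A) :: real) = indicator A" by (auto simp: indicator_def)
  then show ?thesis by simp
qed

lemma prob_mono_on_support: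
  assumes "\<And>x. x \<in> set_pmf p \<Longrightarrow> x \<in> A \<Longrightarrow> x \<in> B"
  shows "prob p A \<le> prob p B"
  using assms by (intro measure_pmf.finite_measure_mono_AE) (auto simp: AE_measure_pmf_iff)

lemma prob_union_bound:
  assumes "finite I" "\<And>x. x \<in> set_pmf p \<Longrightarrow> x \<in> A \<Longrightarrow> \<exists>i\<in>I. x \<in> B i"
  shows "prob p A \<le> (\<Sum>i\<in>I. prob p (B i))"
proof -
  have "prob p A \<le> prob p (\<Union>i\<in>I. B i)"
    using assms(2) by (intro prob_mono_on_support) auto
  also have "\<dots> \<le> (\<Sum>i\<in>I. prob p (B i))"
    by (rule measure_pmf.finite_measure_subadditive_finite) (use assms(1) in auto)
  finally show ?thesis .
qed

lemma prob_pair_pmf: "prob (pair_pmf p q) X = expect p (\<lambda>x. prob q {y. (x, y) \<in> X})"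
proof -
  have "ennreal (prob (pair_pmf p q) X) = (\<integral>\<^sup>+x. \<integral>\<^sup>+y. indicator X (x, y) \<partial>q \<partial>p)"
    by (simp add: nn_integral_pair_pmf'[symmetric] measure_pmf.emeasure_eq_measure[symmetric])
  also have "\<dots> = (\<integral>\<^sup>+x. \<integral>\<^sup>+y. indicator {y. (x, y) \<in> X} y \<partial>q \<partial>p)"
    by (simp add: indicator_def)
  also have "\<dots> = (\<integral>\<^sup>+x. ennreal (prob q {y. (x, y) \<in> X}) \<partial>p)"
    by (simp add: measure_pmf.emeasure_eq_measure)
  also have "\<dots> = ennreal (expect p (\<lambda>x. prob q {y. (x, y) \<in> X}))"
    by (intro nn_integral_eq_integral measure_pmf.integrable_const_bound[where B = 1]) auto
  finally show ?thesis
    by (subst (asm) ennreal_inj) (auto intro: Bochner_Integration.integral_nonneg)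
qed

lemma expect_pair_pmf_finite:
  assumes "finite (set_pmf p)" "finite (set_pmf q)"
  shows "expect (pair_pmf p q) f = expect q (\<lambda>y. expect p (\<lambda>x. f (x, y)))"
proof -
  have "expect (pair_pmf p q) f = (\<Sum>z\<in>set_pmf p \<times> set_pmf q. f z * pmf (pair_pmf p q) z)"
    by (rule integral_measure_pmf_real) (use assms in auto)
  also have "\<dots> = (\<Sum>x\<in>set_pmf p. \<Sum>y\<in>set_pmf q. f (x, y) * (pmf p x * pmf q y))"
    unfolding sum.cartesian_product by (rule sum.cong) (auto simp: pmf_pair)
  also have "\<dots> = (\<Sum>y\<in>set_pmf q. (\<Sum>x\<in>set_pmf p. f (x, y) * pmf p x) * pmf q y)"
    by (subst sum.swap) (simp add: sum_distrib_left sum_distrib_right mult_ac)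
  also have "\<dots> = (\<Sum>y\<in>set_pmf q. expect p (\<lambda>x. f (x, y)) * pmf q y)"
    using integral_measure_pmf_real[OF assms(1)] by auto
  also have "\<dots> = expect q (\<lambda>y. expect p (\<lambda>x. f (x, y)))"
    by (rule integral_measure_pmf_real[symmetric]) (use assms in auto)
  finally show ?thesis .
qed

lemma finite_set_Pi_pmf:
  assumes "finite A" "\<And>x. x \<in> A \<Longrightarrow> finite (set_pmf (p x))"
  shows "finite (set_pmf (Pi_pmf A d p))"
  using assms by (simp add: set_Pi_pmf finite_PiE_dflt)

lemma set_Pi_pmf_component:
  assumes "finite A" "f \<in> set_pmf (Pi_pmf A d p)" "x \<in> A"
  shows "f x \<in> set_pmf (p x)"
  using assms by (auto simp: set_Pi_pmf PiE_dflt_def)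

lemma prob_Pi_pmf_component:
  assumes "finite A" "x \<in> A"
  shows "prob (Pi_pmf A d p) {g. g x \<in> H} = prob (p x) H"
proof -
  have "prob (p x) H = prob (map_pmf (\<lambda>f. f x) (Pi_pmf A d p)) H"
    using assms by (simp add: Pi_pmf_component)
  then show ?thesis by (simp add: vimage_def)
qed

lemma prob_Pi_pmf_split:
  assumes "finite V" "A \<subseteq> V"
  shows "prob (Pi_pmf V d p) X =
           expect (Pi_pmf A d p) (\<lambda>f. prob (Pi_pmf (V - A) d p) {g. override_on g f A \<in> X})"
proof -
  have "V = A \<union> (V - A)" using assms(2) by blast
  then have "Pi_pmf V d p
      = map_pmf (\<lambda>(f, g). override_on g f A) (pair_pmf (Pi_pmf A d p) (Pi_pmf (V - A) d p))"
    using Pi_pmf_union[of A "V - A" d p] assms finite_subset[OF assms(2,1)]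
    by (simp add: override_on_def)
  then show ?thesis by (simp add: prob_pair_pmf vimage_def case_prod_unfold)
qed

lemma prob_Pi_pmf_indep:
  assumes "finite V" "A \<subseteq> V"
    and X: "\<And>f g. override_on g f A \<in> X \<longleftrightarrow> f \<in> X'"
    and Y: "\<And>f g. override_on g f A \<in> Y \<longleftrightarrow> g \<in> Y'"
  shows "prob (Pi_pmf V d p) (X \<inter> Y) = prob (Pi_pmf A d p) X' * prob (Pi_pmf (V - A) d p) Y'"
proof -
  have "prob (Pi_pmf V d p) (X \<inter> Y)
      = expect (Pi_pmf A d p) (\<lambda>f. of_bool (f \<in> X') * prob (Pi_pmf (V - A) d p) Y')"
    unfolding prob_Pi_pmf_split[OF assms(1,2)]
    by (intro arg_cong[where f = "expect _"] ext) (simp add: X Y)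
  then show ?thesis by (simp add: prob_eq_expect[of "Pi_pmf A d p"])
qed

section \<open>Independent identically distributed trials\<close>

definition exact_hits :: "'b set \<Rightarrow> ('v \<Rightarrow> 'b set) \<Rightarrow> nat \<Rightarrow> 'v set \<Rightarrow> 'a set \<Rightarrow> ('a \<Rightarrow> 'b) set" where
  "exact_hits H0 H m A B =
     {g. (\<forall>v\<in>A. card {w \<in> B. g w \<in> H v} = m) \<and> (\<forall>w\<in>B. g w \<in> H0 \<union> (\<Union>v\<in>A. H v))}"

lemma exact_hits_hit_set:
  assumes "disjoint_family_on H (insert a A)" "a \<notin> A" "H a \<inter> H0 = {}" "X \<subseteq> B"
    and "\<forall>w\<in>X. g w \<in> H a" "g \<in> exact_hits H0 H m A (B - X)"
  shows "{w \<in> B. g w \<in> H a} = X"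
proof -
  have "g w \<notin> H a" if "w \<in> B - X" for w
    using that assms(1,3,6) unfolding exact_hits_def disjoint_family_on_insert[OF assms(2)] by blast
  then show ?thesis using assms(4,5) by auto
qed

lemma hit_set_Diff:
  assumes "disjoint_family_on H (insert a A)" "a \<notin> A" "v \<in> A" "\<forall>w\<in>X. g w \<in> H a"
  shows "{w \<in> B - X. g w \<in> H v} = {w \<in> B. g w \<in> H v}"
  using assms(3,4) assms(1)[unfolded disjoint_family_on_insert[OF assms(2)]] by blast

lemma exact_hits_insertI:
  assumes disjoint: "disjoint_family_on H (insert a A)" "a \<notin> A" "H a \<inter> H0 = {}"
    and X: "X \<subseteq> B" "card X = m" "\<forall>w\<in>X. g w \<in> H a" and g: "g \<in> exact_hits H0 H m A (B - X)"
  shows "g \<in> exact_hits H0 H m (insert a A) B"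
  unfolding exact_hits_def
proof (intro CollectI conjI ballI)
  fix v assume "v \<in> insert a A"
  then show "card {w \<in> B. g w \<in> H v} = m"
  proof
    assume "v = a"
    then show ?thesis using exact_hits_hit_set[OF disjoint X(1,3) g] X(2) by simp
  next
    assume v: "v \<in> A"
    have "card {w \<in> B - X. g w \<in> H v} = m" using g v unfolding exact_hits_def by blast
    then show ?thesis unfolding hit_set_Diff[OF disjoint(1,2) v X(3)] .
  qed
next
  fix w assume "w \<in> B"
  then show "g w \<in> H0 \<union> (\<Union>v\<in>insert a A. H v)"
    using g X(3) by (cases "w \<in> X") (auto simp: exact_hits_def)
qed

lemma exact_hits_insert:
  assumes disjoint: "disjoint_family_on H (insert a A)" "a \<notin> A" "H a \<inter> H0 = {}"
  shows "exact_hits H0 H m (insert a A) B =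
    (\<Union>X\<in>{X. X \<subseteq> B \<and> card X = m}. {g. \<forall>w\<in>X. g w \<in> H a} \<inter> exact_hits H0 H m A (B - X))"
    (is "?E = ?F")
proof
  show "?E \<subseteq> ?F"
  proof
    fix g assume g: "g \<in> ?E"
    define X where "X = {w \<in> B. g w \<in> H a}"
    have hits: "\<forall>w\<in>X. g w \<in> H a" by (simp add: X_def)
    have "g \<in> exact_hits H0 H m A (B - X)"
      unfolding exact_hits_def
    proof (intro CollectI conjI ballI)
      fix v assume v: "v \<in> A"
      then show "card {w \<in> B - X. g w \<in> H v} = m"
        using g hit_set_Diff[OF disjoint(1,2) v hits, of B] by (simp add: exact_hits_def)
    qed (use g in \<open>auto simp: exact_hits_def X_def\<close>)
    moreover have "X \<in> {X. X \<subseteq> B \<and> card X = m}" using g by (auto simp: X_def exact_hits_def)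
    ultimately show "g \<in> ?F" using hits by blast
  qed
  show "?F \<subseteq> ?E" using exact_hits_insertI[OF disjoint] by blast
qed

lemma prob_hits_and_exact_hits:
  assumes "finite B" "X \<subseteq> B"
  shows "prob (Pi_pmf B d (\<lambda>_. p)) ({g. \<forall>w\<in>X. g w \<in> D} \<inter> exact_hits H0 H m A (B - X))
    = prob p D ^ card X * prob (Pi_pmf (B - X) d (\<lambda>_. p)) (exact_hits H0 H m A (B - X))"
proof -
  have "prob (Pi_pmf B d (\<lambda>_. p)) ({g. \<forall>w\<in>X. g w \<in> D} \<inter> exact_hits H0 H m A (B - X))
      = prob (Pi_pmf X d (\<lambda>_. p)) (Pi X (\<lambda>_. D))
        * prob (Pi_pmf (B - X) d (\<lambda>_. p)) (exact_hits H0 H m A (B - X))"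
    using assms
    by (intro prob_Pi_pmf_indep) (auto simp: exact_hits_def override_on_def Pi_def cong: conj_cong)
  then show ?thesis using finite_subset[OF assms(2,1)] by (simp add: measure_Pi_pmf_Pi)
qed

lemma prob_exact_hits:
  fixes p :: "'b pmf" and H :: "'v \<Rightarrow> 'b set" and B :: "'a set"
  assumes "finite A" "finite B" "disjoint_family_on H A" "\<And>v. v \<in> A \<Longrightarrow> H v \<inter> H0 = {}"
  shows "prob (Pi_pmf B d (\<lambda>_. p)) (exact_hits H0 H m A B)
    = real (\<Prod>i<card A. (card B - i * m) choose m) * (\<Prod>v\<in>A. prob p (H v)) ^ m
      * prob p H0 ^ (card B - card A * m)"
  using assms
proof (induction A arbitrary: B rule: finite_induct)
  case empty
  have "exact_hits H0 H m {} B = Pi B (\<lambda>_. H0)" by (auto simp: exact_hits_def Pi_def)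
  then show ?case using empty by (simp add: measure_Pi_pmf_Pi)
next
  case (insert a A)
  let ?M = "\<lambda>B. Pi_pmf B d (\<lambda>_. p)"
  let ?Bs = "{X. X \<subseteq> B \<and> card X = m}"
  let ?hits = "\<lambda>X :: 'a set. {g. \<forall>w\<in>X. g w \<in> H a}"
  let ?b = "real (\<Prod>i<card A. (card B - m - i * m) choose m) * (\<Prod>v\<in>A. prob p (H v)) ^ m
    * prob p H0 ^ (card B - m - card A * m)"
  have H0: "H a \<inter> H0 = {}" using insert.prems(3) by simp
  note hit_set = exact_hits_hit_set[OF insert.prems(2) insert.hyps(2) H0]
  have "prob (?M B) (exact_hits H0 H m (insert a A) B)
      = (\<Sum>X\<in>?Bs. prob (?M B) (?hits X \<inter> exact_hits H0 H m A (B - X)))"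
    unfolding exact_hits_insert[OF insert.prems(2) insert.hyps(2) H0]
  proof (rule measure_pmf.finite_measure_finite_Union)
    show "disjoint_family_on (\<lambda>X. ?hits X \<inter> exact_hits H0 H m A (B - X)) ?Bs"
      unfolding disjoint_family_on_def using hit_set by blast
  qed (use insert.prems(1) in auto)
  also have "\<dots> = (\<Sum>X\<in>?Bs. prob p (H a) ^ m * ?b)"
  proof (rule sum.cong[OF refl])
    fix X assume "X \<in> ?Bs"
    then have X: "X \<subseteq> B" "card X = m" by auto
    have card_BX: "card (B - X) = card B - m"
      using insert.prems(1) X by (auto simp: card_Diff_subset finite_subset)
    have IH: "prob (?M (B - X)) (exact_hits H0 H m A (B - X)) = ?b"
      unfolding card_BX[symmetric]
      using insert.prems by (intro insert.IH) (auto simp: disjoint_family_on_def)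
    show "prob (?M B) (?hits X \<inter> exact_hits H0 H m A (B - X)) = prob p (H a) ^ m * ?b"
      by (simp only: prob_hits_and_exact_hits[OF insert.prems(1) X(1)] X(2) IH)
  qed
  also have "\<dots> = real (card B choose m) * (prob p (H a) ^ m * ?b)"
    by (simp add: n_subsets[OF insert.prems(1)])
  finally show ?case
    using insert.hyps
    by (simp add: prod.lessThan_Suc_shift power_mult_distrib mult_ac del: prod.lessThan_Suc)
qed

lemma prob_iid_card_eq:
  fixes p :: "'b pmf" and B :: "'a set"
  assumes "finite B"
  shows "prob (Pi_pmf B d (\<lambda>_. p)) {g. card {w \<in> B. g w \<in> H} = i}
    = real (card B choose i) * prob p H ^ i * prob p (- H) ^ (card B - i)"
  using prob_exact_hits[of "{()}" B "\<lambda>_. H" "- H" d p i] assms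
  by (simp add: disjoint_family_on_def exact_hits_def)

lemma prob_iid_card_le:
  fixes p :: "'b pmf" and B :: "'a set"
  assumes "finite B" "prob p H \<le> x" "prob p (- H) \<le> y" "y \<le> 1"
  shows "prob (Pi_pmf B d (\<lambda>_. p)) {g. card {w \<in> B. g w \<in> H} \<le> q}
     \<le> (\<Sum>i\<le>q. real (card B choose i) * x ^ i) * y ^ (card B - q)"
proof -
  have nonneg: "0 \<le> x" "0 \<le> y" using assms measure_nonneg order_trans by blast+
  have "prob (Pi_pmf B d (\<lambda>_. p)) {g. card {w \<in> B. g w \<in> H} \<le> q}
      \<le> (\<Sum>i\<le>q. prob (Pi_pmf B d (\<lambda>_. p)) {g. card {w \<in> B. g w \<in> H} = i})"
    by (rule prob_union_bound) auto
  also have "\<dots> \<le> (\<Sum>i\<le>q. real (card B choose i) * x ^ i * y ^ (card B - q))"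
    unfolding prob_iid_card_eq[OF assms(1)]
  proof (intro sum_mono mult_mono power_mono)
    fix i assume "i \<in> {..q}"
    then have "y ^ (card B - i) \<le> y ^ (card B - q)"
      using nonneg assms(4) by (intro power_decreasing) auto
    moreover have "prob p (- H) ^ (card B - i) \<le> y ^ (card B - i)"
      using assms(3) by (intro power_mono) auto
    ultimately show "prob p (- H) ^ (card B - i) \<le> y ^ (card B - q)" by linarith
  qed (use assms nonneg in auto)
  finally show ?thesis by (simp add: sum_distrib_right)
qed

lemma binomial_partial_sum_le:
  fixes x :: real
  assumes "x \<ge> 0"
  shows "(\<Sum>i\<le>q. real (N choose i) * x ^ i) \<le> (1 + real N * x) ^ q"
proof -
  have "(\<Sum>i\<le>q. real (N choose i) * x ^ i) \<le> (\<Sum>i\<le>q. real (q choose i) * (real N * x) ^ i)"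
  proof (rule sum_mono)
    fix i assume "i \<in> {..q}"
    then have "1 \<le> q choose i" by (simp add: Suc_leI)
    moreover have "N choose i \<le> N ^ i"
      by (cases "i \<le> N") (auto intro: binomial_le_pow simp: binomial_eq_0)
    ultimately have "N choose i \<le> (q choose i) * N ^ i" using mult_le_mono by fastforce
    then have "real (N choose i) \<le> real (q choose i) * real N ^ i"
      by (metis of_nat_le_iff of_nat_mult of_nat_power)
    then show "real (N choose i) * x ^ i \<le> real (q choose i) * (real N * x) ^ i"
      using assms by (simp add: power_mult_distrib mult_right_mono mult.assoc[symmetric])
  qed
  also have "\<dots> = (real N * x + 1) ^ q" by (subst binomial_ring) simp
  finally show ?thesis by (simp add: add.commute)
qed

lemma binomial_partial_sum_le_pow2: "(\<Sum>i\<le>q. N choose i) \<le> 2 ^ N"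
proof -
  have "(\<Sum>i\<le>q. N choose i) = (\<Sum>i\<in>{..q} \<inter> {..N}. N choose i)"
    by (rule sum.mono_neutral_right) auto
  also have "\<dots> \<le> (\<Sum>i\<le>N. N choose i)" by (rule sum_mono2) auto
  finally show ?thesis by (simp add: choose_row_sum)
qed

lemma prob_iid_card_le_and_ex:
  fixes p :: "'b pmf" and B :: "'a set"
  assumes fin: "finite B" and x: "prob p H \<le> x" and y: "prob p (- H) \<le> y" "y \<le> 1"
    and z: "prob p H' \<le> z"
  shows "prob (Pi_pmf B d (\<lambda>_. p)) {g. card {w \<in> B. g w \<in> H} \<le> q \<and> (\<exists>w\<in>B. g w \<in> H')}
     \<le> real (card B) * (z * ((1 + real (card B) * x) ^ q * y ^ (card B - 1 - q)))"
proof -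
  have nonneg: "0 \<le> x" "0 \<le> y" "0 \<le> z" using x y z measure_nonneg order_trans by blast+
  let ?M = "Pi_pmf B d (\<lambda>_. p)"
  let ?R = "(1 + real (card B) * x) ^ q * y ^ (card B - 1 - q)"
  let ?few = "\<lambda>B. {g. card {v \<in> B. g v \<in> H} \<le> q}"
  have "prob ?M {g. card {w \<in> B. g w \<in> H} \<le> q \<and> (\<exists>w\<in>B. g w \<in> H')}
     \<le> (\<Sum>w\<in>B. prob ?M ({g. g w \<in> H'} \<inter> ?few (B - {w})))"
  proof (rule prob_union_bound[OF fin])
    fix g assume g: "g \<in> {g. card {w \<in> B. g w \<in> H} \<le> q \<and> (\<exists>w\<in>B. g w \<in> H')}"
    then obtain w where w: "w \<in> B" "g w \<in> H'" by auto
    have "card {v \<in> B - {w}. g v \<in> H} \<le> card {v \<in> B. g v \<in> H}" using fin by (intro card_mono) auto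
    then show "\<exists>w\<in>B. g \<in> {g. g w \<in> H'} \<inter> ?few (B - {w})" using g w by fastforce
  qed
  also have "\<dots> \<le> (\<Sum>w\<in>B. z * ?R)"
  proof (rule sum_mono)
    fix w assume w: "w \<in> B"
    have "prob ?M ({g. g w \<in> H'} \<inter> ?few (B - {w}))
      = prob (Pi_pmf {w} d (\<lambda>_. p)) {f. f w \<in> H'} * prob (Pi_pmf (B - {w}) d (\<lambda>_. p)) (?few (B - {w}))"
      using fin w by (intro prob_Pi_pmf_indep) (auto simp: override_on_def cong: conj_cong)
    also have "\<dots> \<le> z * ?R"
    proof (rule mult_mono)
      have "prob (Pi_pmf (B - {w}) d (\<lambda>_. p)) (?few (B - {w}))
          \<le> (\<Sum>i\<le>q. real (card (B - {w}) choose i) * x ^ i) * y ^ (card (B - {w}) - q)"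
        using fin by (intro prob_iid_card_le x y) auto
      also have "\<dots> \<le> (1 + real (card (B - {w})) * x) ^ q * y ^ (card (B - {w}) - q)"
        using nonneg by (intro mult_right_mono binomial_partial_sum_le) auto
      also have "\<dots> \<le> (1 + real (card B) * x) ^ q * y ^ (card (B - {w}) - q)"
        using nonneg fin by (intro mult_right_mono power_mono add_left_mono) (auto intro: card_mono)
      finally show "prob (Pi_pmf (B - {w}) d (\<lambda>_. p)) (?few (B - {w})) \<le> ?R" using w fin by simp
    qed (use z nonneg in \<open>auto simp: prob_Pi_pmf_component\<close>)
    finally show "prob ?M ({g. g w \<in> H'} \<inter> ?few (B - {w})) \<le> z * ?R" .
  qed
  finally show ?thesis by simp
qed

section \<open>Uniform object sets\<close>

definition object_sets :: "nat \<Rightarrow> nat \<Rightarrow> nat set set" where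
  "object_sets P K = {A. A \<subseteq> {..<P} \<and> card A = K}"

abbreviation object_pmf :: "nat \<Rightarrow> nat \<Rightarrow> nat set pmf" where
  "object_pmf P K \<equiv> pmf_of_set (object_sets P K)"

abbreviation objects_pmf :: "'a set \<Rightarrow> nat \<Rightarrow> nat \<Rightarrow> ('a \<Rightarrow> nat set) pmf" where
  "objects_pmf V P K \<equiv> Pi_pmf V {} (\<lambda>_. object_pmf P K)"

definition edge_rate :: "nat \<Rightarrow> nat \<Rightarrow> real" where
  "edge_rate P K = (real K)\<^sup>2 / real P"

lemma edge_rate_nonneg [simp]: "0 \<le> edge_rate P K"
  by (simp add: edge_rate_def)

lemma finite_object_sets [simp]: "finite (object_sets P K)"
  by (simp add: object_sets_def)

lemma card_object_sets: "card (object_sets P K) = P choose K"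
  unfolding object_sets_def using n_subsets[of "{..<P}" K] by simp

lemma choose_ratio_diag_le:
  assumes "j \<le> K" "K \<le> P" "P \<ge> 1"
  shows "real ((P - j) choose (K - j)) \<le> (real K / real P) ^ j * real (P choose K)"
  using assms
proof (induction j)
  case (Suc j)
  have "(K - j) * ((P - j) choose (K - j)) = (P - j) * ((P - Suc j) choose (K - Suc j))"
    using times_binomial_minus1_eq[of "K - j" "P - j"] Suc.prems by simp
  then have "real (K - j) * real ((P - j) choose (K - j))
      = real (P - j) * real ((P - Suc j) choose (K - Suc j))"
    by (metis of_nat_mult)
  then have ratio: "real ((P - Suc j) choose (K - Suc j))
      = real (K - j) / real (P - j) * real ((P - j) choose (K - j))"
    using Suc.prems by (simp add: field_simps)
  have "(real K - real j) * real P \<le> real K * (real P - real j)"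
    using Suc.prems by (simp add: algebra_simps mult_right_mono)
  then have "real (K - j) / real (P - j) \<le> real K / real P"
    using Suc.prems by (simp add: divide_simps of_nat_diff)
  then have "real ((P - Suc j) choose (K - Suc j))
      \<le> real K / real P * real ((P - j) choose (K - j))"
    unfolding ratio by (intro mult_right_mono) auto
  also have "\<dots> \<le> real K / real P * ((real K / real P) ^ j * real (P choose K))"
    using Suc by (intro mult_left_mono) auto
  finally show ?case by simp
qed simp

lemma choose_ratio_prod:
  assumes "K + u \<le> P"
  shows "real ((P - u) choose K) = (\<Prod>i<u. 1 - real K / real (P - i)) * real (P choose K)"
  using assms
proof (induction u)
  case (Suc u)
  have "(P - u - K) * ((P - u) choose K) = (P - u) * ((P - Suc u) choose K)"
    using binomial_absorb_comp[of "P - u" K] by simp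
  then have "real (P - u - K) * real ((P - u) choose K)
      = real (P - u) * real ((P - Suc u) choose K)"
    by (metis of_nat_mult)
  then have "real ((P - Suc u) choose K) = (1 - real K / real (P - u)) * real ((P - u) choose K)"
    using Suc.prems by (simp add: of_nat_diff field_simps)
  then show ?case using Suc by simp
qed simp

lemma exp_le_one_minus:
  fixes z :: real
  assumes "z < 1"
  shows "exp (- (z / (1 - z))) \<le> 1 - z"
proof -
  have "1 / (1 - z) = 1 + z / (1 - z)" using assms by (simp add: field_simps)
  also have "\<dots> \<le> exp (z / (1 - z))" by (rule exp_ge_add_one_self)
  finally show ?thesis using assms by (simp add: exp_minus field_simps)
qed

lemma exp_minus_le_quadratic:
  fixes x :: real
  assumes "0 \<le> x"
  shows "exp (- x) \<le> 1 - x + x\<^sup>2"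
proof -
  have "(1 - x + x\<^sup>2) * (1 + x) = 1 + x ^ 3"
    by (simp add: algebra_simps power2_eq_square power3_eq_cube)
  then have "1 \<le> (1 - x + x\<^sup>2) * (1 + x)" using assms by simp
  then have "1 / (1 + x) \<le> 1 - x + x\<^sup>2" using assms by (simp add: divide_le_eq)
  moreover have "1 / exp x \<le> 1 / (1 + x)"
    using exp_ge_add_one_self[of x] assms by (intro divide_left_mono) auto
  ultimately show ?thesis by (simp add: exp_minus inverse_eq_divide)
qed

lemma sum_Pow_power_card:
  fixes c :: real
  assumes "finite W"
  shows "(\<Sum>J\<in>Pow W. c ^ card J) = (1 + c) ^ card W"
  using prod_add[OF assms, of "\<lambda>_. c" "\<lambda>_. 1"] by (simp add: add.commute)

locale object_pool =
  fixes P K :: nat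
  assumes K_pos: "1 \<le> K" and K_le_P: "K \<le> P"
begin

abbreviation \<theta> :: real where "\<theta> \<equiv> edge_rate P K"

lemma object_sets_nonempty: "object_sets P K \<noteq> {}"
  using card_object_sets[of P K] K_le_P
  by (metis card.empty zero_less_binomial less_numeral_extra(3))

lemma set_object_pmf: "set_pmf (object_pmf P K) = object_sets P K"
  by (simp add: object_sets_nonempty)

lemma finite_set_object_pmf: "finite (set_pmf (object_pmf P K))"
  by (simp add: set_object_pmf del: set_pmf_of_set)

lemma finite_set_objects_pmf: "finite V \<Longrightarrow> finite (set_pmf (objects_pmf V P K))"
  by (intro finite_set_Pi_pmf finite_set_object_pmf)

lemma prob_object_pmf:
  "prob (object_pmf P K) X = real (card (object_sets P K \<inter> X)) / real (P choose K)"
  by (simp add: measure_pmf_of_set object_sets_nonempty card_object_sets)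

lemma prob_superset_le:
  assumes "finite J"
  shows "prob (object_pmf P K) {S. J \<subseteq> S} \<le> (real K / real P) ^ card J"
proof (cases "J \<subseteq> {..<P} \<and> card J \<le> K")
  case False
  have "card J \<le> K \<and> J \<subseteq> {..<P}" if "S \<in> object_sets P K" "J \<subseteq> S" for S
    using that card_mono[of S J] finite_subset[of S "{..<P}"] by (auto simp: object_sets_def)
  then have "object_sets P K \<inter> {S. J \<subseteq> S} = {}" using False by auto
  then show ?thesis by (simp add: prob_object_pmf)
next
  case True
  have "card (object_sets P K \<inter> {S. J \<subseteq> S}) = card {T. T \<subseteq> {..<P} - J \<and> card T = K - card J}"
  proof (rule bij_betw_same_card[of "\<lambda>S. S - J"], rule bij_betwI[where g = "\<lambda>T. T \<union> J"])
    show "(\<lambda>S. S - J) \<in> object_sets P K \<inter> {S. J \<subseteq> S} \<rightarrow> {T. T \<subseteq> {..<P} - J \<and> card T = K - card J}"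
      using assms by (auto simp: object_sets_def card_Diff_subset)
    show "(\<lambda>T. T \<union> J) \<in> {T. T \<subseteq> {..<P} - J \<and> card T = K - card J} \<rightarrow> object_sets P K \<inter> {S. J \<subseteq> S}"
    proof
      fix T assume T: "T \<in> {T. T \<subseteq> {..<P} - J \<and> card T = K - card J}"
      then have "finite T" by (auto intro: finite_subset)
      then have "card (T \<union> J) = card T + card J" using T assms by (intro card_Un_disjoint) auto
      then show "T \<union> J \<in> object_sets P K \<inter> {S. J \<subseteq> S}" using T True by (auto simp: object_sets_def)
    qed
  qed auto
  also have "\<dots> = (P - card J) choose (K - card J)"
    using n_subsets[of "{..<P} - J" "K - card J"] True assms by (simp add: card_Diff_subset)
  finally show ?thesis
    using choose_ratio_diag_le[of "card J" K P] True K_pos K_le_P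
    by (simp add: prob_object_pmf field_simps)
qed

lemma prob_hit_le:
  assumes "finite U"
  shows "prob (object_pmf P K) {S. S \<inter> U \<noteq> {}} \<le> real (card U) * (real K / real P)"
proof -
  have "prob (object_pmf P K) {S. S \<inter> U \<noteq> {}} \<le> (\<Sum>a\<in>U. prob (object_pmf P K) {S. {a} \<subseteq> S})"
    by (rule prob_union_bound) (use assms in auto)
  also have "\<dots> \<le> (\<Sum>a\<in>U. real K / real P)"
    using prob_superset_le[of "{_}"] by (intro sum_mono) simp
  finally show ?thesis by simp
qed

lemma prob_hit_both_le:
  assumes "finite U" "finite W" "U \<inter> W = {}"
  shows "prob (object_pmf P K) {S. S \<inter> U \<noteq> {} \<and> S \<inter> W \<noteq> {}}
    \<le> real (card U) * real (card W) * (real K / real P)\<^sup>2"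
proof -
  have "prob (object_pmf P K) {S. S \<inter> U \<noteq> {} \<and> S \<inter> W \<noteq> {}}
      \<le> (\<Sum>z\<in>U \<times> W. prob (object_pmf P K) {S. {fst z, snd z} \<subseteq> S})"
    by (rule prob_union_bound) (use assms in fastforce)+
  also have "\<dots> \<le> (\<Sum>z\<in>U \<times> W. (real K / real P)\<^sup>2)"
  proof (rule sum_mono)
    fix z assume "z \<in> U \<times> W"
    then have "card {fst z, snd z} = 2" using assms(3) by (auto simp: card_insert_if)
    then show "prob (object_pmf P K) {S. {fst z, snd z} \<subseteq> S} \<le> (real K / real P)\<^sup>2"
      using prob_superset_le[of "{fst z, snd z}"] by simp
  qed
  finally show ?thesis by (simp add: card_cartesian_product)
qed

lemma prob_miss_eq:
  assumes "U \<subseteq> {..<P}"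
  shows "prob (object_pmf P K) {S. S \<inter> U = {}} = real ((P - card U) choose K) / real (P choose K)"
proof -
  have "object_sets P K \<inter> {S. S \<inter> U = {}} = {T. T \<subseteq> {..<P} - U \<and> card T = K}"
    by (auto simp: object_sets_def)
  moreover have "card ({..<P} - U) = P - card U"
    using assms by (simp add: card_Diff_subset finite_subset)
  ultimately have "card (object_sets P K \<inter> {S. S \<inter> U = {}}) = (P - card U) choose K"
    using n_subsets[of "{..<P} - U" K] by simp
  then show ?thesis by (simp add: prob_object_pmf)
qed

lemma prob_miss_eq_prod:
  assumes "U \<subseteq> {..<P}" "K + card U \<le> P"
  shows "prob (object_pmf P K) {S. S \<inter> U = {}} = (\<Prod>i<card U. 1 - real K / real (P - i))"
  using choose_ratio_prod[OF assms(2)] K_le_P by (simp add: prob_miss_eq[OF assms(1)])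

lemma prob_miss_le:
  assumes "U \<subseteq> {..<P}"
  shows "prob (object_pmf P K) {S. S \<inter> U = {}} \<le> exp (- (real (card U) * (real K / real P)))"
proof (cases "K + card U \<le> P")
  case True
  have "(\<Prod>i<card U. 1 - real K / real (P - i)) \<le> (\<Prod>i<card U. exp (- (real K / real P)))"
  proof (rule prod_mono, rule conjI)
    fix i assume "i \<in> {..<card U}"
    then have i: "K \<le> P - i" "0 < P - i" using True K_pos by auto
    then show "0 \<le> 1 - real K / real (P - i)" by simp
    have "real K / real P \<le> real K / real (P - i)" using i by (intro divide_left_mono) auto
    then have "1 - real K / real (P - i) \<le> 1 + - (real K / real P)" by simp
    also have "\<dots> \<le> exp (- (real K / real P))" by (rule exp_ge_add_one_self)
    finally show "1 - real K / real (P - i) \<le> exp (- (real K / real P))" .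
  qed
  also have "\<dots> = exp (- (real (card U) * (real K / real P)))"
    by (simp add: exp_of_nat_mult[symmetric])
  finally show ?thesis using prob_miss_eq_prod[OF assms True] by simp
next
  case False
  then have "P - card U < K" using K_pos by linarith
  then show ?thesis by (simp add: prob_miss_eq[OF assms] binomial_eq_0)
qed

lemma prob_miss_ge:
  assumes "U \<subseteq> {..<P}" "K + card U < P"
  shows "exp (- (real (card U) * real K / real (P - card U - K)))
    \<le> prob (object_pmf P K) {S. S \<inter> U = {}}"
proof -
  have "exp (- (real (card U) * real K / real (P - card U - K)))
      = (\<Prod>i<card U. exp (- (real K / real (P - card U - K))))"
    by (simp add: exp_of_nat_mult[symmetric])
  also have "\<dots> \<le> (\<Prod>i<card U. 1 - real K / real (P - i))"
  proof (rule prod_mono, rule conjI)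
    fix i assume "i \<in> {..<card U}"
    then have i: "K < P - i" "P - card U - K \<le> P - i - K" "0 < P - card U - K"
      using assms(2) by auto
    have "x / y / (1 - x / y) = x / (y - x)" if "0 < y" for x y :: real
      using that by (cases "x = y") (simp_all add: field_simps)
    from this[of "real (P - i)" "real K"] i(1)
    have "real K / real (P - i) / (1 - real K / real (P - i)) = real K / real (P - i - K)"
      by (simp only: of_nat_diff[OF less_imp_le[OF i(1)]])
    also have "\<dots> \<le> real K / real (P - card U - K)"
      using i by (intro divide_left_mono) (auto intro: of_nat_mono)
    finally have "exp (- (real K / real (P - card U - K)))
        \<le> exp (- (real K / real (P - i) / (1 - real K / real (P - i))))" by simp
    also have "\<dots> \<le> 1 - real K / real (P - i)" using i(1) by (intro exp_le_one_minus) simp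
    finally show "exp (- (real K / real (P - card U - K))) \<le> 1 - real K / real (P - i)" .
  qed simp
  finally show ?thesis using prob_miss_eq_prod[OF assms(1)] assms(2) by simp
qed

text \<open>
  Expanding \<open>t ^ m = (1 + (t - 1)) ^ m\<close> over the subsets of \<open>S \<inter> U\<close> reduces the moment generating
  function to the inclusion probabilities.
\<close>

lemma expect_power_card_inter_le:
  fixes t :: real
  assumes "finite U" "t \<ge> 1"
  shows "expect (object_pmf P K) (\<lambda>S. t ^ card (S \<inter> U))
      \<le> exp ((t - 1) * (real (card U) * (real K / real P)))"
proof -
  have "t ^ card (S \<inter> U) = (\<Sum>J\<in>Pow U. (t - 1) ^ card J * of_bool (S \<in> {S. J \<subseteq> S}))" for S
  proof -
    have "t ^ card (S \<inter> U) = (\<Sum>J\<in>Pow (S \<inter> U). (t - 1) ^ card J)"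
      using sum_Pow_power_card[of "S \<inter> U" "t - 1"] assms(1) by simp
    also have "\<dots> = (\<Sum>J\<in>Pow U. (t - 1) ^ card J * of_bool (S \<in> {S. J \<subseteq> S}))"
      using assms(1) by (intro sum.mono_neutral_cong_left) auto
    finally show ?thesis .
  qed
  then have "expect (object_pmf P K) (\<lambda>S. t ^ card (S \<inter> U))
      = (\<Sum>J\<in>Pow U. (t - 1) ^ card J * prob (object_pmf P K) {S. J \<subseteq> S})"
    unfolding prob_eq_expect
    by (subst Bochner_Integration.integral_sum[symmetric] integral_mult_right_zero[symmetric])+
       (auto intro!: integrable_measure_pmf_finite finite_set_object_pmf)
  also have "\<dots> \<le> (\<Sum>J\<in>Pow U. (t - 1) ^ card J * (real K / real P) ^ card J)"
    using assms by (intro sum_mono mult_left_mono prob_superset_le) (auto intro: finite_subset)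
  also have "\<dots> = (1 + (t - 1) * (real K / real P)) ^ card U"
    using assms by (simp only: power_mult_distrib[symmetric] sum_Pow_power_card)
  also have "\<dots> \<le> exp ((t - 1) * (real K / real P)) ^ card U"
    using assms by (intro power_mono) (auto simp: exp_ge_add_one_self)
  also have "\<dots> = exp ((t - 1) * (real (card U) * (real K / real P)))"
    by (simp add: exp_of_nat_mult[symmetric] mult_ac)
  finally show ?thesis .
qed

lemma objects_pmf_component:
  assumes "finite V" "S \<in> set_pmf (objects_pmf V P K)" "i \<in> V"
  shows "S i \<subseteq> {..<P}" "card (S i) = K" "finite (S i)"
proof -
  have "S i \<in> object_sets P K"
    using set_Pi_pmf_component[OF assms] set_object_pmf by simp
  then show "S i \<subseteq> {..<P}" "card (S i) = K" by (auto simp: object_sets_def)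
  then show "finite (S i)" using finite_subset by blast
qed

lemma prob_hit_only_ge:
  assumes "finite A" "disjoint_family_on f A" "v \<in> A"
    and f: "\<And>b. b \<in> A \<Longrightarrow> f b \<subseteq> {..<P} \<and> card (f b) = K"
  shows "\<theta> * (1 - real (card A) * \<theta>)
    \<le> prob (object_pmf P K) {T. T \<inter> f v \<noteq> {} \<and> (\<forall>b\<in>A - {v}. T \<inter> f b = {})}"
proof -
  let ?Q = "object_pmf P K"
  let ?only = "{T. T \<inter> f v \<noteq> {} \<and> (\<forall>b\<in>A - {v}. T \<inter> f b = {})}"
  let ?both = "\<lambda>b. {T. T \<inter> f v \<noteq> {} \<and> T \<inter> f b \<noteq> {}}"
  have both: "prob ?Q (?both b) \<le> \<theta>\<^sup>2" if b: "b \<in> A - {v}" for b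
  proof -
    have "f v \<inter> f b = {}" "finite (f v)" "finite (f b)"
      using b assms finite_subset[of "f _" "{..<P}"] by (auto simp: disjoint_family_on_def)
    from prob_hit_both_le[OF this(2,3,1)] show ?thesis
      using b f assms(3) by (simp add: edge_rate_def power2_eq_square)
  qed
  have "1 = prob ?Q ({T. T \<inter> f v = {}} \<union> (?only \<union> (\<Union>b\<in>A - {v}. ?both b)))"
  proof -
    have "{T. T \<inter> f v = {}} \<union> (?only \<union> (\<Union>b\<in>A - {v}. ?both b)) = UNIV" by auto
    then show ?thesis by simp
  qed
  also have "\<dots> \<le> prob ?Q {T. T \<inter> f v = {}} + (prob ?Q ?only + prob ?Q (\<Union>b\<in>A - {v}. ?both b))"
    by (intro order_trans[OF measure_Un_le] add_mono order_refl) auto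
  also have "prob ?Q (\<Union>b\<in>A - {v}. ?both b) \<le> (\<Sum>b\<in>A - {v}. prob ?Q (?both b))"
    by (rule measure_pmf.finite_measure_subadditive_finite) (use assms(1) in auto)
  also have "\<dots> \<le> (\<Sum>b\<in>A - {v}. \<theta>\<^sup>2)" using both by (rule sum_mono)
  also have "\<dots> = (real (card A) - 1) * \<theta>\<^sup>2"
    using assms(1,3) card_gt_0_iff[of A] by (auto simp: of_nat_diff Suc_le_eq)
  also have "prob ?Q {T. T \<inter> f v = {}} \<le> exp (- \<theta>)"
    using prob_miss_le[of "f v"] f[OF assms(3)] by (simp add: edge_rate_def power2_eq_square)
  also have "\<dots> \<le> 1 - \<theta> + \<theta>\<^sup>2" by (rule exp_minus_le_quadratic) simp
  finally have "1 \<le> 1 - \<theta> + \<theta>\<^sup>2 + (prob ?Q ?only + (real (card A) - 1) * \<theta>\<^sup>2)" by simp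
  then show ?thesis by (simp add: algebra_simps power2_eq_square)
qed

end

section \<open>The objects of a set of nodes\<close>

definition objects_of :: "('a \<Rightarrow> 'b set) \<Rightarrow> 'a set \<Rightarrow> 'b set" where
  "objects_of S A = (\<Union>i\<in>A. S i)"

definition defect :: "nat \<Rightarrow> ('a \<Rightarrow> 'b set) \<Rightarrow> 'a set \<Rightarrow> nat" where
  "defect K S A = card A * K - card (objects_of S A)"

lemma card_UN_eq_sum_card_iff:
  assumes "finite A" "\<And>i. i \<in> A \<Longrightarrow> finite (S i)"
  shows "card (\<Union>i\<in>A. S i) = (\<Sum>i\<in>A. card (S i)) \<longleftrightarrow> disjoint_family_on S A"
  using assms
proof (induction A rule: finite_induct)
  case (insert a A)
  have "card (\<Union>i\<in>insert a A. S i) + card (S a \<inter> (\<Union>i\<in>A. S i)) = card (S a) + card (\<Union>i\<in>A. S i)"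
    using card_Un_Int[of "S a" "\<Union>i\<in>A. S i"] insert by simp
  moreover have "card (\<Union>i\<in>A. S i) \<le> (\<Sum>i\<in>A. card (S i))" using insert.hyps by (intro card_UN_le)
  moreover have "card (S a \<inter> (\<Union>i\<in>A. S i)) = 0 \<longleftrightarrow> S a \<inter> (\<Union>i\<in>A. S i) = {}"
    using insert.hyps insert.prems by simp
  ultimately have "card (\<Union>i\<in>insert a A. S i) = card (S a) + (\<Sum>i\<in>A. card (S i)) \<longleftrightarrow>
      S a \<inter> (\<Union>i\<in>A. S i) = {} \<and> card (\<Union>i\<in>A. S i) = (\<Sum>i\<in>A. card (S i))"
    by linarith
  then show ?case
    using insert.IH insert.prems disjoint_family_on_insert[OF insert.hyps(2), of S] insert.hyps
    by simp
qed (simp add: disjoint_family_on_def)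

context object_pool
begin

lemma objects_of_bounds:
  assumes "finite V" "S \<in> set_pmf (objects_pmf V P K)" "A \<subseteq> V"
  shows "objects_of S A \<subseteq> {..<P}" "finite (objects_of S A)" "card (objects_of S A) \<le> card A * K"
    and "card (objects_of S A) = card A * K \<longleftrightarrow> disjoint_family_on S A"
proof -
  have fin: "finite A" using assms finite_subset by blast
  have component: "S i \<subseteq> {..<P}" "card (S i) = K" "finite (S i)" if "i \<in> A" for i
    using objects_pmf_component[OF assms(1,2)] assms(3) that by blast+
  show "objects_of S A \<subseteq> {..<P}" using component by (auto simp: objects_of_def)
  then show "finite (objects_of S A)" using finite_subset by blast
  have sum: "(\<Sum>i\<in>A. card (S i)) = card A * K" using component by simp
  show "card (objects_of S A) \<le> card A * K"
    unfolding objects_of_def sum[symmetric] by (rule card_UN_le[OF fin])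
  show "card (objects_of S A) = card A * K \<longleftrightarrow> disjoint_family_on S A"
    unfolding objects_of_def sum[symmetric]
      using component by (intro card_UN_eq_sum_card_iff[OF fin])
qed

lemma card_objects_of_add_defect:
  assumes "finite V" "S \<in> set_pmf (objects_pmf V P K)" "A \<subseteq> V"
  shows "card (objects_of S A) + defect K S A = card A * K"
  using objects_of_bounds(3)[OF assms] by (simp add: defect_def)

lemma defect_eq_0_iff:
  assumes "finite V" "S \<in> set_pmf (objects_pmf V P K)" "A \<subseteq> V"
  shows "defect K S A = 0 \<longleftrightarrow> disjoint_family_on S A"
  using objects_of_bounds(3,4)[OF assms] by (auto simp: defect_def)

lemma defect_insert:
  assumes A: "finite A" "a \<notin> A" and y: "y \<in> set_pmf (object_pmf P K)"
    and f: "f \<in> set_pmf (objects_pmf A P K)"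
  shows "defect K (f(a := y)) (insert a A) = defect K f A + card (y \<inter> objects_of f A)"
proof -
  note bounds = objects_of_bounds[OF A(1) f subset_refl]
  have y': "card y = K" "finite y" using y set_object_pmf
    by (auto simp: object_sets_def intro: finite_subset)
  have "objects_of (f(a := y)) (insert a A) = y \<union> objects_of f A"
    using A by (auto simp: objects_of_def)
  moreover have "card (y \<union> objects_of f A) + card (y \<inter> objects_of f A) = K + card (objects_of f A)"
    using card_Un_Int[OF y'(2) bounds(2)] y' by simp
  ultimately show ?thesis using bounds(3) A by (simp add: defect_def)
qed

lemma expect_power_defect_le:
  fixes t :: real
  assumes "finite A" "t \<ge> 1"
  shows "expect (objects_pmf A P K) (\<lambda>S. t ^ defect K S A) \<le> exp ((t - 1) * \<theta> * (real (card A))\<^sup>2)"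
  using assms(1)
proof (induction A rule: finite_induct)
  case empty
  then show ?case by (simp add: defect_def)
next
  case (insert a A)
  let ?r = "real (card A)" and ?M = "objects_pmf A P K" and ?Q = "object_pmf P K"
  have finite_support: "finite (set_pmf ?M)" "finite (set_pmf ?Q)"
    using insert.hyps finite_set_objects_pmf finite_set_object_pmf by blast+
  have "expect (objects_pmf (insert a A) P K) (\<lambda>S. t ^ defect K S (insert a A))
    = expect (pair_pmf ?Q ?M) (\<lambda>(y, f). t ^ defect K (f(a := y)) (insert a A))"
    using insert.hyps by (subst Pi_pmf_insert) (auto simp: case_prod_unfold)
  also have "\<dots>
      \<le> expect (pair_pmf ?Q ?M) (\<lambda>(y, f). t ^ defect K f A * t ^ card (y \<inter> objects_of f A))"
    by (rule expect_mono)
      (use finite_support defect_insert[OF insert.hyps] in \<open>auto simp: power_add\<close>)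
  also have "\<dots> = expect ?M (\<lambda>f. t ^ defect K f A * expect ?Q (\<lambda>y. t ^ card (y \<inter> objects_of f A)))"
    by (subst expect_pair_pmf_finite[OF finite_support(2,1)]) simp
  also have "\<dots> \<le> expect ?M (\<lambda>f. t ^ defect K f A * exp ((t - 1) * (\<theta> * ?r)))"
  proof (rule expect_mono[OF finite_support(1)], rule mult_left_mono)
    fix f assume f: "f \<in> set_pmf ?M"
    note bounds = objects_of_bounds[OF insert.hyps(1) f subset_refl]
    have "real (card (objects_of f A)) * (real K / real P) \<le> real (card A * K) * (real K / real P)"
      using bounds(3) by (intro mult_right_mono of_nat_mono) auto
    also have "\<dots> = \<theta> * ?r" by (simp add: edge_rate_def power2_eq_square)
    finally have "(t - 1) * (real (card (objects_of f A)) * (real K / real P)) \<le> (t - 1) * (\<theta> * ?r)"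
      using assms(2) by (intro mult_left_mono) auto
    then show "expect ?Q (\<lambda>y. t ^ card (y \<inter> objects_of f A)) \<le> exp ((t - 1) * (\<theta> * ?r))"
      using expect_power_card_inter_le[OF bounds(2) assms(2)]
      by (meson exp_le_cancel_iff order_trans)
  qed (use assms(2) in auto)
  also have "\<dots> \<le> exp ((t - 1) * \<theta> * ?r\<^sup>2) * exp ((t - 1) * (\<theta> * ?r))"
    using insert.IH by simp
  also have "\<dots> = exp ((t - 1) * \<theta> * (?r\<^sup>2 + ?r))"
    by (simp only: exp_add[symmetric] distrib_left mult.assoc)
  also have "\<dots> \<le> exp ((t - 1) * \<theta> * (real (card (insert a A)))\<^sup>2)"
  proof -
    have "?r\<^sup>2 + ?r \<le> (real (card (insert a A)))\<^sup>2"
      using insert.hyps by (simp add: power2_eq_square algebra_simps)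
    then show ?thesis unfolding exp_le_cancel_iff using assms(2) by (intro mult_left_mono) auto
  qed
  finally show ?case .
qed

lemma prob_disjoint_ge:
  assumes "finite A"
  shows "2 - exp (\<theta> * (real (card A))\<^sup>2) \<le> prob (objects_pmf A P K) {S. disjoint_family_on S A}"
proof -
  let ?M = "objects_pmf A P K"
  have finite_support: "finite (set_pmf ?M)" using finite_set_objects_pmf assms by blast
  have "expect ?M (\<lambda>S. 2 - of_bool (disjoint_family_on S A))
      = 2 - prob ?M {S. disjoint_family_on S A}"
    unfolding prob_eq_expect by (subst Bochner_Integration.integral_diff)
      (auto intro!: integrable_measure_pmf_finite finite_support)
  then have "2 - prob ?M {S. disjoint_family_on S A}
      = expect ?M (\<lambda>S. 2 - of_bool (disjoint_family_on S A))" ..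
  also have "\<dots> \<le> expect ?M (\<lambda>S. 2 ^ defect K S A)"
  proof (rule expect_mono[OF finite_support])
    fix S assume S: "S \<in> set_pmf ?M"
    show "2 - of_bool (disjoint_family_on S A) \<le> (2::real) ^ defect K S A"
    proof (cases "disjoint_family_on S A")
      case False
      then have "(2::real) ^ 1 \<le> 2 ^ defect K S A"
        using defect_eq_0_iff[OF assms S subset_refl] by (intro power_increasing) auto
      then show ?thesis using False by simp
    qed simp
  qed
  also have "\<dots> \<le> exp ((2 - 1) * \<theta> * (real (card A))\<^sup>2)"
    by (rule expect_power_defect_le[OF assms]) simp
  finally show ?thesis by simp
qed

end

section \<open>Neighbourhoods of node sets\<close>

definition nbh :: "'a set \<Rightarrow> ('a \<Rightarrow> 'b set) \<Rightarrow> 'a set \<Rightarrow> 'a set" where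
  "nbh V S A = {w \<in> V - A. S w \<inter> objects_of S A \<noteq> {}}"

definition double_hit :: "'a set \<Rightarrow> ('a \<Rightarrow> 'b set) \<Rightarrow> 'a set \<Rightarrow> bool" where
  "double_hit V S A \<longleftrightarrow>
     (\<exists>w\<in>V - A. \<exists>a\<in>A. \<exists>b\<in>A. a \<noteq> b \<and> S w \<inter> S a \<noteq> {} \<and> S w \<inter> S b \<noteq> {})"

lemma intersection_edges_iff:
  "{a, b} \<in> intersection_edges n S \<longleftrightarrow> a < n \<and> b < n \<and> a \<noteq> b \<and> S a \<inter> S b \<noteq> {}"
  unfolding intersection_edges_def by (auto simp: doubleton_eq_iff)

lemma boundary_intersection_edges:
  assumes "A \<subseteq> {..<n}"
  shows "boundary {..<n} (intersection_edges n S) A = nbh {..<n} S A"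
  using assms unfolding boundary_def nbh_def objects_of_def
  by (auto simp: intersection_edges_iff subset_eq disjoint_iff) metis

lemma node_degree_intersection_edges:
  assumes "v < n"
  shows "node_degree {..<n} (intersection_edges n S) v = card (nbh {..<n} S {v})"
proof -
  have "{u \<in> {..<n}. u \<noteq> v \<and> {u, v} \<in> intersection_edges n S} = nbh {..<n} S {v}"
    using assms by (auto simp: nbh_def objects_of_def intersection_edges_iff)
  then show ?thesis by (simp add: node_degree_def)
qed

lemma min_degree_intersection_edges_ge_iff:
  assumes "n \<ge> 1"
  shows "min_degree {..<n} (intersection_edges n S) \<ge> k \<longleftrightarrow> (\<forall>v<n. k \<le> card (nbh {..<n} S {v}))"
  using assms
  by (subst min_degree_ge_iff) (auto simp: node_degree_intersection_edges lessThan_empty_iff)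

lemma k_connected_imp_card_nbh_ge:
  assumes "n \<ge> 2" "k_connected k {..<n} (intersection_edges n S)" "v < n"
  shows "k \<le> card (nbh {..<n} S {v})"
  using k_connected_imp_node_degree[OF _ _ assms(2), of v] assms node_degree_intersection_edges[of v n S]
  by simp

lemma card_nbh_subset_le:
  assumes "finite V" "A' \<subseteq> A" "A \<subseteq> V"
  shows "card (nbh V S A') \<le> (card A - card A') + card (nbh V S A)"
proof -
  have fin: "finite A" using assms finite_subset by auto
  have "nbh V S A' \<subseteq> (A - A') \<union> nbh V S A"
    using assms by (auto simp: nbh_def objects_of_def)
  then have "card (nbh V S A') \<le> card ((A - A') \<union> nbh V S A)"
    using fin assms(1) by (intro card_mono) (auto simp: nbh_def)
  also have "\<dots> \<le> card (A - A') + card (nbh V S A)" by (rule card_Un_le)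
  also have "card (A - A') = card A - card A'"
    using assms fin by (intro card_Diff_subset) (auto intro: finite_subset)
  finally show ?thesis .
qed

lemma objects_of_override_on: "objects_of (override_on g f A) A = objects_of f A"
  by (simp add: objects_of_def)

lemma disjoint_family_on_override_on:
  "disjoint_family_on (override_on g f A) A \<longleftrightarrow> disjoint_family_on f A"
  by (simp add: disjoint_family_on_def)

lemma nbh_override_on:
  "nbh V (override_on g f A) A = {w \<in> V - A. g w \<in> {T. T \<inter> objects_of f A \<noteq> {}}}"
  unfolding nbh_def objects_of_override_on by auto

context object_pool
begin

abbreviation miss_bound :: "('a \<Rightarrow> nat set) \<Rightarrow> 'a set \<Rightarrow> real" where
  "miss_bound f A \<equiv> exp (- (real (card (objects_of f A)) * (real K / real P)))"

lemma prob_hit_objects_of_le: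
  assumes "finite A" "f \<in> set_pmf (objects_pmf A P K)"
  shows "prob (object_pmf P K) {T. T \<inter> objects_of f A \<noteq> {}} \<le> real (card A) * \<theta>"
proof -
  note bounds = objects_of_bounds[OF assms subset_refl]
  have "real (card (objects_of f A)) * (real K / real P) \<le> real (card A * K) * (real K / real P)"
    using bounds(3) by (intro mult_right_mono of_nat_mono) auto
  also have "\<dots> = real (card A) * \<theta>" by (simp add: edge_rate_def power2_eq_square)
  finally show ?thesis using prob_hit_le[OF bounds(2)] by linarith
qed

lemma prob_miss_objects_of_le:
  assumes "finite A" "f \<in> set_pmf (objects_pmf A P K)"
  shows "prob (object_pmf P K) (- {T. T \<inter> objects_of f A \<noteq> {}})
    \<le> miss_bound f A"
proof -
  have "- {T. T \<inter> objects_of f A \<noteq> {}} = {T. T \<inter> objects_of f A = {}}" by auto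
  then show ?thesis using prob_miss_le[OF objects_of_bounds(1)[OF assms subset_refl]] by simp
qed

lemma prob_small_nbh_le:
  assumes V: "finite V" "A \<subseteq> V"
    and \<Phi>_local: "\<And>f g. \<Phi> (override_on g f A) \<longleftrightarrow> \<Phi> f"
    and x: "real (card A) * \<theta> \<le> x \<or> 1 \<le> x"
  shows "prob (objects_pmf V P K) {S. \<Phi> S \<and> card (nbh V S A) \<le> q}
    \<le> (\<Sum>i\<le>q. real (card V choose i) * x ^ i) *
       expect (objects_pmf A P K) (\<lambda>f. of_bool (\<Phi> f) *
         miss_bound f A ^ (card V - card A - q))"
proof -
  have A: "finite A" using V finite_subset by auto
  have "0 \<le> real (card A) * \<theta>" by simp
  then have x_nonneg: "0 \<le> x" using x by linarith
  let ?C = "\<Sum>i\<le>q. real (card V choose i) * x ^ i"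
  have "prob (objects_pmf V P K) {S. \<Phi> S \<and> card (nbh V S A) \<le> q}
      \<le> expect (objects_pmf A P K) (\<lambda>f. ?C * (of_bool (\<Phi> f) * miss_bound f A ^ (card V - card A - q)))"
    unfolding prob_Pi_pmf_split[OF V]
  proof (rule expect_mono[OF finite_set_objects_pmf[OF A]])
    fix f assume f: "f \<in> set_pmf (objects_pmf A P K)"
    let ?H = "{T. T \<inter> objects_of f A \<noteq> {}}"
    have "prob (object_pmf P K) ?H \<le> x"
      using prob_hit_objects_of_le[OF A f] x by (metis measure_pmf.prob_le_1 order_trans)
    then have "prob (objects_pmf (V - A) P K) {g. card {w \<in> V - A. g w \<in> ?H} \<le> q}
        \<le> (\<Sum>i\<le>q. real (card (V - A) choose i) * x ^ i) * miss_bound f A ^ (card (V - A) - q)"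
      using V(1) by (intro prob_iid_card_le prob_miss_objects_of_le[OF A f]) auto
    also have "\<dots> \<le> ?C * miss_bound f A ^ (card (V - A) - q)"
      using x_nonneg V(1)
      by (intro mult_right_mono sum_mono of_nat_mono binomial_right_mono card_mono) auto
    finally show "prob (objects_pmf (V - A) P K)
        {g. override_on g f A \<in> {S. \<Phi> S \<and> card (nbh V S A) \<le> q}}
      \<le> ?C * (of_bool (\<Phi> f) * miss_bound f A ^ (card V - card A - q))"
      using card_Diff_subset[OF A V(2)] by (cases "\<Phi> f") (simp_all add: \<Phi>_local nbh_override_on)
  qed
  then show ?thesis by simp
qed

lemma miss_bound_power_eq:
  assumes "finite A" "f \<in> set_pmf (objects_pmf A P K)"
  shows "miss_bound f A ^ m
    = exp (- (real (card A) * \<theta> * real m)) * exp (real K * real m / real P) ^ defect K f A"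
proof -
  have "real (card (objects_of f A)) = real (card A) * real K - real (defect K f A)"
    using arg_cong[OF card_objects_of_add_defect[OF assms subset_refl], of real] by simp
  then have "real m * - (real (card (objects_of f A)) * (real K / real P))
      = - (real (card A) * \<theta> * real m) + real (defect K f A) * (real K * real m / real P)"
    by (simp add: edge_rate_def power2_eq_square left_diff_distrib right_diff_distrib
        diff_divide_distrib mult_ac)
  then show ?thesis unfolding exp_of_nat_mult[symmetric] exp_add[symmetric] by simp
qed

lemma expect_overlap_miss_bound_le:
  fixes s :: real and m :: nat
  assumes A: "finite A" and s: "s \<ge> 1"
  defines "t \<equiv> exp (real K * real m / real P)"
  shows "expect (objects_pmf A P K) (\<lambda>f. of_bool (\<not> disjoint_family_on f A) * miss_bound f A ^ m)
    \<le> exp (- (real (card A) * \<theta> * real m)) * (exp (s * t * \<theta> * (real (card A))\<^sup>2) / s)"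
proof -
  let ?E = "exp (- (real (card A) * \<theta> * real m))"
  have t: "t \<ge> 1" by (simp add: t_def)
  have "expect (objects_pmf A P K) (\<lambda>f. of_bool (\<not> disjoint_family_on f A) * miss_bound f A ^ m)
      \<le> expect (objects_pmf A P K) (\<lambda>f. ?E / s * (s * t) ^ defect K f A)"
  proof (rule expect_mono[OF finite_set_objects_pmf[OF A]])
    fix f assume f: "f \<in> set_pmf (objects_pmf A P K)"
    show "of_bool (\<not> disjoint_family_on f A) * miss_bound f A ^ m \<le> ?E / s * (s * t) ^ defect K f A"
    proof (cases "disjoint_family_on f A")
      case False
      then obtain d where d: "defect K f A = Suc d"
        using defect_eq_0_iff[OF A f subset_refl] by (metis not0_implies_Suc)
      have "1 * (?E * t ^ defect K f A) \<le> s ^ d * (?E * t ^ defect K f A)"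
        using s t by (intro mult_right_mono) auto
      then show ?thesis
        using False s unfolding miss_bound_power_eq[OF A f] t_def[symmetric]
        by (simp add: d power_mult_distrib mult_ac)
    qed (use s t in simp)
  qed
  also have "\<dots> \<le> ?E / s * exp ((s * t - 1) * \<theta> * (real (card A))\<^sup>2)"
    using expect_power_defect_le[OF A, of "s * t"] mult_mono[OF s t] s
    by (simp add: divide_right_mono)
  also have "\<dots> \<le> ?E * (exp (s * t * \<theta> * (real (card A))\<^sup>2) / s)"
    using s by (simp add: divide_right_mono mult_right_mono)
  finally show ?thesis .
qed

lemma prob_overlap_small_nbh_le:
  fixes s t :: real and q m :: nat
  assumes V: "finite V" "A \<subseteq> V" and s: "s \<ge> 1"
  defines "m \<equiv> card V - card A - q"
  defines "t \<equiv> exp (real K * real m / real P)"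
  shows "prob (objects_pmf V P K) {S. \<not> disjoint_family_on S A \<and> card (nbh V S A) \<le> q}
     \<le> (1 + real (card V) * (real (card A) * \<theta>)) ^ q * exp (- (real (card A) * \<theta> * real m))
         * (exp (s * t * \<theta> * (real (card A))\<^sup>2) / s)"
proof -
  have A: "finite A" using V finite_subset by auto
  let ?x = "real (card A) * \<theta>"
  have "prob (objects_pmf V P K) {S. \<not> disjoint_family_on S A \<and> card (nbh V S A) \<le> q}
      \<le> (\<Sum>i\<le>q. real (card V choose i) * ?x ^ i)
        * expect (objects_pmf A P K) (\<lambda>f. of_bool (\<not> disjoint_family_on f A) * miss_bound f A ^ m)"
    unfolding m_def by (intro prob_small_nbh_le V) (simp_all add: disjoint_family_on_override_on)
  also have "\<dots> \<le> (1 + real (card V) * ?x) ^ q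
      * (exp (- (?x * real m)) * (exp (s * t * \<theta> * (real (card A))\<^sup>2) / s))"
    unfolding t_def using expect_overlap_miss_bound_le[OF A s]
    by (intro mult_mono binomial_partial_sum_le Bochner_Integration.integral_nonneg) auto
  finally show ?thesis by (simp add: mult.assoc)
qed

lemma prob_single_small_nbh_le:
  assumes "finite V" "v \<in> V"
  shows "prob (objects_pmf V P K) {S. card (nbh V S {v}) \<le> q}
     \<le> (1 + real (card V) * \<theta>) ^ q * exp (- (\<theta> * real (card V - 1 - q)))"
proof -
  let ?m = "card V - 1 - q"
  have "expect (objects_pmf {v} P K)
      (\<lambda>f. miss_bound f {v} ^ ?m)
    \<le> expect (objects_pmf {v} P K) (\<lambda>_. exp (- (\<theta> * real ?m)))"
  proof (rule expect_mono)
    fix f assume "f \<in> set_pmf (objects_pmf {v} P K)"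
    then have "card (objects_of f {v}) = K"
      using objects_pmf_component(2)[of "{v}" f v] by (simp add: objects_of_def)
    then show "miss_bound f {v} ^ ?m \<le> exp (- (\<theta> * real ?m))"
      by (simp add: exp_of_nat_mult[symmetric] edge_rate_def power2_eq_square mult_ac)
  qed (simp add: finite_set_objects_pmf del: set_pmf_of_set)
  then have "(\<Sum>i\<le>q. real (card V choose i) * \<theta> ^ i) * expect (objects_pmf {v} P K)
      (\<lambda>f. miss_bound f {v} ^ ?m)
    \<le> (1 + real (card V) * \<theta>) ^ q * exp (- (\<theta> * real ?m))"
    by (intro mult_mono binomial_partial_sum_le Bochner_Integration.integral_nonneg) auto
  then show ?thesis
    using prob_small_nbh_le[OF assms(1), of "{v}" "\<lambda>_. True" \<theta> q] assms(2) by simp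
qed

lemma prob_few_objects_le:
  fixes y :: real
  assumes V: "finite V" "A \<subseteq> V" and y: "y \<ge> 0"
  shows "prob (objects_pmf V P K) {S. 2 * card (objects_of S A) < card A * K}
     \<le> exp (- (y * real (card A) * real K / 2) + (exp y - 1) * \<theta> * (real (card A))\<^sup>2)"
proof -
  have A: "finite A" using V finite_subset by auto
  let ?e = "exp (- (y * real (card A) * real K / 2))"
  have "prob (objects_pmf V P K) {S. 2 * card (objects_of S A) < card A * K}
     = expect (objects_pmf A P K) (\<lambda>f. of_bool (2 * card (objects_of f A) < card A * K))"
    by (simp add: prob_Pi_pmf_split[OF V] objects_of_override_on of_bool_def if_distrib cong: if_cong)
  also have "\<dots> \<le> expect (objects_pmf A P K) (\<lambda>f. ?e * exp y ^ defect K f A)"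
  proof (rule expect_mono[OF finite_set_objects_pmf[OF A]])
    fix f assume f: "f \<in> set_pmf (objects_pmf A P K)"
    show "of_bool (2 * card (objects_of f A) < card A * K) \<le> ?e * exp y ^ defect K f A"
    proof (cases "2 * card (objects_of f A) < card A * K")
      case True
      then have "real (card A * K) \<le> real (2 * defect K f A)"
        using card_objects_of_add_defect[OF A f subset_refl] by (intro of_nat_mono) linarith
      then have "y * (real (card A) * real K) \<le> y * (2 * real (defect K f A))"
        using y by (intro mult_left_mono) auto
      then have "1 \<le> exp (- (y * real (card A) * real K / 2) + real (defect K f A) * y)"
        by (simp add: mult_ac)
      then show ?thesis using True unfolding exp_add exp_of_nat_mult by simp
    qed simp
  qed
  also have "\<dots> \<le> ?e * exp ((exp y - 1) * \<theta> * (real (card A))\<^sup>2)"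
    using expect_power_defect_le[OF A, of "exp y"] y by simp
  finally show ?thesis unfolding exp_add .
qed

lemma prob_many_objects_small_nbh_le:
  fixes V A :: "'a set"
  assumes V: "finite V" "A \<subseteq> V"
  shows "prob (objects_pmf V P K) {S. card A * K \<le> 2 * card (objects_of S A) \<and> card (nbh V S A) \<le> q}
     \<le> real (\<Sum>i\<le>q. card V choose i) * exp (- (real (card A) * \<theta> * real (card V - card A - q) / 2))"
proof -
  have A: "finite A" using V finite_subset by auto
  let ?m = "card V - card A - q"
  let ?many = "\<lambda>S :: 'a \<Rightarrow> nat set. card A * K \<le> 2 * card (objects_of S A)"
  have "expect (objects_pmf A P K)
      (\<lambda>f. of_bool (?many f) * miss_bound f A ^ ?m)
    \<le> expect (objects_pmf A P K) (\<lambda>_. exp (- (real (card A) * \<theta> * real ?m / 2)))"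
  proof (rule expect_mono[OF finite_set_objects_pmf[OF A]])
    fix f :: "'a \<Rightarrow> nat set"
    let ?u = "real (card (objects_of f A))"
    show "of_bool (?many f) * exp (- (?u * (real K / real P))) ^ ?m
        \<le> exp (- (real (card A) * \<theta> * real ?m / 2))"
    proof (cases "?many f")
      case True
      then have "real (card A * K) \<le> real (2 * card (objects_of f A))" by (rule of_nat_mono)
      then have "(real (card A) * real K) * (real ?m * (real K / real P))
          \<le> (2 * ?u) * (real ?m * (real K / real P))"
        by (intro mult_right_mono) auto
      moreover have "real (card A) * \<theta> * real ?m
          = (real (card A) * real K) * (real ?m * (real K / real P))"
        by (simp add: edge_rate_def power2_eq_square)
      moreover have "real ?m * - (?u * (real K / real P)) = - (?u * (real ?m * (real K / real P)))"
        by simp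
      ultimately have "real ?m * - (?u * (real K / real P)) \<le> - (real (card A) * \<theta> * real ?m / 2)"
        by linarith
      then show ?thesis using True by (simp add: exp_of_nat_mult[symmetric])
    qed simp
  qed
  then have "(\<Sum>i\<le>q. real (card V choose i) * 1 ^ i) * expect (objects_pmf A P K)
      (\<lambda>f. of_bool (?many f) * miss_bound f A ^ ?m)
    \<le> real (\<Sum>i\<le>q. card V choose i) * exp (- (real (card A) * \<theta> * real ?m / 2))"
    by (simp add: mult_left_mono sum_nonneg)
  then show ?thesis
    using prob_small_nbh_le[OF V, of ?many 1 q] by (simp add: objects_of_override_on)
qed

lemma prob_hit_two_le:
  assumes "finite A" "disjoint_family_on f A" and f: "f \<in> set_pmf (objects_pmf A P K)"
  shows "prob (object_pmf P K) {T. \<exists>a\<in>A. \<exists>b\<in>A. a \<noteq> b \<and> T \<inter> f a \<noteq> {} \<and> T \<inter> f b \<noteq> {}}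
    \<le> (real (card A) * \<theta>)\<^sup>2"
proof -
  let ?pairs = "{p \<in> A \<times> A. fst p \<noteq> snd p}"
  have "prob (object_pmf P K) {T. \<exists>a\<in>A. \<exists>b\<in>A. a \<noteq> b \<and> T \<inter> f a \<noteq> {} \<and> T \<inter> f b \<noteq> {}}
    \<le> (\<Sum>p\<in>?pairs. prob (object_pmf P K) {T. T \<inter> f (fst p) \<noteq> {} \<and> T \<inter> f (snd p) \<noteq> {}})"
    by (rule prob_union_bound) (use assms(1) in force)+
  also have "\<dots> \<le> (\<Sum>p\<in>?pairs. \<theta>\<^sup>2)"
  proof (rule sum_mono)
    fix p assume "p \<in> ?pairs"
    then have p: "fst p \<in> A" "snd p \<in> A" "fst p \<noteq> snd p" by auto
    note component = objects_pmf_component[OF assms(1) f p(1)] objects_pmf_component[OF assms(1) f p(2)]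
    have "f (fst p) \<inter> f (snd p) = {}" using assms(2) p by (auto simp: disjoint_family_on_def)
    from prob_hit_both_le[OF component(3,6) this]
    show "prob (object_pmf P K) {T. T \<inter> f (fst p) \<noteq> {} \<and> T \<inter> f (snd p) \<noteq> {}} \<le> \<theta>\<^sup>2"
      using component by (simp add: edge_rate_def power2_eq_square)
  qed
  also have "\<dots> = real (card ?pairs) * \<theta>\<^sup>2" by simp
  also have "\<dots> \<le> real (card (A \<times> A)) * \<theta>\<^sup>2"
    using assms(1) by (intro mult_right_mono of_nat_mono card_mono) auto
  also have "\<dots> = (real (card A) * \<theta>)\<^sup>2" by (simp add: card_cartesian_product power2_eq_square)
  finally show ?thesis .
qed

lemma prob_double_hit_small_nbh_given_le:
  assumes V: "finite V" "A \<subseteq> V"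
    and f: "f \<in> set_pmf (objects_pmf A P K)" and disjoint: "disjoint_family_on f A"
  shows "prob (objects_pmf (V - A) P K)
      {g. card (nbh V (override_on g f A) A) \<le> q \<and> double_hit V (override_on g f A) A}
    \<le> real (card V) * ((real (card A) * \<theta>)\<^sup>2 * ((1 + real (card V) * (real (card A) * \<theta>)) ^ q
        * exp (- (real (card A) * \<theta>)) ^ (card V - card A - 1 - q)))" (is "prob _ ?E \<le> ?R")
proof -
  have A: "finite A" using V finite_subset by auto
  let ?H = "{T. T \<inter> objects_of f A \<noteq> {}}"
  let ?H' = "{T. \<exists>a\<in>A. \<exists>b\<in>A. a \<noteq> b \<and> T \<inter> f a \<noteq> {} \<and> T \<inter> f b \<noteq> {}}"
  have "card (objects_of f A) = card A * K"
    using objects_of_bounds(4)[OF A f subset_refl] disjoint by simp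
  then have miss: "prob (object_pmf P K) (- ?H) \<le> exp (- (real (card A) * \<theta>))"
    using prob_miss_objects_of_le[OF A f] by (simp add: edge_rate_def power2_eq_square mult.assoc)
  have "\<exists>w\<in>V - A. g w \<in> ?H'" if "double_hit V (override_on g f A) A" for g
    using that unfolding double_hit_def by (auto simp: override_on_def)
  then have "prob (objects_pmf (V - A) P K) ?E
      \<le> prob (objects_pmf (V - A) P K) {g. card {w \<in> V - A. g w \<in> ?H} \<le> q \<and> (\<exists>w\<in>V - A. g w \<in> ?H')}"
    unfolding nbh_override_on by (intro prob_mono_on_support) simp
  also have "\<dots> \<le> real (card (V - A)) * ((real (card A) * \<theta>)\<^sup>2 *
      ((1 + real (card (V - A)) * (real (card A) * \<theta>)) ^ q
        * exp (- (real (card A) * \<theta>)) ^ (card (V - A) - 1 - q)))"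
    using V(1) by (intro prob_iid_card_le_and_ex prob_hit_objects_of_le[OF A f] miss
        prob_hit_two_le[OF A disjoint f]) auto
  also have "\<dots> \<le> ?R"
    unfolding card_Diff_subset[OF A V(2)]
    by (intro mult_mono power_mono add_left_mono mult_nonneg_nonneg) auto
  finally show ?thesis .
qed

lemma prob_double_hit_small_nbh_le:
  assumes V: "finite V" "A \<subseteq> V"
  shows "prob (objects_pmf V P K) {S. disjoint_family_on S A \<and> card (nbh V S A) \<le> q \<and> double_hit V S A}
    \<le> real (card V) * ((real (card A) * \<theta>)\<^sup>2 * ((1 + real (card V) * (real (card A) * \<theta>)) ^ q
        * exp (- (real (card A) * \<theta>)) ^ (card V - card A - 1 - q)))" (is "prob _ ?E \<le> ?R")
proof -
  have A: "finite A" using V finite_subset by auto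
  have "prob (objects_pmf V P K) ?E \<le> expect (objects_pmf A P K) (\<lambda>_. ?R)"
    unfolding prob_Pi_pmf_split[OF V]
  proof (rule expect_mono[OF finite_set_objects_pmf[OF A]])
    fix f assume f: "f \<in> set_pmf (objects_pmf A P K)"
    show "prob (objects_pmf (V - A) P K) {g. override_on g f A \<in> ?E} \<le> ?R"
    proof (cases "disjoint_family_on f A")
      case True
      then show ?thesis
        using prob_double_hit_small_nbh_given_le[OF V f True, of q]
        by (simp add: disjoint_family_on_override_on)
    qed (simp add: disjoint_family_on_override_on)
  qed
  then show ?thesis by simp
qed

end

section \<open>Joint degree distribution of finitely many nodes\<close>

definition degree_event :: "'a set \<Rightarrow> 'a set \<Rightarrow> nat \<Rightarrow> ('a \<Rightarrow> 'b set) set" where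
  "degree_event V A d = {S. \<forall>v\<in>A. card (nbh V S {v}) = d}"

definition simple_degree_event :: "'a set \<Rightarrow> 'a set \<Rightarrow> nat \<Rightarrow> ('a \<Rightarrow> 'b set) set" where
  "simple_degree_event V A d =
     {S \<in> degree_event V A d. disjoint_family_on S A \<and> \<not> double_hit V S A}"

definition hit_only :: "('a \<Rightarrow> 'b set) \<Rightarrow> 'a set \<Rightarrow> 'a \<Rightarrow> 'b set set" where
  "hit_only f A v = {T. T \<inter> f v \<noteq> {} \<and> (\<forall>b\<in>A - {v}. T \<inter> f b = {})}"

lemma card_nbh_le_of_degree_event:
  assumes "finite V" "finite A" "S \<in> degree_event V A d"
  shows "card (nbh V S A) \<le> card A * d"
proof -
  have "nbh V S A \<subseteq> (\<Union>v\<in>A. nbh V S {v})" by (auto simp: nbh_def objects_of_def)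
  then have "card (nbh V S A) \<le> card (\<Union>v\<in>A. nbh V S {v})"
    using assms by (intro card_mono) (auto simp: nbh_def)
  also have "\<dots> \<le> (\<Sum>v\<in>A. card (nbh V S {v}))" using assms by (intro card_UN_le) auto
  also have "\<dots> = card A * d" using assms by (simp add: degree_event_def)
  finally show ?thesis .
qed

lemma override_on_mem_simple_degree_event_iff:
  assumes "A \<subseteq> V" "disjoint_family_on f A"
  shows "override_on g f A \<in> simple_degree_event V A d \<longleftrightarrow>
    g \<in> exact_hits {T. T \<inter> objects_of f A = {}} (hit_only f A) d A (V - A)"
proof -
  let ?S = "override_on g f A"
  have no_double: "\<not> double_hit V ?S A \<longleftrightarrow>
      (\<forall>w\<in>V - A. g w \<in> {T. T \<inter> objects_of f A = {}} \<union> (\<Union>v\<in>A. hit_only f A v))"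
    unfolding double_hit_def hit_only_def objects_of_def by (simp add: override_on_def) blast
  have "nbh V ?S {v} = {w \<in> V - A. g w \<in> hit_only f A v}"
    if "v \<in> A" "\<not> double_hit V ?S A" for v
  proof -
    have "f w \<inter> f v = {}" if "w \<in> A" "w \<noteq> v" for w
      using assms(2) \<open>v \<in> A\<close> that by (simp add: disjoint_family_on_def)
    moreover have "g w \<inter> f v \<noteq> {} \<longleftrightarrow> g w \<in> hit_only f A v" if "w \<in> V - A" for w
      using \<open>\<not> double_hit V ?S A\<close> that \<open>v \<in> A\<close>
      unfolding double_hit_def hit_only_def by (simp add: override_on_def) blast
    ultimately show ?thesis
      using \<open>v \<in> A\<close> assms(1) unfolding nbh_def objects_of_def by (auto simp: override_on_def)
  qed
  then show ?thesis
    unfolding simple_degree_event_def degree_event_def exact_hits_def mem_Collect_eq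
      disjoint_family_on_override_on no_double[symmetric]
    using assms(2) by auto
qed

context object_pool
begin

definition conditional_degree_prob :: "'a set \<Rightarrow> 'a set \<Rightarrow> nat \<Rightarrow> ('a \<Rightarrow> nat set) \<Rightarrow> real" where
  "conditional_degree_prob V A d f =
     real (\<Prod>i<card A. (card V - card A - i * d) choose d)
       * (\<Prod>v\<in>A. prob (object_pmf P K) (hit_only f A v)) ^ d
       * prob (object_pmf P K) {T. T \<inter> objects_of f A = {}} ^ (card V - card A - card A * d)"

lemma prob_simple_degree_event:
  assumes V: "finite V" "A \<subseteq> V"
  shows "prob (objects_pmf V P K) (simple_degree_event V A d) =
    expect (objects_pmf A P K) (\<lambda>f. of_bool (disjoint_family_on f A) * conditional_degree_prob V A d f)"
proof -
  have A: "finite A" using V finite_subset by auto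
  have "prob (objects_pmf (V - A) P K) {g. override_on g f A \<in> simple_degree_event V A d}
      = of_bool (disjoint_family_on f A) * conditional_degree_prob V A d f" for f
  proof (cases "disjoint_family_on f A")
    case True
    have "disjoint_family_on (hit_only f A) A"
      unfolding disjoint_family_on_def hit_only_def by blast
    moreover have "hit_only f A v \<inter> {T. T \<inter> objects_of f A = {}} = {}" if "v \<in> A" for v
      using that unfolding hit_only_def objects_of_def by blast
    ultimately show ?thesis
      using prob_exact_hits[OF A, of "V - A" "hit_only f A"] V(1) True
      unfolding override_on_mem_simple_degree_event_iff[OF V(2) True] conditional_degree_prob_def
      by (simp add: card_Diff_subset[OF A V(2)])
  next
    case False
    then show ?thesis by (simp add: simple_degree_event_def disjoint_family_on_override_on)
  qed
  then show ?thesis unfolding prob_Pi_pmf_split[OF V] by presburger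
qed

lemma prob_hit_only_le:
  assumes "finite A" "f \<in> set_pmf (objects_pmf A P K)" "v \<in> A"
  shows "prob (object_pmf P K) (hit_only f A v) \<le> \<theta>"
proof -
  note component = objects_pmf_component[OF assms]
  have "prob (object_pmf P K) (hit_only f A v) \<le> prob (object_pmf P K) {T. T \<inter> f v \<noteq> {}}"
    by (intro prob_mono_on_support) (auto simp: hit_only_def)
  also have "\<dots> \<le> \<theta>"
    using prob_hit_le[OF component(3)] component(2) by (simp add: edge_rate_def power2_eq_square)
  finally show ?thesis .
qed

lemma conditional_degree_prob_le:
  assumes A: "finite A" and f: "f \<in> set_pmf (objects_pmf A P K)" "disjoint_family_on f A"
  shows "conditional_degree_prob V A d f \<le> real (card V choose d) ^ card A * \<theta> ^ (card A * d)
      * exp (- (real (card A) * \<theta>)) ^ (card V - card A - card A * d)"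
proof -
  note bounds = objects_of_bounds[OF A f(1) subset_refl]
  have "(\<Prod>i<card A. (card V - card A - i * d) choose d) \<le> (\<Prod>i<card A. card V choose d)"
    by (intro prod_mono) (auto intro: binomial_right_mono)
  then have "real (\<Prod>i<card A. (card V - card A - i * d) choose d)
      \<le> real ((card V choose d) ^ card A)"
    by (intro of_nat_mono) simp
  moreover have "(\<Prod>v\<in>A. prob (object_pmf P K) (hit_only f A v)) \<le> (\<Prod>v\<in>A. \<theta>)"
    using prob_hit_only_le[OF A f(1)] by (intro prod_mono) auto
  then have "(\<Prod>v\<in>A. prob (object_pmf P K) (hit_only f A v)) ^ d \<le> \<theta> ^ (card A * d)"
    unfolding power_mult by (intro power_mono prod_nonneg) auto
  moreover have "prob (object_pmf P K) {T. T \<inter> objects_of f A = {}} \<le> exp (- (real (card A) * \<theta>))"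
    using prob_miss_le[OF bounds(1)] bounds(4) f(2)
    by (simp add: edge_rate_def power2_eq_square mult.assoc)
  ultimately show ?thesis
    unfolding conditional_degree_prob_def of_nat_power
    by (intro mult_mono power_mono) (auto intro!: prod_nonneg zero_le_power mult_nonneg_nonneg)
qed

lemma prob_simple_degree_event_le:
  assumes V: "finite V" "A \<subseteq> V"
  shows "prob (objects_pmf V P K) (simple_degree_event V A d)
    \<le> real (card V choose d) ^ card A * \<theta> ^ (card A * d)
      * exp (- (real (card A) * \<theta>)) ^ (card V - card A - card A * d)" (is "_ \<le> ?b")
proof -
  have A: "finite A" using V finite_subset by auto
  have "prob (objects_pmf V P K) (simple_degree_event V A d) \<le> expect (objects_pmf A P K) (\<lambda>_. ?b)"
    unfolding prob_simple_degree_event[OF V]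
  proof (rule expect_mono[OF finite_set_objects_pmf[OF A]])
    fix f assume "f \<in> set_pmf (objects_pmf A P K)"
    then show "of_bool (disjoint_family_on f A) * conditional_degree_prob V A d f \<le> ?b"
      using conditional_degree_prob_le[OF A] by (cases "disjoint_family_on f A") simp_all
  qed
  then show ?thesis by simp
qed

lemma prob_miss_disjoint_ge:
  assumes "finite A" "f \<in> set_pmf (objects_pmf A P K)" "disjoint_family_on f A"
    and small: "real (card A + 1) * \<theta> < 1"
  shows "exp (- (real (card A) * \<theta> / (1 - real (card A + 1) * \<theta>)))
    \<le> prob (object_pmf P K) {T. T \<inter> objects_of f A = {}}"
proof -
  let ?j = "card A"
  note bounds = objects_of_bounds[OF assms(1,2) subset_refl]
  have card_U: "card (objects_of f A) = ?j * K" using bounds(4) assms(3) by simp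
  have P: "0 < real P" using K_pos K_le_P by simp
  have "real K / real P \<le> \<theta>"
    using K_pos by (simp add: edge_rate_def power2_eq_square divide_right_mono)
  then have rate: "real (?j + 1) * (real K / real P) \<le> real (?j + 1) * \<theta>"
    by (intro mult_left_mono) auto
  have "real (K + ?j * K) = real (?j + 1) * real K" by (simp add: distrib_right)
  also have "\<dots> = real (?j + 1) * (real K / real P) * real P" using P by simp
  also have "\<dots> < 1 * real P" using rate small P by (intro mult_strict_right_mono) linarith+
  finally have "real (K + ?j * K) < real P" by simp
  then have room: "K + ?j * K < P" by (simp only: of_nat_less_iff)
  have "real (P - ?j * K - K) = real P * (1 - real (?j + 1) * (real K / real P))"
    using room P by (simp add: of_nat_diff field_simps)
  then have "real (?j * K) * real K / real (P - ?j * K - K)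
      = real ?j * \<theta> / (1 - real (?j + 1) * (real K / real P))"
    using P by (simp add: edge_rate_def power2_eq_square)
  also have "\<dots> \<le> real ?j * \<theta> / (1 - real (?j + 1) * \<theta>)"
    using rate small by (intro divide_left_mono mult_pos_pos) auto
  finally show ?thesis
    using prob_miss_ge[OF bounds(1)] room unfolding card_U by (auto intro: order_trans[rotated])
qed

lemma conditional_degree_prob_ge:
  assumes A: "finite A" and f: "f \<in> set_pmf (objects_pmf A P K)" "disjoint_family_on f A"
    and small: "real (card A + 1) * \<theta> < 1"
  shows "real ((card V - card A - card A * d) choose d) ^ card A
        * (\<theta> * (1 - real (card A) * \<theta>)) ^ (card A * d)
        * exp (- (real (card A) * \<theta> / (1 - real (card A + 1) * \<theta>))) ^ (card V - card A - card A * d)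
    \<le> conditional_degree_prob V A d f"
proof -
  note component = objects_pmf_component[OF A f(1)]
  have "0 \<le> \<theta>" "real (card A + 1) * \<theta> = real (card A) * \<theta> + \<theta>"
    by (simp_all add: distrib_right)
  then have rate: "0 \<le> \<theta> * (1 - real (card A) * \<theta>)"
    using small by (intro mult_nonneg_nonneg) linarith+
  have "(card V - card A - card A * d) choose d \<le> (card V - card A - i * d) choose d"
    if "i < card A" for i
    using that by (intro binomial_right_mono diff_le_mono2 mult_right_mono) auto
  then have "(\<Prod>i<card A. (card V - card A - card A * d) choose d)
      \<le> (\<Prod>i<card A. (card V - card A - i * d) choose d)" by (intro prod_mono) auto
  then have "real (((card V - card A - card A * d) choose d) ^ card A)
      \<le> real (\<Prod>i<card A. (card V - card A - i * d) choose d)" by (intro of_nat_mono) simp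
  moreover have "(\<Prod>v\<in>A. \<theta> * (1 - real (card A) * \<theta>))
      \<le> (\<Prod>v\<in>A. prob (object_pmf P K) (hit_only f A v))"
    unfolding hit_only_def using component rate
    by (intro prod_mono conjI prob_hit_only_ge[OF A f(2)]) auto
  then have "(\<theta> * (1 - real (card A) * \<theta>)) ^ (card A * d)
      \<le> (\<Prod>v\<in>A. prob (object_pmf P K) (hit_only f A v)) ^ d"
    unfolding power_mult using rate by (intro power_mono) auto
  ultimately show ?thesis
    unfolding conditional_degree_prob_def of_nat_power
    using prob_miss_disjoint_ge[OF A f small] rate
    by (intro mult_mono power_mono) (auto intro!: prod_nonneg zero_le_power mult_nonneg_nonneg)
qed

lemma prob_simple_degree_event_ge:
  assumes V: "finite V" "A \<subseteq> V" and small: "real (card A + 1) * \<theta> < 1"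
  shows "(2 - exp (\<theta> * (real (card A))\<^sup>2)) *
      (real ((card V - card A - card A * d) choose d) ^ card A
        * (\<theta> * (1 - real (card A) * \<theta>)) ^ (card A * d)
        * exp (- (real (card A) * \<theta> / (1 - real (card A + 1) * \<theta>))) ^ (card V - card A - card A * d))
    \<le> prob (objects_pmf V P K) (simple_degree_event V A d)" (is "_ * ?b \<le> _")
proof -
  have A: "finite A" using V finite_subset by auto
  have "0 \<le> \<theta>" "real (card A + 1) * \<theta> = real (card A) * \<theta> + \<theta>"
    by (simp_all add: distrib_right)
  then have "real (card A) * \<theta> \<le> 1" using small by linarith
  then have "(2 - exp (\<theta> * (real (card A))\<^sup>2)) * ?b
      \<le> prob (objects_pmf A P K) {f. disjoint_family_on f A} * ?b"
    using prob_disjoint_ge[OF A] by (intro mult_right_mono) auto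
  also have "\<dots> = expect (objects_pmf A P K) (\<lambda>f. of_bool (disjoint_family_on f A) * ?b)"
    by (simp add: prob_eq_expect)
  also have "\<dots> \<le> prob (objects_pmf V P K) (simple_degree_event V A d)"
    unfolding prob_simple_degree_event[OF V]
  proof (rule expect_mono[OF finite_set_objects_pmf[OF A]])
    fix f assume "f \<in> set_pmf (objects_pmf A P K)"
    then show "of_bool (disjoint_family_on f A) * ?b
        \<le> of_bool (disjoint_family_on f A) * conditional_degree_prob V A d f"
      using conditional_degree_prob_ge[OF A _ _ small] by (cases "disjoint_family_on f A") simp_all
  qed
  finally show ?thesis .
qed

lemma prob_degree_event_le:
  assumes V: "finite V" "A \<subseteq> V"
  shows "prob (objects_pmf V P K) (degree_event V A d)
    \<le> prob (objects_pmf V P K) (simple_degree_event V A d)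
      + prob (objects_pmf V P K) {S. \<not> disjoint_family_on S A \<and> card (nbh V S A) \<le> card A * d}
      + prob (objects_pmf V P K)
          {S. disjoint_family_on S A \<and> card (nbh V S A) \<le> card A * d \<and> double_hit V S A}"
    (is "_ \<le> prob ?M ?E1 + prob ?M ?E2 + prob ?M ?E3")
proof -
  have A: "finite A" using V finite_subset by auto
  have "degree_event V A d \<subseteq> ?E1 \<union> ?E2 \<union> ?E3"
    using card_nbh_le_of_degree_event[OF V(1) A] by (auto simp: simple_degree_event_def)
  then have "prob ?M (degree_event V A d) \<le> prob ?M (?E1 \<union> ?E2 \<union> ?E3)"
    by (intro prob_mono_on_support) auto
  also have "\<dots> \<le> prob ?M ?E1 + prob ?M ?E2 + prob ?M ?E3"
    by (intro order_trans[OF measure_Un_le] add_mono order_refl) auto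
  finally show ?thesis .
qed

end

section \<open>Sparse parameters\<close>

lemma sum_power_fact_le_exp:
  fixes x :: real
  assumes "x \<ge> 0" "finite I"
  shows "(\<Sum>i\<in>I. x ^ i / fact i) \<le> exp x"
proof -
  have "(\<lambda>i. x ^ i / fact i) sums exp x"
    using exp_converges[of x] by (simp add: field_simps)
  then show ?thesis using sum_le_suminf[of "\<lambda>i. x ^ i / fact i" I] assms
    by (auto simp: sums_iff)
qed

lemma power_le_fact_exp:
  fixes x :: real
  assumes "x \<ge> 0"
  shows "x ^ i \<le> fact i * exp x"
  using sum_power_fact_le_exp[OF assms, of "{i}"] by (simp add: field_simps)

lemma choose_le_power_fact: "real (n choose r) \<le> real n ^ r / fact r"
proof -
  have "fact r * (n choose r) \<le> n ^ r"
    by (cases "r \<le> n") (use binomial_fact_pow[of n r] in \<open>auto simp: mult.commute binomial_eq_0\<close>)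
  then have "real (fact r * (n choose r)) \<le> real (n ^ r)" by (rule of_nat_mono)
  then show ?thesis by (simp add: field_simps)
qed

lemma choose_le_exp:
  assumes "r \<ge> 1" "n \<ge> 1"
  shows "real (n choose r) \<le> exp (real r * (1 + ln (real n / real r)))"
proof -
  have "real n ^ r / fact r = (real n / real r) ^ r * (real r ^ r / fact r)"
    using assms by (simp add: power_divide)
  also have "\<dots> \<le> (real n / real r) ^ r * exp (real r)"
    using power_le_fact_exp[of "real r" r] by (intro mult_left_mono) (auto simp: field_simps)
  also have "real n / real r = exp (ln (real n / real r))" using assms by simp
  also have "exp (ln (real n / real r)) ^ r * exp (real r)
      = exp (real r * (1 + ln (real n / real r)))"
    by (simp only: exp_of_nat_mult[symmetric] exp_add[symmetric]) (simp add: algebra_simps)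
  finally show ?thesis using choose_le_power_fact[of n r] by linarith
qed

lemma sum_power_le_twice:
  fixes z :: real
  assumes "0 \<le> z" "z \<le> 1 / 2" "finite I" "0 \<notin> I"
  shows "(\<Sum>r\<in>I. z ^ r) \<le> 2 * z"
proof -
  have "1 + (\<Sum>r\<in>I. z ^ r) = (\<Sum>r\<in>insert 0 I. z ^ r)" using assms(3,4) by simp
  also have "\<dots> \<le> (\<Sum>r. z ^ r)"
    using assms by (intro sum_le_suminf summable_geometric) auto
  also have "\<dots> = 1 / (1 - z)" using assms by (simp add: suminf_geometric)
  also have "\<dots> \<le> 1 + 2 * z"
  proof -
    have "2 * z * z \<le> 1 * z" using assms by (intro mult_right_mono) auto
    then show ?thesis using assms by (simp add: field_simps)
  qed
  finally show ?thesis by simp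
qed

lemma prob_ex_subset_le:
  fixes V :: "'a set"
  assumes V: "finite V"
    and bound: "\<And>A. A \<subseteq> V \<Longrightarrow> R (card A) \<Longrightarrow> prob M {S. Q A S} \<le> b (card A)"
  shows "prob M {S. \<exists>A\<subseteq>V. R (card A) \<and> Q A S}
    \<le> (\<Sum>r | r \<le> card V \<and> R r. real (card V choose r) * b r)"
proof -
  define J where "J = {A. A \<subseteq> V \<and> R (card A)}"
  have J: "finite J" using V by (simp add: J_def)
  have "prob M {S. \<exists>A\<subseteq>V. R (card A) \<and> Q A S} \<le> (\<Sum>A\<in>J. prob M {S. Q A S})"
    by (rule prob_union_bound[OF J]) (auto simp: J_def)
  also have "\<dots> \<le> (\<Sum>A\<in>J. b (card A))" by (rule sum_mono) (use bound in \<open>auto simp: J_def\<close>)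
  also have "\<dots> = (\<Sum>r | r \<le> card V \<and> R r. \<Sum>A | A \<in> J \<and> card A = r. b (card A))"
    using J V by (intro sum.group[symmetric]) (auto simp: J_def card_mono)
  also have "\<dots> = (\<Sum>r | r \<le> card V \<and> R r. real (card V choose r) * b r)"
  proof (rule sum.cong[OF refl])
    fix r assume "r \<in> {r. r \<le> card V \<and> R r}"
    then have "{A. A \<in> J \<and> card A = r} = {A. A \<subseteq> V \<and> card A = r}" by (auto simp: J_def)
    then show "(\<Sum>A | A \<in> J \<and> card A = r. b (card A)) = real (card V choose r) * b r"
      using n_subsets[OF V, of r] by simp
  qed
  finally show ?thesis .
qed

definition mean_degree :: "nat \<Rightarrow> nat \<Rightarrow> nat \<Rightarrow> real" where
  "mean_degree n P K = real n * edge_rate P K"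

lemma mean_degree_nonneg [simp]: "0 \<le> mean_degree n P K"
  by (simp add: mean_degree_def)

text \<open>
  Here \<open>c\<close> is the constant in \<open>K = \<Omega>(\<surd>(ln n))\<close>. All estimates are uniform in the other parameters,
  so that \<open>P\<close> and \<open>K\<close> need not be sequences.
\<close>

locale sparse_rig = object_pool P K for P K :: nat +
  fixes c :: real and n :: nat
  assumes c_pos: "0 < c"
    and ln_ge_1: "1 \<le> ln (real n)"
    and K_ge: "c * sqrt (ln (real n)) \<le> real K"
    and mean_degree_le: "mean_degree n P K \<le> 3 * ln (real n)"
begin

abbreviation L :: real where "L \<equiv> ln (real n)"
abbreviation \<Lambda> :: real where "\<Lambda> \<equiv> mean_degree n P K"
abbreviation M :: "(nat \<Rightarrow> nat set) pmf" where "M \<equiv> objects_pmf {..<n} P K"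

lemma n_pos: "0 < real n"
  using ln_ge_1 by (cases "n = 0") auto

lemma n_ge_1: "1 \<le> n"
  using n_pos by simp

lemma edge_rate_le: "\<theta> \<le> 3 * L / real n"
  using mean_degree_le n_pos by (simp add: mean_degree_def field_simps)

lemma exp_K_le:
  assumes "m \<le> n"
  shows "exp (real K * real m / real P) \<le> exp (3 / c * sqrt L)"
proof -
  have "real K * real m / real P \<le> real K * real n / real P"
    using assms by (intro divide_right_mono mult_left_mono) auto
  also have "\<dots> = \<Lambda> / real K"
    using K_pos by (simp add: mean_degree_def edge_rate_def power2_eq_square)
  also have "\<dots> \<le> 3 * L / real K" using mean_degree_le by (intro divide_right_mono) auto
  also have "\<dots> \<le> 3 * L / (c * sqrt L)"
    using K_ge c_pos ln_ge_1 K_pos by (intro divide_left_mono) auto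
  also have "\<dots> = 3 / c * sqrt L"
    using c_pos ln_ge_1 real_div_sqrt[of L] by (simp add: field_simps)
  finally show ?thesis by simp
qed

end

section \<open>Connectivity given the minimum degree\<close>

definition small_overlap_event :: "nat \<Rightarrow> nat \<Rightarrow> (nat \<Rightarrow> nat set) set" where
  "small_overlap_event n q = {S. \<exists>A\<subseteq>{..<n}. (1 \<le> card A \<and> real (card A) \<le> real n powr 0.9) \<and>
     \<not> disjoint_family_on S A \<and> card (nbh {..<n} S A) \<le> q}"

definition few_objects_event :: "nat \<Rightarrow> nat \<Rightarrow> (nat \<Rightarrow> nat set) set" where
  "few_objects_event n K = {S. \<exists>A\<subseteq>{..<n}.
     (1 \<le> card A \<and> real (card A) \<le> 128 * real n / ln (real n)) \<and>
     2 * card (objects_of S A) < card A * K}"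

definition medium_cut_event :: "nat \<Rightarrow> nat \<Rightarrow> nat \<Rightarrow> (nat \<Rightarrow> nat set) set" where
  "medium_cut_event n K q = {S. \<exists>A\<subseteq>{..<n}.
     (real n powr 0.9 \<le> real (card A) \<and> real (card A) \<le> 128 * real n / ln (real n)) \<and>
     card A * K \<le> 2 * card (objects_of S A) \<and> card (nbh {..<n} S A) \<le> q}"

text \<open>
  A set of at most half of the nodes that has more than \<open>128 n / ln n\<close> elements and at most \<open>q\<close>
  neighbours is replaced by a subset of the size below, which has at most \<open>n div 2 + q\<close> neighbours.
\<close>

definition large_cut_event :: "nat \<Rightarrow> nat \<Rightarrow> nat \<Rightarrow> (nat \<Rightarrow> nat set) set" where
  "large_cut_event n K q = {S. \<exists>A\<subseteq>{..<n}. card A = nat \<lfloor>128 * real n / ln (real n)\<rfloor> \<and>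
     card A * K \<le> 2 * card (objects_of S A) \<and> card (nbh {..<n} S A) \<le> n div 2 + q}"

context sparse_rig
begin

lemma prob_overlapping_set_le:
  assumes A: "A \<subseteq> {..<n}" "1 \<le> card A" "real (card A) \<le> real n powr 0.9"
    and C: "L - C \<le> \<Lambda>"
    and large: "3 * L / real n * (real n powr 0.9 + real q) \<le> 1" "real n powr 0.9 + real q \<le> real n"
      "real n powr (1/20) * exp (3 / c * sqrt L) * (3 * L / real n) * real n powr 0.9 \<le> 1"
  defines "r \<equiv> real (card A)"
  shows "prob M {S. \<not> disjoint_family_on S A \<and> card (nbh {..<n} S A) \<le> q}
    \<le> (4 * L * r) ^ q * exp (- (r * (L - C - 1))) * (exp r / real n powr (1/20))"
proof -
  define m where "m = n - card A - q"
  define s where "s = real n powr (1/20)"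
  define t where "t = exp (real K * real m / real P)"
  have s: "1 \<le> s" using n_ge_1 by (simp add: s_def ge_one_powr_ge_zero)
  have r: "1 \<le> r" "r \<le> real n powr 0.9" using A(2,3) by (simp_all add: r_def)
  have "real (card A + q) \<le> real n" using large(2) r(2) by (simp add: r_def)
  then have m: "real m = real n - r - real q" by (simp add: m_def r_def of_nat_diff)
  have "prob M {S. \<not> disjoint_family_on S A \<and> card (nbh {..<n} S A) \<le> q}
     \<le> (1 + real n * (r * \<theta>)) ^ q * exp (- (r * \<theta> * real m)) * (exp (s * t * \<theta> * r\<^sup>2) / s)"
    using prob_overlap_small_nbh_le[OF finite_lessThan A(1) s, of q]
    by (simp add: r_def m_def t_def)
  also have "\<dots> \<le> (4 * L * r) ^ q * exp (- (r * (L - C - 1))) * (exp r / s)"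
  proof (intro mult_mono power_mono divide_right_mono)
    have "real n * (r * \<theta>) \<le> 3 * L * r"
      using mult_right_mono[OF mean_degree_le, of r] r by (simp add: mean_degree_def mult_ac)
    moreover have "1 \<le> L * r" using mult_mono[OF ln_ge_1 r(1)] ln_ge_1 by simp
    ultimately show "1 + real n * (r * \<theta>) \<le> 4 * L * r" by linarith
    have "\<theta> * (r + real q) \<le> 3 * L / real n * (real n powr 0.9 + real q)"
      using edge_rate_le r by (intro mult_mono) (auto intro: order_trans[OF edge_rate_nonneg])
    then have "L - C - 1 \<le> \<theta> * real m"
      using C large(1) unfolding m mean_degree_def by (simp add: algebra_simps)
    then have "r * (L - C - 1) \<le> r * (\<theta> * real m)" using r by (intro mult_left_mono) auto
    then show "exp (- (r * \<theta> * real m)) \<le> exp (- (r * (L - C - 1)))" by (simp add: mult_ac)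
    have "t \<le> exp (3 / c * sqrt L)" unfolding t_def by (rule exp_K_le) (simp add: m_def)
    then have "s * t * \<theta> * r \<le> s * exp (3 / c * sqrt L) * (3 * L / real n) * real n powr 0.9"
      using s edge_rate_le r ln_ge_1 by (intro mult_mono) (auto simp: t_def)
    also have "\<dots> \<le> 1" using large(3) by (simp add: s_def)
    finally have "s * t * \<theta> * r * r \<le> 1 * r" using r by (intro mult_right_mono) auto
    then show "exp (s * t * \<theta> * r\<^sup>2) \<le> exp r" by (simp add: power2_eq_square mult_ac)
  qed (use s r ln_ge_1 in auto)
  finally show ?thesis by (simp add: s_def)
qed

lemma choose_mult_overlap_term_le:
  assumes "1 \<le> s"
  shows "real (n choose r) * ((4 * L * real r) ^ q * exp (- (real r * (L - C - 1))) * (exp (real r) / s))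
    \<le> (4 * L) ^ q / s * fact q * (exp (C + 3) ^ r / fact r)"
proof -
  let ?E = "exp (- (real r * (L - C - 1)))"
  have "real (n choose r) * ((4 * L * real r) ^ q * ?E * (exp (real r) / s))
      \<le> real n ^ r / fact r * ((4 * L * real r) ^ q * ?E * (exp (real r) / s))"
    using choose_le_power_fact assms ln_ge_1 by (intro mult_right_mono) auto
  also have "\<dots> = (4 * L) ^ q / s * real r ^ q * ((real n ^ r * ?E * exp (real r)) / fact r)"
    by (simp add: power_mult_distrib mult_ac)
  also have "real n ^ r * ?E * exp (real r) = exp (real r * (C + 2))"
  proof -
    have "real n ^ r = exp (real r * L)" using n_pos by (simp add: exp_of_nat_mult)
    then show ?thesis by (simp add: exp_add[symmetric] algebra_simps)
  qed
  also have "(4 * L) ^ q / s * real r ^ q * (exp (real r * (C + 2)) / fact r)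
      \<le> (4 * L) ^ q / s * (fact q * exp (real r)) * (exp (real r * (C + 2)) / fact r)"
    using power_le_fact_exp[of "real r" q] ln_ge_1 assms
    by (intro mult_right_mono mult_left_mono) auto
  also have "\<dots> = (4 * L) ^ q / s * fact q * ((exp (real r) * exp (real r * (C + 2))) / fact r)"
    by simp
  also have "exp (real r) * exp (real r * (C + 2)) = exp (C + 3) ^ r"
    unfolding exp_add[symmetric] exp_of_nat_mult[symmetric] by (simp add: algebra_simps)
  finally show ?thesis .
qed

lemma prob_small_overlap_event_le:
  assumes C: "L - C \<le> \<Lambda>"
    and large: "3 * L / real n * (real n powr 0.9 + real q) \<le> 1" "real n powr 0.9 + real q \<le> real n"
      "real n powr (1/20) * exp (3 / c * sqrt L) * (3 * L / real n) * real n powr 0.9 \<le> 1"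
  shows "prob M (small_overlap_event n q)
    \<le> (4 * L) ^ q * real n powr (-1/20) * (fact q * exp (exp (C + 3)))"
proof -
  define s where "s = real n powr (1/20)"
  have s: "1 \<le> s" using n_ge_1 by (simp add: s_def ge_one_powr_ge_zero)
  let ?I = "{r. r \<le> card {..<n} \<and> 1 \<le> r \<and> real r \<le> real n powr 0.9}"
  have "prob M (small_overlap_event n q) \<le> (\<Sum>r\<in>?I. real (card {..<n} choose r) *
      ((4 * L * real r) ^ q * exp (- (real r * (L - C - 1))) * (exp (real r) / s)))"
    unfolding small_overlap_event_def s_def
    using prob_overlapping_set_le[OF _ _ _ C large] by (intro prob_ex_subset_le) auto
  also have "\<dots> \<le> (\<Sum>r\<in>?I. (4 * L) ^ q / s * fact q * (exp (C + 3) ^ r / fact r))"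
    using choose_mult_overlap_term_le[OF s] by (intro sum_mono) simp
  also have "\<dots> = (4 * L) ^ q / s * fact q * (\<Sum>r\<in>?I. exp (C + 3) ^ r / fact r)"
    by (simp add: sum_distrib_left)
  also have "\<dots> \<le> (4 * L) ^ q / s * fact q * exp (exp (C + 3))"
    using ln_ge_1 s by (intro mult_left_mono sum_power_fact_le_exp) auto
  finally show ?thesis by (simp add: s_def powr_minus_divide mult_ac)
qed

lemma prob_few_objects_set_le:
  assumes A: "A \<subseteq> {..<n}" "1 \<le> card A" "real (card A) \<le> 128 * real n / L"
    and large: "exp 1 \<le> L / 128" "3 * L * (L / 128) powr (-3/4) \<le> c * sqrt L / 16"
  defines "r \<equiv> real (card A)"
  shows "prob M {S. 2 * card (objects_of S A) < card A * K}
    \<le> exp (- (r * real K * ln (real n / r) / 16))"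
proof -
  define x where "x = real n / r"
  define y where "y = ln x / 4"
  have r: "1 \<le> r" using A(2) by (simp add: r_def)
  have x: "L / 128 \<le> x" using A(3) r ln_ge_1 by (simp add: x_def r_def field_simps)
  have x_pos: "x > 0" using n_pos r by (simp add: x_def)
  have "exp 1 \<le> x" using x large(1) by linarith
  then have ln_x: "1 \<le> ln x" using x_pos by (simp add: ln_ge_iff)
  have exp_y: "exp y = x powr (1/4)" using x_pos by (simp add: y_def powr_def)
  have "(exp y - 1) * \<theta> * r\<^sup>2 \<le> exp y * \<theta> * r\<^sup>2" by (intro mult_right_mono) auto
  also have "\<dots> = x powr (1/4) * (\<Lambda> * (r / x))"
    using n_pos r by (simp add: exp_y x_def mean_degree_def power2_eq_square)
  also have "\<dots> \<le> x powr (1/4) * ((3 * L) * (r / x))"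
    using mean_degree_le x_pos r by (intro mult_left_mono mult_right_mono) auto
  also have "\<dots> = 3 * L * (x powr (1/4) / x) * r" by simp
  also have "x powr (1/4) / x = x powr (-3/4)" using x_pos powr_diff[of x "1/4" 1] by simp
  also have "3 * L * x powr (-3/4) * r \<le> 3 * L * (L / 128) powr (-3/4) * r"
    using x ln_ge_1 r by (intro mult_right_mono mult_left_mono powr_mono2') auto
  also have "\<dots> \<le> (c * sqrt L / 16) * r" using large(2) r by (intro mult_right_mono) auto
  also have "\<dots> \<le> (real K / 16) * r" using K_ge r by (intro mult_right_mono divide_right_mono) auto
  also have "\<dots> \<le> (real K / 16) * r * ln x"
    using mult_left_mono[OF ln_x, of "real K / 16 * r"] r by simp
  finally have "(exp y - 1) * \<theta> * r\<^sup>2 \<le> (real K / 16) * r * ln x" .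
  moreover have "y * r * real K / 2 = 2 * ((real K / 16) * r * ln x)"
    "r * real K * ln x / 16 = (real K / 16) * r * ln x" by (simp_all add: y_def)
  ultimately have "- (y * r * real K / 2) + (exp y - 1) * \<theta> * r\<^sup>2 \<le> - (r * real K * ln x / 16)"
    by linarith
  moreover have "prob M {S. 2 * card (objects_of S A) < card A * K}
      \<le> exp (- (y * r * real K / 2) + (exp y - 1) * \<theta> * r\<^sup>2)"
    unfolding r_def
    by (rule prob_few_objects_le[OF finite_lessThan A(1)]) (use ln_x in \<open>simp add: y_def\<close>)
  ultimately show ?thesis unfolding x_def by (meson exp_le_cancel_iff order_trans)
qed

lemma choose_mult_few_objects_term_le:
  assumes r: "1 \<le> r" "real r \<le> 128 * real n / L"
    and large: "exp 1 \<le> L / 128" "64 \<le> c * sqrt L"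
  shows "real (n choose r) * exp (- (real r * real K * ln (real n / real r) / 16)) \<le> (128 / L) ^ r"
proof -
  define x where "x = real n / real r"
  have x: "L / 128 \<le> x" using r ln_ge_1 by (simp add: x_def field_simps)
  have x_pos: "x > 0" using n_pos r by (simp add: x_def)
  have "exp 1 \<le> x" using x large(1) by linarith
  then have ln_x: "1 \<le> ln x" using x_pos by (simp add: ln_ge_iff)
  have "real (n choose r) * exp (- (real r * real K * ln x / 16))
      \<le> exp (real r * (1 + ln x)) * exp (- (real r * real K * ln x / 16))"
    unfolding x_def using r n_ge_1 by (intro mult_right_mono choose_le_exp) auto
  also have "\<dots> = exp (real r * (1 + ln x - real K * ln x / 16))"
    unfolding exp_add[symmetric] by (simp add: algebra_simps)
  also have "\<dots> \<le> exp (real r * (- ln x))"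
  proof -
    have "64 * ln x \<le> real K * ln x" using K_ge large(2) ln_x by (intro mult_right_mono) auto
    then have "1 + ln x - real K * ln x / 16 \<le> - ln x" using ln_x by linarith
    then show ?thesis unfolding exp_le_cancel_iff by (intro mult_left_mono) auto
  qed
  also have "\<dots> = (1 / x) ^ r" using x_pos by (simp add: exp_of_nat_mult exp_minus field_simps)
  also have "\<dots> \<le> (128 / L) ^ r"
    using x x_pos ln_ge_1 by (intro power_mono) (auto simp: field_simps)
  finally show ?thesis unfolding x_def .
qed

lemma prob_few_objects_event_le:
  assumes large: "exp 1 \<le> L / 128" "3 * L * (L / 128) powr (-3/4) \<le> c * sqrt L / 16"
    "64 \<le> c * sqrt L" "128 / L \<le> 1 / 2"
  shows "prob M (few_objects_event n K) \<le> 2 * (128 / L)"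
proof -
  let ?I = "{r. r \<le> card {..<n} \<and> 1 \<le> r \<and> real r \<le> 128 * real n / L}"
  have "prob M (few_objects_event n K)
      \<le> (\<Sum>r\<in>?I. real (card {..<n} choose r) * exp (- (real r * real K * ln (real n / real r) / 16)))"
    unfolding few_objects_event_def
    using prob_few_objects_set_le[OF _ _ _ large(1,2)] by (intro prob_ex_subset_le) auto
  also have "\<dots> \<le> (\<Sum>r\<in>?I. (128 / L) ^ r)"
    using choose_mult_few_objects_term_le[OF _ _ large(1,3)] by (intro sum_mono) simp
  also have "\<dots> \<le> 2 * (128 / L)"
    using large(4) ln_ge_1 by (intro sum_power_le_twice) auto
  finally show ?thesis .
qed

lemma prob_medium_cut_set_le:
  assumes A: "A \<subseteq> {..<n}" "real (card A) \<le> 128 * real n / L"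
    and C: "L - C \<le> \<Lambda>" and large: "128 * real n / L + real q \<le> real n / 2"
  defines "r \<equiv> real (card A)"
  shows "prob M {S. card A * K \<le> 2 * card (objects_of S A) \<and> card (nbh {..<n} S A) \<le> q}
    \<le> (1 + real n) ^ q * exp (- (r * (L - C) / 4))"
proof -
  define m where "m = n - card A - q"
  have "r + real q \<le> real n / 2" using large A(2) by (simp add: r_def)
  then have m: "real m \<ge> real n / 2" unfolding m_def r_def by linarith
  have "r * (L - C) \<le> r * \<Lambda>" using C by (intro mult_left_mono) (auto simp: r_def)
  moreover have "r * \<theta> * (real n / 2) \<le> r * \<theta> * real m"
    using m by (intro mult_left_mono) (auto simp: r_def)
  moreover have "r * \<theta> * (real n / 2) = r * \<Lambda> / 2" by (simp add: mean_degree_def)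
  ultimately have "- (r * \<theta> * real m / 2) \<le> - (r * (L - C) / 4)" by linarith
  moreover have "real (\<Sum>i\<le>q. n choose i) \<le> (1 + real n) ^ q"
    using binomial_partial_sum_le[of 1 n q] by simp
  ultimately have "real (\<Sum>i\<le>q. n choose i) * exp (- (r * \<theta> * real m / 2))
      \<le> (1 + real n) ^ q * exp (- (r * (L - C) / 4))"
    by (intro mult_mono) auto
  then show ?thesis
    using prob_many_objects_small_nbh_le[OF finite_lessThan A(1), of q]
    unfolding r_def m_def by simp
qed

lemma choose_mult_medium_cut_term_le:
  assumes r: "1 \<le> r" "real n powr 0.9 \<le> real r"
    and large: "1 + C / 4 - 3/20 * L \<le> -1/10 * L"
  shows "real (n choose r) * ((1 + real n) ^ q * exp (- (real r * (L - C) / 4)))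
    \<le> (1 + real n) ^ q * exp (- (1/10) * real n powr 0.9 * L)"
proof -
  define x where "x = real n / real r"
  have "real n = real n powr 0.1 * real n powr 0.9" using n_pos by (simp add: powr_add[symmetric])
  also have "\<dots> \<le> real n powr 0.1 * real r" using r by (intro mult_left_mono) auto
  finally have "x \<le> real n powr 0.1" using r by (simp add: x_def field_simps)
  then have "ln x \<le> ln (real n powr 0.1)" using n_pos r by (intro ln_mono) (auto simp: x_def)
  also have "\<dots> = L / 10" using n_pos by (simp add: ln_powr)
  finally have "1 + ln x - (L - C) / 4 \<le> - (1/10) * L" using large by (simp add: field_simps)
  then have "real r * (1 + ln x - (L - C) / 4) \<le> real r * (- (1/10) * L)"
    by (intro mult_left_mono) auto
  also have "\<dots> \<le> - (1/10) * real n powr 0.9 * L"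
    using mult_left_mono[OF r(2), of "1/10 * L"] ln_ge_1 by (simp add: mult_ac)
  finally have exponent: "real r * (1 + ln x) + - (real r * (L - C) / 4)
      \<le> - (1/10) * real n powr 0.9 * L"
    by (simp add: algebra_simps)
  have "real (n choose r) * exp (- (real r * (L - C) / 4))
      \<le> exp (real r * (1 + ln x)) * exp (- (real r * (L - C) / 4))"
    unfolding x_def using r n_ge_1 by (intro mult_right_mono choose_le_exp) auto
  also have "\<dots> \<le> exp (- (1/10) * real n powr 0.9 * L)"
    unfolding exp_add[symmetric] exp_le_cancel_iff by (rule exponent)
  finally show ?thesis by (simp add: mult_left_mono mult.left_commute)
qed

lemma prob_medium_cut_event_le:
  assumes C: "L - C \<le> \<Lambda>"
    and large: "128 * real n / L + real q \<le> real n / 2" "1 + C / 4 - 3/20 * L \<le> -1/10 * L"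
  shows "prob M (medium_cut_event n K q)
    \<le> (1 + real n) * ((1 + real n) ^ q * exp (- (1/10) * real n powr 0.9 * L))" (is "_ \<le> _ * ?b")
proof -
  let ?I = "{r. r \<le> card {..<n} \<and> real n powr 0.9 \<le> real r \<and> real r \<le> 128 * real n / L}"
  have "prob M (medium_cut_event n K q)
      \<le> (\<Sum>r\<in>?I. real (card {..<n} choose r) * ((1 + real n) ^ q * exp (- (real r * (L - C) / 4))))"
    unfolding medium_cut_event_def
    using prob_medium_cut_set_le[OF _ _ C large(1)] by (intro prob_ex_subset_le) auto
  also have "\<dots> \<le> (\<Sum>r\<in>?I. ?b)"
  proof (rule sum_mono)
    fix r assume r: "r \<in> ?I"
    have "0 < real n powr 0.9" using n_pos by simp
    then have "1 \<le> r" using r by (cases "r = 0") auto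
    then show "real (card {..<n} choose r) * ((1 + real n) ^ q * exp (- (real r * (L - C) / 4)))
        \<le> ?b"
      using choose_mult_medium_cut_term_le[OF _ _ large(2)] r by simp
  qed
  also have "\<dots> = real (card ?I) * ?b" by simp
  also have "\<dots> \<le> (1 + real n) * ?b"
  proof (rule mult_right_mono)
    have "card ?I \<le> card {..n}" by (intro card_mono) auto
    then show "real (card ?I) \<le> 1 + real n" by simp
  qed simp
  finally show ?thesis .
qed

lemma prob_large_cut_set_le:
  assumes A: "A \<subseteq> {..<n}" "card A = nat \<lfloor>128 * real n / L\<rfloor>"
    and \<Lambda>: "L / 2 \<le> \<Lambda>"
    and large: "128 * real n / L + real n / 2 + real q \<le> 3/4 * real n"
      "64 * real n / L \<le> 128 * real n / L - 1"
  shows "prob M {S. card A * K \<le> 2 * card (objects_of S A) \<and> card (nbh {..<n} S A) \<le> n div 2 + q}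
    \<le> 2 ^ n * exp (- 4 * real n)"
proof -
  define m where "m = n - card A - (n div 2 + q)"
  define r where "r = real (card A)"
  have r: "r \<le> 128 * real n / L" "64 * real n / L \<le> r"
    using ln_ge_1 n_pos large(2) unfolding A(2) r_def by linarith+
  have "real (n div 2) \<le> real n / 2" by linarith
  then have "r + real (n div 2 + q) \<le> 3/4 * real n" using large(1) r by simp
  then have m: "real m \<ge> real n / 4" unfolding m_def r_def by linarith
  have "32 * real n = (64 * real n / L) * (L / 2)" using ln_ge_1 by simp
  also have "\<dots> \<le> r * \<Lambda>" using r \<Lambda> ln_ge_1 by (intro mult_mono) (auto simp: r_def)
  finally have "8 * real n \<le> r * \<theta> * (real n / 4)" by (simp add: mean_degree_def mult_ac)
  also have "\<dots> \<le> r * \<theta> * real m" using m by (intro mult_left_mono) (auto simp: r_def)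
  finally have "exp (- (r * \<theta> * real m / 2)) \<le> exp (- 4 * real n)" by simp
  moreover have "real (\<Sum>i\<le>n div 2 + q. n choose i) \<le> real (2 ^ n)"
    by (rule of_nat_mono[OF binomial_partial_sum_le_pow2])
  ultimately have "real (\<Sum>i\<le>n div 2 + q. n choose i) * exp (- (r * \<theta> * real m / 2))
      \<le> 2 ^ n * exp (- 4 * real n)"
    by (intro mult_mono) auto
  then show ?thesis
    using prob_many_objects_small_nbh_le[OF finite_lessThan A(1), of "n div 2 + q"]
    unfolding m_def r_def by simp
qed

lemma prob_large_cut_event_le:
  assumes \<Lambda>: "L / 2 \<le> \<Lambda>"
    and large: "128 * real n / L + real n / 2 + real q \<le> 3/4 * real n"
      "64 * real n / L \<le> 128 * real n / L - 1"
  shows "prob M (large_cut_event n K q) \<le> exp (- 2 * real n)"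
proof -
  let ?r = "nat \<lfloor>128 * real n / L\<rfloor>"
  have "prob M (large_cut_event n K q)
      \<le> (\<Sum>r | r \<le> card {..<n} \<and> r = ?r. real (card {..<n} choose r) * (2 ^ n * exp (- 4 * real n)))"
    unfolding large_cut_event_def
    using prob_large_cut_set_le[OF _ _ \<Lambda> large] by (intro prob_ex_subset_le) auto
  also have "\<dots> \<le> (\<Sum>r\<in>{?r}. real (card {..<n} choose r) * (2 ^ n * exp (- 4 * real n)))"
    by (intro sum_mono2) auto
  also have "\<dots> \<le> 2 ^ n * (2 ^ n * exp (- 4 * real n))"
    using of_nat_mono[OF binomial_le_pow2[of n ?r], where 'a = real] by simp
  also have "\<dots> \<le> exp (real n) * (exp (real n) * exp (- 4 * real n))"
  proof -
    have "(2::real) ^ n \<le> exp 1 ^ n" using exp_ge_add_one_self[of 1] by (intro power_mono) auto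
    then have "(2::real) ^ n \<le> exp (real n)" by (simp add: exp_of_nat_mult[symmetric])
    then show ?thesis by (intro mult_mono) auto
  qed
  also have "\<dots> = exp (- 2 * real n)" by (simp add: exp_add[symmetric])
  finally show ?thesis .
qed

end

lemma small_overlap_event_unlikely:
  fixes c C \<epsilon> :: real
  assumes "c > 0" "\<epsilon> > 0"
  shows "\<forall>\<^sub>F n in sequentially. \<forall>P K. sparse_rig P K c n \<and> ln (real n) - C \<le> mean_degree n P K \<longrightarrow>
    prob (objects_pmf {..<n} P K) (small_overlap_event n q) \<le> \<epsilon>"
proof -
  have large: "\<forall>\<^sub>F n in sequentially. 3 * ln (real n) / real n * (real n powr 0.9 + real q) \<le> 1"
    "\<forall>\<^sub>F n in sequentially. real n powr 0.9 + real q \<le> real n"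
    "\<forall>\<^sub>F n in sequentially. real n powr (1/20) * exp (3 / c * sqrt (ln (real n))) *
      (3 * ln (real n) / real n) * real n powr 0.9 \<le> 1"
    using assms(1) by real_asymp+
  have "(\<lambda>n::nat. (4 * ln (real n)) ^ q * real n powr (-1/20) * (fact q * exp (exp (C + 3)))) \<longlonglongrightarrow> 0"
    by (rule tendsto_mult_left_zero) real_asymp
  then have "\<forall>\<^sub>F n in sequentially.
      (4 * ln (real n)) ^ q * real n powr (-1/20) * (fact q * exp (exp (C + 3))) < \<epsilon>"
    using assms(2) by (rule order_tendstoD)
  with large show ?thesis
  proof eventually_elim
    case (elim n)
    show ?case
    proof (intro allI impI, elim conjE)
      fix P K assume "sparse_rig P K c n" and C: "ln (real n) - C \<le> mean_degree n P K"
      then interpret sparse_rig P K c n by simp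
      show "prob M (small_overlap_event n q) \<le> \<epsilon>"
        using prob_small_overlap_event_le[OF C elim(1-3)] elim(4) by linarith
    qed
  qed
qed

lemma few_objects_event_unlikely:
  fixes c \<epsilon> :: real
  assumes "c > 0" "\<epsilon> > 0"
  shows "\<forall>\<^sub>F n in sequentially. \<forall>P K. sparse_rig P K c n \<longrightarrow>
    prob (objects_pmf {..<n} P K) (few_objects_event n K) \<le> \<epsilon>"
proof -
  have "\<forall>\<^sub>F n in sequentially. exp 1 \<le> ln (real n) / 128"
    "\<forall>\<^sub>F n in sequentially. 3 * ln (real n) * (ln (real n) / 128) powr (-3/4)
        \<le> c * sqrt (ln (real n)) / 16"
    "\<forall>\<^sub>F n in sequentially. 64 \<le> c * sqrt (ln (real n))"
    "\<forall>\<^sub>F n in sequentially. 128 / ln (real n) \<le> 1 / 2"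
    "\<forall>\<^sub>F n in sequentially. 2 * (128 / ln (real n)) \<le> \<epsilon>"
    using assms by real_asymp+
  then show ?thesis
  proof eventually_elim
    case (elim n)
    show ?case
    proof (intro allI impI)
      fix P K assume "sparse_rig P K c n"
      then interpret sparse_rig P K c n .
      show "prob M (few_objects_event n K) \<le> \<epsilon>"
        using prob_few_objects_event_le[OF elim(1-4)] elim(5) by linarith
    qed
  qed
qed

lemma medium_cut_event_unlikely:
  fixes c C \<epsilon> :: real
  assumes "\<epsilon> > 0"
  shows "\<forall>\<^sub>F n in sequentially. \<forall>P K. sparse_rig P K c n \<and> ln (real n) - C \<le> mean_degree n P K \<longrightarrow>
    prob (objects_pmf {..<n} P K) (medium_cut_event n K q) \<le> \<epsilon>"
proof -
  have "\<forall>\<^sub>F n in sequentially. 128 * real n / ln (real n) + real q \<le> real n / 2"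
    "\<forall>\<^sub>F n in sequentially. 1 + C / 4 - 3/20 * ln (real n) \<le> -1/10 * ln (real n)"
    "\<forall>\<^sub>F n in sequentially.
      (1 + real n) * ((1 + real n) ^ q * exp (- (1/10) * real n powr 0.9 * ln (real n))) \<le> \<epsilon>"
    using assms by real_asymp+
  then show ?thesis
  proof eventually_elim
    case (elim n)
    show ?case
    proof (intro allI impI, elim conjE)
      fix P K assume "sparse_rig P K c n" and C: "ln (real n) - C \<le> mean_degree n P K"
      then interpret sparse_rig P K c n by simp
      show "prob M (medium_cut_event n K q) \<le> \<epsilon>"
        using prob_medium_cut_event_le[OF C elim(1,2)] elim(3) by linarith
    qed
  qed
qed

lemma large_cut_event_unlikely:
  fixes c C \<epsilon> :: real
  assumes "\<epsilon> > 0"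
  shows "\<forall>\<^sub>F n in sequentially. \<forall>P K. sparse_rig P K c n \<and> ln (real n) - C \<le> mean_degree n P K \<longrightarrow>
    prob (objects_pmf {..<n} P K) (large_cut_event n K q) \<le> \<epsilon>"
proof -
  have "\<forall>\<^sub>F n in sequentially. 128 * real n / ln (real n) + real n / 2 + real q \<le> 3/4 * real n"
    "\<forall>\<^sub>F n in sequentially. 64 * real n / ln (real n) \<le> 128 * real n / ln (real n) - 1"
    "\<forall>\<^sub>F n in sequentially. ln (real n) / 2 \<le> ln (real n) - C"
    "\<forall>\<^sub>F n in sequentially. exp (- 2 * real n) \<le> \<epsilon>"
    using assms by real_asymp+
  then show ?thesis
  proof eventually_elim
    case (elim n)
    show ?case
    proof (intro allI impI, elim conjE)
      fix P K assume "sparse_rig P K c n" and C: "ln (real n) - C \<le> mean_degree n P K"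
      then interpret sparse_rig P K c n by simp
      show "prob M (large_cut_event n K q) \<le> \<epsilon>"
        using prob_large_cut_event_le[OF order_trans[OF elim(3) C] elim(1,2)] elim(4) by linarith
    qed
  qed
qed

lemma not_k_connected_imp_overlapping_cut:
  assumes deg: "\<forall>v<n. k \<le> card (nbh {..<n} S {v})"
    and "\<not> k_connected k {..<n} (intersection_edges n S)"
  shows "\<exists>A\<subseteq>{..<n}. 1 \<le> card A \<and> 2 * card A \<le> n \<and> card (nbh {..<n} S A) < k \<and>
           \<not> disjoint_family_on S A"
proof -
  have "\<forall>v\<in>{..<n}. k \<le> node_degree {..<n} (intersection_edges n S) v"
    using deg by (simp add: node_degree_intersection_edges)
  from not_k_connected_imp_small_boundary[OF finite_lessThan this assms(2)]
  obtain A a b where A: "A \<subseteq> {..<n}" "2 * card A \<le> card {..<n}"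
    "card (boundary {..<n} (intersection_edges n S) A) < k"
    and ab: "a \<in> A" "b \<in> A" "a \<noteq> b" "{a, b} \<in> intersection_edges n S" by blast
  have "\<not> disjoint_family_on S A"
    using ab by (auto simp: intersection_edges_iff disjoint_family_on_def)
  moreover have "1 \<le> card A"
    using ab(1) finite_subset[OF A(1)] by (auto simp: Suc_le_eq card_gt_0_iff)
  ultimately show ?thesis using A by (auto simp: boundary_intersection_edges)
qed

lemma cut_events_cover:
  assumes A: "A \<subseteq> {..<n}" "1 \<le> card A" "2 * card A \<le> n" "card (nbh {..<n} S A) \<le> q"
    and "\<not> disjoint_family_on S A" and large: "1 \<le> 128 * real n / ln (real n)"
  shows "S \<in> small_overlap_event n q \<union> few_objects_event n K \<union>
    medium_cut_event n K q \<union> large_cut_event n K q"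
proof -
  let ?m = "nat \<lfloor>128 * real n / ln (real n)\<rfloor>"
  consider (small) "real (card A) \<le> real n powr 0.9"
    | (medium) "real n powr 0.9 \<le> real (card A)" "real (card A) \<le> 128 * real n / ln (real n)"
    | (large) "128 * real n / ln (real n) \<le> real (card A)" by linarith
  then show ?thesis
  proof cases
    case small
    then have "S \<in> small_overlap_event n q"
      using assms unfolding small_overlap_event_def by blast
    then show ?thesis by blast
  next
    case medium
    then have "S \<in> few_objects_event n K \<union> medium_cut_event n K q"
      using A unfolding few_objects_event_def medium_cut_event_def
      by (cases "2 * card (objects_of S A) < card A * K") (auto simp: not_less)
    then show ?thesis by blast
  next
    case large
    have m: "1 \<le> ?m" "real ?m \<le> 128 * real n / ln (real n)" using assms(6) by linarith+
    have "?m \<le> card A" using large m by linarith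
    then obtain A' where A': "A' \<subseteq> A" "card A' = ?m" by (meson obtain_subset_with_card_n)
    have nbh_A': "card (nbh {..<n} S A') \<le> n div 2 + q"
      using card_nbh_subset_le[OF finite_lessThan A'(1) A(1), of S] A(3,4) by linarith
    show ?thesis
    proof (cases "2 * card (objects_of S A') < card A' * K")
      case True
      then have "S \<in> few_objects_event n K"
        unfolding few_objects_event_def using A' A(1) m by (intro CollectI exI[of _ A']) auto
      then show ?thesis by blast
    next
      case False
      then have "S \<in> large_cut_event n K q"
        unfolding large_cut_event_def using A' A(1) nbh_A' by (intro CollectI exI[of _ A']) auto
      then show ?thesis by blast
    qed
  qed
qed

definition min_degree_not_connected_event :: "nat \<Rightarrow> nat \<Rightarrow> (nat \<Rightarrow> nat set) set" where
  "min_degree_not_connected_event n k =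
     {S. (\<forall>v<n. k \<le> card (nbh {..<n} S {v})) \<and> \<not> k_connected k {..<n} (intersection_edges n S)}"

theorem min_degree_not_connected_unlikely:
  fixes c C \<epsilon> :: real
  assumes c: "c > 0" and "\<epsilon> > 0"
  shows "\<forall>\<^sub>F n in sequentially. \<forall>P K. sparse_rig P K c n \<and> ln (real n) - C \<le> mean_degree n P K \<longrightarrow>
    prob (objects_pmf {..<n} P K) (min_degree_not_connected_event n k) \<le> \<epsilon>"
proof -
  have \<epsilon>: "\<epsilon> / 4 > 0" using assms(2) by simp
  have "\<forall>\<^sub>F n in sequentially. 1 \<le> 128 * real n / ln (real n)" by real_asymp
  with small_overlap_event_unlikely[OF c \<epsilon>, of C "k - 1"] few_objects_event_unlikely[OF c \<epsilon>]
    medium_cut_event_unlikely[OF \<epsilon>, of c C "k - 1"] large_cut_event_unlikely[OF \<epsilon>, of c C "k - 1"]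
  show ?thesis
  proof eventually_elim
    case (elim n)
    show ?case
    proof (intro allI impI)
      fix P K assume sparse: "sparse_rig P K c n \<and> ln (real n) - C \<le> mean_degree n P K"
      then interpret sparse_rig P K c n by simp
      let ?E1 = "small_overlap_event n (k - 1)" and ?E2 = "few_objects_event n K"
        and ?E3 = "medium_cut_event n K (k - 1)" and ?E4 = "large_cut_event n K (k - 1)"
      have "prob M (min_degree_not_connected_event n k) \<le> prob M (?E1 \<union> ?E2 \<union> ?E3 \<union> ?E4)"
      proof (rule prob_mono_on_support)
        fix S assume "S \<in> min_degree_not_connected_event n k"
        then obtain A where "A \<subseteq> {..<n}" "1 \<le> card A" "2 * card A \<le> n"
          "card (nbh {..<n} S A) < k" "\<not> disjoint_family_on S A"
          using not_k_connected_imp_overlapping_cut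
          unfolding min_degree_not_connected_event_def by blast
        then show "S \<in> ?E1 \<union> ?E2 \<union> ?E3 \<union> ?E4" using elim(5) by (intro cut_events_cover) auto
      qed
      also have "\<dots> \<le> prob M ?E1 + prob M ?E2 + prob M ?E3 + prob M ?E4"
        by (intro order_trans[OF measure_Un_le] add_mono order_refl) auto
      also have "\<dots> \<le> \<epsilon> / 4 + \<epsilon> / 4 + \<epsilon> / 4 + \<epsilon> / 4"
        using elim(1-4) sparse by (intro add_mono) blast+
      finally show "prob M (min_degree_not_connected_event n k) \<le> \<epsilon>" by simp
    qed
  qed
qed

section \<open>Asymptotics of the joint degree distribution\<close>

definition degree_weight :: "nat \<Rightarrow> real \<Rightarrow> real" where
  "degree_weight d x = x ^ d * exp (- x) / fact d"

text \<open>
  The three summands of the upper factor stem from simple degree events, overlapping object sets and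
  double hits; both factors tend to \<open>1\<close>.
\<close>

definition degree_upper_factor :: "nat \<Rightarrow> nat \<Rightarrow> nat \<Rightarrow> real" where
  "degree_upper_factor j d n =
     exp (real j * real (j + j * d) * (3 * ln (real n) / real n))
     + (4 * (1 + real j) * ln (real n)) ^ (j * d) * real n powr (-1/20) *
       (exp (real j * real (j + j * d) * (3 * ln (real n) / real n)) * (exp 1 * fact d ^ j))
     + (4 * (1 + real j) * ln (real n)) ^ (j * d) * (real n * (3 * ln (real n) / real n)\<^sup>2) *
       (exp (real j * real (j + 1 + j * d) * (3 * ln (real n) / real n)) * ((real j)\<^sup>2 * fact d ^ j))"

definition degree_lower_factor :: "nat \<Rightarrow> nat \<Rightarrow> nat \<Rightarrow> real" where
  "degree_lower_factor j d n =
     (2 - exp (3 * ln (real n) / real n * (real j)\<^sup>2)) *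
     ((1 - real (j + j * d + d) / real n) ^ d) ^ j * (1 - real j * (3 * ln (real n) / real n)) ^ (j * d) *
     exp (- (2 * real j * (3 * ln (real n)) * (real (j + 1) * (3 * ln (real n) / real n))))"

lemma choose_ge_power:
  assumes "d \<le> m"
  shows "(real m - real d) ^ d \<le> fact d * real (m choose d)"
  using assms
proof (induction d)
  case (Suc d)
  have "Suc d * (m choose Suc d) = (m - d) * (m choose d)"
    using binomial_absorb_comp[of m d] Suc_times_binomial[of d "m - 1"] Suc.prems by (cases m) auto
  then have "real (Suc d) * real (m choose Suc d) = (real m - real d) * real (m choose d)"
    using Suc.prems by (metis of_nat_mult of_nat_diff Suc_leD)
  then have fact_choose_Suc: "fact (Suc d) * real (m choose Suc d)
      = (real m - real d) * (fact d * real (m choose d))"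
    by (simp only: fact_Suc mult_ac)
  have "(real m - real (Suc d)) ^ Suc d \<le> (real m - real d) ^ Suc d"
    using Suc.prems by (intro power_mono) auto
  also have "\<dots> \<le> (real m - real d) * (fact d * real (m choose d))"
    using Suc by (simp add: mult_left_mono)
  finally show ?case unfolding fact_choose_Suc .
qed simp

lemma choose_diff_ge:
  assumes "a + d \<le> n" "1 \<le> n"
  shows "(1 - real (a + d) / real n) ^ d * (real n ^ d / fact d) \<le> real ((n - a) choose d)"
    (is "?l \<le> _")
proof -
  have "?l * fact d = ((1 - real (a + d) / real n) * real n) ^ d"
    by (simp add: power_mult_distrib)
  also have "(1 - real (a + d) / real n) * real n = real (n - a) - real d"
    using assms by (simp add: left_diff_distrib of_nat_diff)
  also have "\<dots> ^ d \<le> fact d * real ((n - a) choose d)"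
    using assms by (intro choose_ge_power) auto
  finally have "?l * fact d \<le> real ((n - a) choose d) * fact d" by (simp only: mult.commute)
  then show ?thesis by (rule mult_right_le_imp_le) simp
qed

context sparse_rig
begin

lemma degree_weight_power:
  "degree_weight d \<Lambda> ^ j = (real n ^ d / fact d) ^ j * \<theta> ^ (j * d) * exp (- (real j * \<Lambda>))"
proof -
  have "degree_weight d \<Lambda> ^ j = (\<Lambda> ^ d / fact d) ^ j * exp (- \<Lambda>) ^ j"
    by (simp add: degree_weight_def power_mult_distrib[symmetric])
  also have "\<Lambda> ^ d / fact d = real n ^ d / fact d * \<theta> ^ d"
    by (simp add: mean_degree_def power_mult_distrib)
  also have "exp (- \<Lambda>) ^ j = exp (- (real j * \<Lambda>))" by (simp add: exp_of_nat_mult[symmetric])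
  finally show ?thesis
    by (simp only: power_mult_distrib[of "real n ^ d / fact d"] power_mult[symmetric] mult.commute[of d j])
qed

lemma exp_le_degree_weight_power:
  assumes "d = 0 \<or> 1 \<le> \<Lambda>"
  shows "exp (- (real j * \<Lambda>)) \<le> fact d ^ j * degree_weight d \<Lambda> ^ j"
proof -
  have "1 \<le> \<Lambda> ^ d" using assms by (cases "d = 0") auto
  then have "1 * exp (- \<Lambda>) \<le> \<Lambda> ^ d * exp (- \<Lambda>)" by (intro mult_right_mono) auto
  then have "exp (- \<Lambda>) \<le> fact d * degree_weight d \<Lambda>" by (simp add: degree_weight_def)
  then have "exp (- \<Lambda>) ^ j \<le> (fact d * degree_weight d \<Lambda>) ^ j" by (intro power_mono) auto
  then show ?thesis by (simp add: exp_of_nat_mult[symmetric] power_mult_distrib)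
qed

lemma exp_power_diff_le:
  "exp (- (real j * \<theta>)) ^ (n - a) \<le> exp (- (real j * \<Lambda>)) * exp (real j * real a * (3 * L / real n))"
proof -
  have "real n - real a \<le> real (n - a)" by linarith
  then have "(real n - real a) * (real j * \<theta>) \<le> real (n - a) * (real j * \<theta>)"
    by (intro mult_right_mono) auto
  moreover have "real j * real a * \<theta> \<le> real j * real a * (3 * L / real n)"
    using edge_rate_le by (intro mult_left_mono) auto
  ultimately have "real (n - a) * - (real j * \<theta>)
      \<le> - (real j * \<Lambda>) + real j * real a * (3 * L / real n)"
    by (simp add: mean_degree_def algebra_simps)
  then show ?thesis unfolding exp_of_nat_mult[symmetric] exp_add[symmetric] by simp
qed

lemma one_plus_mean_degree_le: "1 + real n * (real j * \<theta>) \<le> 4 * (1 + real j) * L"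
proof -
  have "real n * (real j * \<theta>) \<le> 3 * (real j * L)"
    using mult_left_mono[OF mean_degree_le, of "real j"] by (simp add: mean_degree_def mult_ac)
  moreover have "0 \<le> real j * L" using ln_ge_1 by simp
  moreover have "4 * (1 + real j) * L = 4 * L + 4 * (real j * L)" by (simp add: algebra_simps)
  ultimately show ?thesis using ln_ge_1 by linarith
qed

lemma prob_simple_degree_event_upper:
  assumes A: "A \<subseteq> {..<n}" "card A = j"
  shows "prob M (simple_degree_event {..<n} A d)
    \<le> exp (real j * real (j + j * d) * (3 * L / real n)) * degree_weight d \<Lambda> ^ j"
proof -
  have "prob M (simple_degree_event {..<n} A d)
      \<le> real (n choose d) ^ j * \<theta> ^ (j * d) * exp (- (real j * \<theta>)) ^ (n - (j + j * d))"
    using prob_simple_degree_event_le[OF finite_lessThan A(1), of d] A(2) by simp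
  also have "\<dots> \<le> (real n ^ d / fact d) ^ j * \<theta> ^ (j * d) *
      (exp (- (real j * \<Lambda>)) * exp (real j * real (j + j * d) * (3 * L / real n)))"
    by (intro mult_mono power_mono exp_power_diff_le choose_le_power_fact) auto
  finally show ?thesis by (simp add: degree_weight_power mult_ac)
qed

lemma prob_overlap_small_nbh_upper:
  assumes A: "A \<subseteq> {..<n}" "card A = j" and d: "d = 0 \<or> 1 \<le> \<Lambda>"
    and large: "real n powr (1/20) * exp (3 / c * sqrt L) * (3 * L / real n) * (real j)\<^sup>2 \<le> 1"
  shows "prob M {S. \<not> disjoint_family_on S A \<and> card (nbh {..<n} S A) \<le> j * d}
    \<le> (4 * (1 + real j) * L) ^ (j * d) * real n powr (-1/20) *
      (exp (real j * real (j + j * d) * (3 * L / real n)) * (exp 1 * fact d ^ j)) * degree_weight d \<Lambda> ^ j"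
proof -
  define m where "m = n - (j + j * d)"
  define s where "s = real n powr (1/20)"
  define t where "t = exp (real K * real m / real P)"
  have s: "1 \<le> s" using n_ge_1 by (simp add: s_def ge_one_powr_ge_zero)
  let ?U = "exp (real j * real (j + j * d) * (3 * L / real n))"
  have "prob M {S. \<not> disjoint_family_on S A \<and> card (nbh {..<n} S A) \<le> j * d}
      \<le> (1 + real n * (real j * \<theta>)) ^ (j * d) * exp (- (real j * \<theta>)) ^ m * (exp (s * t * \<theta> * (real j)\<^sup>2) / s)"
    using prob_overlap_small_nbh_le[OF finite_lessThan A(1) s, of "j * d"] A(2)
    by (simp add: t_def m_def exp_of_nat_mult[symmetric] mult_ac)
  also have "\<dots> \<le> (4 * (1 + real j) * L) ^ (j * d) * (exp (- (real j * \<Lambda>)) * ?U) * (exp 1 / s)"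
  proof (intro mult_mono divide_right_mono power_mono one_plus_mean_degree_le)
    show "exp (- (real j * \<theta>)) ^ m \<le> exp (- (real j * \<Lambda>)) * ?U"
      unfolding m_def by (rule exp_power_diff_le)
    have "t \<le> exp (3 / c * sqrt L)" unfolding t_def by (rule exp_K_le) (simp add: m_def)
    then have "s * t * \<theta> * (real j)\<^sup>2 \<le> s * exp (3 / c * sqrt L) * (3 * L / real n) * (real j)\<^sup>2"
      using s edge_rate_le ln_ge_1 by (intro mult_mono) (auto simp: t_def)
    also have "\<dots> \<le> 1" using large by (simp add: s_def)
    finally show "exp (s * t * \<theta> * (real j)\<^sup>2) \<le> exp 1" by simp
  qed (use s ln_ge_1 in auto)
  also have "\<dots> = (4 * (1 + real j) * L) ^ (j * d) * (?U * exp 1 / s) * exp (- (real j * \<Lambda>))" by simp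
  also have "\<dots>
      \<le> (4 * (1 + real j) * L) ^ (j * d) * (?U * exp 1 / s) * (fact d ^ j * degree_weight d \<Lambda> ^ j)"
    using exp_le_degree_weight_power[OF d] s ln_ge_1 by (intro mult_left_mono) auto
  finally show ?thesis by (simp add: s_def powr_minus_divide mult_ac)
qed

lemma prob_double_hit_small_nbh_upper:
  assumes A: "A \<subseteq> {..<n}" "card A = j" and d: "d = 0 \<or> 1 \<le> \<Lambda>"
  shows "prob M {S. disjoint_family_on S A \<and> card (nbh {..<n} S A) \<le> j * d \<and> double_hit {..<n} S A}
    \<le> (4 * (1 + real j) * L) ^ (j * d) * (real n * (3 * L / real n)\<^sup>2) *
      (exp (real j * real (j + 1 + j * d) * (3 * L / real n)) * ((real j)\<^sup>2 * fact d ^ j)) * degree_weight d \<Lambda> ^ j"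
proof -
  let ?U = "exp (real j * real (j + 1 + j * d) * (3 * L / real n))"
  have "prob M {S. disjoint_family_on S A \<and> card (nbh {..<n} S A) \<le> j * d \<and> double_hit {..<n} S A}
      \<le> real n * ((real j * \<theta>)\<^sup>2 * ((1 + real n * (real j * \<theta>)) ^ (j * d)
        * exp (- (real j * \<theta>)) ^ (n - (j + 1 + j * d))))"
    using prob_double_hit_small_nbh_le[OF finite_lessThan A(1), of "j * d"] A(2) by simp
  also have "\<dots> \<le> real n * ((real j * (3 * L / real n))\<^sup>2 * ((4 * (1 + real j) * L) ^ (j * d)
      * (exp (- (real j * \<Lambda>)) * ?U)))"
    using edge_rate_le ln_ge_1
    by (intro mult_left_mono mult_mono power_mono one_plus_mean_degree_le exp_power_diff_le) auto
  also have "\<dots>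
      = (4 * (1 + real j) * L) ^ (j * d) * (real n * (3 * L / real n)\<^sup>2) * (?U * (real j)\<^sup>2)
      * exp (- (real j * \<Lambda>))"
    by (simp only: power_mult_distrib mult_ac)
  also have "\<dots>
      \<le> (4 * (1 + real j) * L) ^ (j * d) * (real n * (3 * L / real n)\<^sup>2) * (?U * (real j)\<^sup>2)
      * (fact d ^ j * degree_weight d \<Lambda> ^ j)"
    using exp_le_degree_weight_power[OF d] ln_ge_1 by (intro mult_left_mono) auto
  finally show ?thesis by (simp only: mult_ac)
qed

lemma exp_miss_power_ge:
  assumes "real (j + 1) * (3 * L / real n) \<le> 1 / 2"
  shows "exp (- (real j * \<Lambda>)) * exp (- (2 * real j * (3 * L) * (real (j + 1) * (3 * L / real n))))
    \<le> exp (- (real j * \<theta> / (1 - real (j + 1) * \<theta>))) ^ (n - a)"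
proof -
  let ?y = "real (j + 1) * \<theta>"
  have y_le: "?y \<le> real (j + 1) * (3 * L / real n)"
    using edge_rate_le by (intro mult_left_mono) auto
  have y: "0 \<le> ?y" "?y \<le> 1 / 2" using y_le assms by simp_all
  have "1 / (1 - ?y) \<le> 1 + 2 * ?y"
  proof -
    have "0 \<le> ?y * (1 - 2 * ?y)" by (rule mult_nonneg_nonneg) (use y in linarith)+
    then have "1 \<le> (1 + 2 * ?y) * (1 - ?y)" by (simp add: algebra_simps)
    then show ?thesis using y(2) by (simp add: divide_le_eq)
  qed
  then have "real j * \<theta> * (1 / (1 - ?y)) \<le> real j * \<theta> * (1 + 2 * ?y)" by (intro mult_left_mono) auto
  then have "real n * (real j * \<theta> / (1 - ?y)) \<le> real n * (real j * \<theta> * (1 + 2 * ?y))"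
    by (intro mult_left_mono) auto
  also have "\<dots> = real j * \<Lambda> + 2 * real j * \<Lambda> * ?y" by (simp add: mean_degree_def algebra_simps)
  also have "2 * real j * \<Lambda> * ?y \<le> 2 * real j * (3 * L) * (real (j + 1) * (3 * L / real n))"
    by (rule mult_mono[OF mult_left_mono[OF mean_degree_le] y_le]) (use ln_ge_1 y(1) in auto)
  finally have "exp (- (real j * \<Lambda>)) * exp (- (2 * real j * (3 * L) * (real (j + 1) * (3 * L / real n))))
      \<le> exp (real n * - (real j * \<theta> / (1 - ?y)))"
    unfolding exp_add[symmetric] by simp
  also have "\<dots> = exp (- (real j * \<theta> / (1 - ?y))) ^ n" by (rule exp_of_nat_mult)
  also have "\<dots> \<le> exp (- (real j * \<theta> / (1 - ?y))) ^ (n - a)"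
    using y(2) by (intro power_decreasing) auto
  finally show ?thesis .
qed

lemma prob_simple_degree_event_lower:
  assumes A: "A \<subseteq> {..<n}" "card A = j"
    and large: "j + j * d + d \<le> n" "real (j + 1) * (3 * L / real n) \<le> 1 / 2"
      "0 \<le> 2 - exp (3 * L / real n * (real j)\<^sup>2)"
  shows "(2 - exp (3 * L / real n * (real j)\<^sup>2)) * ((1 - real (j + j * d + d) / real n) ^ d) ^ j *
      (1 - real j * (3 * L / real n)) ^ (j * d) *
      exp (- (2 * real j * (3 * L) * (real (j + 1) * (3 * L / real n)))) * degree_weight d \<Lambda> ^ j
    \<le> prob M (simple_degree_event {..<n} A d)"
proof -
  let ?\<delta> = "3 * L / real n"
  let ?tail = "exp (- (2 * real j * (3 * L) * (real (j + 1) * ?\<delta>)))"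
  let ?choose = "(1 - real (j + j * d + d) / real n) ^ d * (real n ^ d / fact d)"
  have edge: "real (j + 1) * \<theta> < 1"
    using mult_left_mono[OF edge_rate_le, of "real (j + 1)"] large(2) by simp
  have room: "0 \<le> 1 - real (j + j * d + d) / real n"
    using of_nat_mono[OF large(1), where 'a = real] n_pos
    by (simp only: diff_ge_0_iff_ge divide_le_eq_1_pos)
  have \<delta>: "0 \<le> 1 - real j * ?\<delta>"
  proof -
    have "real (j + 1) * ?\<delta> = real j * ?\<delta> + ?\<delta>"
      by (simp add: distrib_right add_divide_distrib)
    moreover have "0 \<le> ?\<delta>" using ln_ge_1 by simp
    ultimately show ?thesis using large(2) by linarith
  qed
  have "(2 - exp (?\<delta> * (real j)\<^sup>2)) * ((1 - real (j + j * d + d) / real n) ^ d) ^ j *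
      (1 - real j * ?\<delta>) ^ (j * d) * ?tail * degree_weight d \<Lambda> ^ j
    = (2 - exp (?\<delta> * (real j)\<^sup>2)) * (?choose ^ j * (\<theta> * (1 - real j * ?\<delta>)) ^ (j * d) *
        (exp (- (real j * \<Lambda>)) * ?tail))"
    unfolding degree_weight_power power_mult_distrib by (simp only: mult_ac)
  also have "\<dots> \<le> (2 - exp (\<theta> * (real j)\<^sup>2)) * (real ((n - (j + j * d)) choose d) ^ j *
      (\<theta> * (1 - real j * \<theta>)) ^ (j * d) *
      exp (- (real j * \<theta> / (1 - real (j + 1) * \<theta>))) ^ (n - (j + j * d)))"
  proof (intro mult_mono power_mono exp_miss_power_ge[OF large(2)])
    have "\<theta> * (real j)\<^sup>2 \<le> ?\<delta> * (real j)\<^sup>2" using edge_rate_le by (intro mult_right_mono) auto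
    then show "2 - exp (?\<delta> * (real j)\<^sup>2) \<le> 2 - exp (\<theta> * (real j)\<^sup>2)" by simp
    with large(3) show "0 \<le> 2 - exp (\<theta> * (real j)\<^sup>2)" by linarith
    show "?choose \<le> real ((n - (j + j * d)) choose d)"
      by (rule choose_diff_ge[OF large(1) n_ge_1])
    show rate: "1 - real j * ?\<delta> \<le> 1 - real j * \<theta>"
      using mult_left_mono[OF edge_rate_le, of "real j"] by simp
    have "0 \<le> 1 - real j * \<theta>" using rate \<delta> by linarith
    then have "0 \<le> \<theta> * (1 - real j * \<theta>)" by simp
    then show "0 \<le> real ((n - (j + j * d)) choose d) ^ j * (\<theta> * (1 - real j * \<theta>)) ^ (j * d)" by simp
  qed (use room \<delta> in auto)
  also have "\<dots> \<le> prob M (simple_degree_event {..<n} A d)"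
    using prob_simple_degree_event_ge[OF finite_lessThan A(1), of d] edge A(2) by simp
  finally show ?thesis .
qed

lemma prob_degree_event_upper:
  assumes A: "A \<subseteq> {..<n}" "card A = j" and d: "d = 0 \<or> 1 \<le> \<Lambda>"
    and large: "real n powr (1/20) * exp (3 / c * sqrt L) * (3 * L / real n) * (real j)\<^sup>2 \<le> 1"
  shows "prob M (degree_event {..<n} A d) \<le> degree_upper_factor j d n * degree_weight d \<Lambda> ^ j"
  unfolding degree_upper_factor_def distrib_right
  using prob_degree_event_le[OF finite_lessThan A(1), of d, unfolded A(2)]
    prob_simple_degree_event_upper[OF A, of d]
    prob_overlap_small_nbh_upper[OF A d large] prob_double_hit_small_nbh_upper[OF A d]
  by linarith

lemma prob_degree_event_lower:
  assumes "A \<subseteq> {..<n}" "card A = j"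
    and "j + j * d + d \<le> n" "real (j + 1) * (3 * L / real n) \<le> 1 / 2"
      "0 \<le> 2 - exp (3 * L / real n * (real j)\<^sup>2)"
  shows "degree_lower_factor j d n * degree_weight d \<Lambda> ^ j \<le> prob M (degree_event {..<n} A d)"
  unfolding degree_lower_factor_def
  by (rule order_trans[OF prob_simple_degree_event_lower[OF assms]])
    (auto simp: simple_degree_event_def intro: prob_mono_on_support)

end

lemma degree_upper_factor_tendsto: "degree_upper_factor j d \<longlonglongrightarrow> 1"
proof -
  have exp_1: "(\<lambda>n::nat. exp (x * (3 * ln (real n) / real n))) \<longlonglongrightarrow> 1" for x :: real
    by real_asymp
  define b where "b = 4 * (1 + real j)"
  have b: "b > 0" by (simp add: b_def)
  have overlap: "(\<lambda>n::nat. (b * ln (real n)) ^ (j * d) * real n powr (-1/20)) \<longlonglongrightarrow> 0"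
    using b by real_asymp
  have double: "(\<lambda>n::nat. (b * ln (real n)) ^ (j * d) * (real n * (3 * ln (real n) / real n)\<^sup>2))
      \<longlonglongrightarrow> 0"
    using b by real_asymp
  from tendsto_add[OF tendsto_add[OF exp_1[of "real j * real (j + j * d)"]
        tendsto_mult[OF overlap tendsto_mult[OF exp_1[of "real j * real (j + j * d)"] tendsto_const]]]
      tendsto_mult[OF double tendsto_mult[OF exp_1[of "real j * real (j + 1 + j * d)"] tendsto_const]]]
  show ?thesis unfolding degree_upper_factor_def b_def by simp
qed

lemma degree_lower_factor_tendsto: "degree_lower_factor j d \<longlonglongrightarrow> 1"
proof -
  have choose: "(\<lambda>n::nat. 1 - real (j + j * d + d) / real n) \<longlonglongrightarrow> 1" by real_asymp
  have rate: "(\<lambda>n::nat. 1 - real j * (3 * ln (real n) / real n)) \<longlonglongrightarrow> 1" by real_asymp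
  have disjoint: "(\<lambda>n::nat. 2 - exp (3 * ln (real n) / real n * (real j)\<^sup>2)) \<longlonglongrightarrow> 1" by real_asymp
  have tail: "(\<lambda>n::nat. exp (- (2 * real j * (3 * ln (real n)) *
      (real (j + 1) * (3 * ln (real n) / real n))))) \<longlonglongrightarrow> 1" by real_asymp
  from tendsto_mult[OF tendsto_mult[OF tendsto_mult[OF disjoint
          tendsto_power[OF tendsto_power[OF choose, of d], of j]]
        tendsto_power[OF rate, of "j * d"]] tail]
  show ?thesis unfolding degree_lower_factor_def by simp
qed

theorem prob_degree_event_asymptotic:
  fixes c \<epsilon> :: real
  assumes c: "c > 0" and \<epsilon>: "\<epsilon> > 0"
  shows "\<forall>\<^sub>F n in sequentially. \<forall>P K. sparse_rig P K c n \<and> (d = 0 \<or> 1 \<le> mean_degree n P K) \<longrightarrow>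
    (\<forall>A\<subseteq>{..<n}. card A = j \<longrightarrow>
      \<bar>prob (objects_pmf {..<n} P K) (degree_event {..<n} A d) - degree_weight d (mean_degree n P K) ^ j\<bar>
      \<le> \<epsilon> * degree_weight d (mean_degree n P K) ^ j)"
proof -
  have "\<forall>\<^sub>F n in sequentially. degree_upper_factor j d n < 1 + \<epsilon>"
    "\<forall>\<^sub>F n in sequentially. 1 - \<epsilon> < degree_lower_factor j d n"
    using order_tendstoD[OF degree_upper_factor_tendsto] order_tendstoD[OF degree_lower_factor_tendsto] \<epsilon>
    by auto
  moreover have "\<forall>\<^sub>F n in sequentially. real n powr (1/20) * exp (3 / c * sqrt (ln (real n))) *
      (3 * ln (real n) / real n) * (real j)\<^sup>2 \<le> 1"
    "\<forall>\<^sub>F n in sequentially. real (j + 1) * (3 * ln (real n) / real n) \<le> 1 / 2"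
    "\<forall>\<^sub>F n in sequentially. 0 \<le> 2 - exp (3 * ln (real n) / real n * (real j)\<^sup>2)"
    using c by real_asymp+
  moreover have "\<forall>\<^sub>F n in sequentially. j + j * d + d \<le> n" by (rule eventually_ge_at_top)
  ultimately show ?thesis
  proof eventually_elim
    case (elim n)
    show ?case
    proof (intro allI impI)
      fix P K A assume P: "sparse_rig P K c n \<and> (d = 0 \<or> 1 \<le> mean_degree n P K)"
        and A: "A \<subseteq> {..<n}" "card A = j"
      then interpret sparse_rig P K c n by simp
      let ?w = "degree_weight d \<Lambda> ^ j"
      have w: "0 \<le> ?w" by (simp add: degree_weight_def)
      have d: "d = 0 \<or> 1 \<le> \<Lambda>" using P by simp
      have "prob M (degree_event {..<n} A d) \<le> (1 + \<epsilon>) * ?w"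
        using prob_degree_event_upper[OF A d elim(3)] mult_right_mono[OF less_imp_le[OF elim(1)] w]
        by linarith
      moreover have "(1 - \<epsilon>) * ?w \<le> prob M (degree_event {..<n} A d)"
        using prob_degree_event_lower[OF A elim(6,4,5)] mult_right_mono[OF less_imp_le[OF elim(2)] w]
        by linarith
      ultimately show "\<bar>prob M (degree_event {..<n} A d) - ?w\<bar> \<le> \<epsilon> * ?w"
        by (simp add: abs_le_iff algebra_simps)
    qed
  qed
qed

section \<open>The method of binomial moments\<close>

definition binomial_moment :: "'a pmf \<Rightarrow> ('a \<Rightarrow> nat) \<Rightarrow> nat \<Rightarrow> real" where
  "binomial_moment p X i = expect p (\<lambda>x. real (X x choose i))"

lemma alternating_choose_sum:
  "(\<Sum>i\<le>m. (-1) ^ i * real (Suc x choose i)) = (-1) ^ m * real (x choose m)"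
  by (induction m) (auto simp: algebra_simps)

lemma alternating_choose_sum_0: "(\<Sum>i\<le>m. (-1) ^ i * real (0 choose i)) = 1"
proof -
  have "(\<Sum>i\<le>m. (-1) ^ i * real (0 choose i)) = (\<Sum>i\<in>{0}. (-1) ^ i * real (0 choose i))"
    by (rule sum.mono_neutral_right) (auto simp: binomial_eq_0)
  then show ?thesis by simp
qed

lemma bonferroni_even: "of_bool (x = 0) \<le> (\<Sum>i\<le>2 * m. (-1) ^ i * real (x choose i))"
  by (cases x) (simp_all only: alternating_choose_sum_0 alternating_choose_sum, simp_all)

lemma bonferroni_odd: "(\<Sum>i\<le>Suc (2 * m). (-1) ^ i * real (x choose i)) \<le> of_bool (x = 0)"
  by (cases x) (simp_all only: alternating_choose_sum_0 alternating_choose_sum, simp_all)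

lemma prob_eq_0_bonferroni:
  assumes "finite (set_pmf p)"
  shows "prob p {x. X x = 0} \<le> (\<Sum>i\<le>2 * m. (-1) ^ i * binomial_moment p X i)"
    and "(\<Sum>i\<le>Suc (2 * m). (-1) ^ i * binomial_moment p X i) \<le> prob p {x. X x = 0}"
proof -
  have alternating_moment_sum: "(\<Sum>i\<le>l. (-1) ^ i * binomial_moment p X i)
     = expect p (\<lambda>x. \<Sum>i\<le>l. (-1) ^ i * real (X x choose i))" for l
    unfolding binomial_moment_def
    by (subst Bochner_Integration.integral_sum) (auto intro!: integrable_measure_pmf_finite assms)
  show "prob p {x. X x = 0} \<le> (\<Sum>i\<le>2 * m. (-1) ^ i * binomial_moment p X i)"
    unfolding alternating_moment_sum prob_eq_expect
    by (rule expect_mono[OF assms]) (use bonferroni_even in simp)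
  show "(\<Sum>i\<le>Suc (2 * m). (-1) ^ i * binomial_moment p X i) \<le> prob p {x. X x = 0}"
    unfolding alternating_moment_sum prob_eq_expect
    by (rule expect_mono[OF assms]) (use bonferroni_odd in simp)
qed

lemma alternating_exp_tendsto: "(\<lambda>l. \<Sum>i\<le>l. (-1) ^ i * (x ^ i / fact i)) \<longlonglongrightarrow> exp (- x)" for x :: real
proof -
  have "(\<lambda>i. (- x) ^ i / fact i) sums exp (- x)"
    using exp_converges[of "- x"] by (simp add: field_simps)
  then have "(\<lambda>l. \<Sum>i\<le>l. (- x) ^ i / fact i) \<longlonglongrightarrow> exp (- x)" by (simp add: sums_def_le)
  moreover have "(- x) ^ i / fact i = (-1) ^ i * (x ^ i / fact i)" for i
    using power_minus[of x i] by simp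
  ultimately show ?thesis by simp
qed

theorem prob_eq_0_poisson_limit:
  fixes p :: "nat \<Rightarrow> 'a pmf" and X :: "nat \<Rightarrow> 'a \<Rightarrow> nat"
  assumes fin: "\<forall>\<^sub>F n in sequentially. finite (set_pmf (p n))"
    and moments: "\<And>i. (\<lambda>n. binomial_moment (p n) (X n) i) \<longlonglongrightarrow> \<mu> ^ i / fact i"
  shows "(\<lambda>n. prob (p n) {x. X n x = 0}) \<longlonglongrightarrow> exp (- \<mu>)"
proof -
  define U where "U = (\<lambda>l. \<Sum>i\<le>l. (-1) ^ i * (\<mu> ^ i / fact i))"
  have U: "U \<longlonglongrightarrow> exp (- \<mu>)" unfolding U_def by (rule alternating_exp_tendsto)
  have partial: "(\<lambda>n. \<Sum>i\<le>l. (-1) ^ i * binomial_moment (p n) (X n) i) \<longlonglongrightarrow> U l" for l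
    unfolding U_def by (intro tendsto_sum tendsto_mult tendsto_const moments)
  show ?thesis
  proof (rule order_tendstoI)
    fix a assume "a < exp (- \<mu>)"
    with U have "\<forall>\<^sub>F l in sequentially. a < U l" by (rule order_tendstoD)
    then obtain m where m: "a < U (Suc (2 * m))"
      unfolding eventually_sequentially by (metis le_SucI mult_2 trans_le_add1 order_refl)
    have "\<forall>\<^sub>F n in sequentially. a < (\<Sum>i\<le>Suc (2 * m). (-1) ^ i * binomial_moment (p n) (X n) i)"
      using partial m by (rule order_tendstoD)
    with fin show "\<forall>\<^sub>F n in sequentially. a < prob (p n) {x. X n x = 0}"
      by eventually_elim (use prob_eq_0_bonferroni(2) less_le_trans in blast)
  next
    fix a assume "exp (- \<mu>) < a"
    with U have "\<forall>\<^sub>F l in sequentially. U l < a" by (rule order_tendstoD)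
    then obtain m where m: "U (2 * m) < a"
      unfolding eventually_sequentially by (metis mult_2 trans_le_add1 order_refl)
    have "\<forall>\<^sub>F n in sequentially. (\<Sum>i\<le>2 * m. (-1) ^ i * binomial_moment (p n) (X n) i) < a"
      using partial m by (rule order_tendstoD)
    with fin show "\<forall>\<^sub>F n in sequentially. prob (p n) {x. X n x = 0} < a"
      by eventually_elim (use prob_eq_0_bonferroni(1) le_less_trans in blast)
  qed
qed

lemma prob_eq_0_second_moment:
  fixes p :: "'a pmf" and X :: "'a \<Rightarrow> nat"
  assumes fin: "finite (set_pmf p)"
  defines "m1 \<equiv> binomial_moment p X 1" and "m2 \<equiv> binomial_moment p X 2"
  shows "prob p {x. X x = 0} * m1\<^sup>2 \<le> 2 * m2 + m1 - m1\<^sup>2"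
proof -
  have choose_2: "2 * real (k choose 2) + real k = (real k)\<^sup>2" for k :: nat
    by (induction k) (simp_all add: numeral_2_eq_2 algebra_simps power2_eq_square)
  have "prob p {x. X x = 0} * m1\<^sup>2 = expect p (\<lambda>x. of_bool (x \<in> {x. X x = 0}) * m1\<^sup>2)"
    unfolding prob_eq_expect by simp
  also have "\<dots> \<le> expect p (\<lambda>x. (2 * real (X x choose 2) + real (X x choose 1))
      + (m1\<^sup>2 - 2 * m1 * real (X x choose 1)))"
  proof (rule expect_mono[OF fin])
    fix x
    have "(2 * real (X x choose 2) + real (X x choose 1)) + (m1\<^sup>2 - 2 * m1 * real (X x choose 1))
        = (real (X x) - m1)\<^sup>2"
      using choose_2[of "X x"] by (simp add: power2_diff)
    then show "of_bool (x \<in> {x. X x = 0}) * m1\<^sup>2 \<le> (2 * real (X x choose 2) + real (X x choose 1))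
        + (m1\<^sup>2 - 2 * m1 * real (X x choose 1))"
      by (cases "X x = 0") auto
  qed
  also have "\<dots> = (2 * m2 + m1) + (m1\<^sup>2 - 2 * m1 * m1)"
    unfolding m1_def m2_def binomial_moment_def
    by (subst Bochner_Integration.integral_add Bochner_Integration.integral_diff;
        (intro integrable_measure_pmf_finite fin)?)+ simp
  finally show ?thesis by (simp add: power2_eq_square)
qed

lemma prob_eq_0_le_of_moment_estimates:
  fixes T \<delta> :: real
  assumes fin: "finite (set_pmf p)" and "0 < T" "0 \<le> \<delta>" "\<delta> \<le> 1/2"
    and m1: "(1 - \<delta>) * T \<le> binomial_moment p X 1" "binomial_moment p X 1 \<le> (1 + \<delta>) * T"
    and m2: "2 * binomial_moment p X 2 \<le> (1 + \<delta>) * T\<^sup>2"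
  shows "prob p {x. X x = 0} \<le> 12 * \<delta> + 8 / T"
proof -
  let ?p = "prob p {x. X x = 0}" and ?m1 = "binomial_moment p X 1"
  have square: "((1 - \<delta>) * T)\<^sup>2 \<le> ?m1\<^sup>2" using m1(1) assms(2,4) by (intro power_mono) auto
  have "(1 - 2 * \<delta>) * T\<^sup>2 \<le> (1 - \<delta>)\<^sup>2 * T\<^sup>2"
    by (intro mult_right_mono) (auto simp: power2_eq_square algebra_simps)
  then have lower: "(1 - 2 * \<delta>) * T\<^sup>2 \<le> ?m1\<^sup>2" using square by (simp add: power_mult_distrib)
  have "(1/2)\<^sup>2 \<le> (1 - \<delta>)\<^sup>2" using assms(4) by (intro power_mono) auto
  then have "(1/2)\<^sup>2 * T\<^sup>2 \<le> (1 - \<delta>)\<^sup>2 * T\<^sup>2" by (intro mult_right_mono) auto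
  then have "T\<^sup>2 / 4 \<le> ?m1\<^sup>2" using square by (simp add: power_mult_distrib power_divide)
  then have "?p * (T\<^sup>2 / 4) \<le> ?p * ?m1\<^sup>2" by (intro mult_left_mono) auto
  also have "\<dots> \<le> 2 * binomial_moment p X 2 + ?m1 - ?m1\<^sup>2" by (rule prob_eq_0_second_moment[OF fin])
  also have "\<dots> \<le> (1 + \<delta>) * T\<^sup>2 + (1 + \<delta>) * T - (1 - 2 * \<delta>) * T\<^sup>2" using m1(2) m2 lower by linarith
  also have "\<dots> = 3 * \<delta> * T\<^sup>2 + (1 + \<delta>) * T" by (simp add: algebra_simps)
  also have "\<dots> \<le> 3 * \<delta> * T\<^sup>2 + 2 * T" using assms(2,4) by (intro add_left_mono mult_right_mono) auto
  also have "\<dots> = (12 * \<delta> + 8 / T) * (T\<^sup>2 / 4)"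
    using assms(2) by (simp add: field_simps power2_eq_square)
  finally show ?thesis using assms(2) by (simp add: mult_le_cancel_right)
qed

lemma choose_over_power_tendsto: "(\<lambda>n. real (n choose i) / real n ^ i) \<longlonglongrightarrow> 1 / fact i"
proof (rule tendsto_sandwich)
  have "(\<lambda>n. 1 - real i / real n) \<longlonglongrightarrow> 1" by real_asymp
  then have "(\<lambda>n. (1 - real i / real n) ^ i / fact i) \<longlonglongrightarrow> 1 ^ i / fact i"
    by (intro tendsto_intros) auto
  then show "(\<lambda>n. (1 - real i / real n) ^ i / fact i) \<longlonglongrightarrow> 1 / fact i" by simp
  show "\<forall>\<^sub>F n in sequentially. real (n choose i) / real n ^ i \<le> 1 / fact i"
    using eventually_gt_at_top[of 0]
  proof eventually_elim
    case (elim n)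
    then show ?case using choose_le_power_fact[of n i] by (simp add: field_simps)
  qed
  show "\<forall>\<^sub>F n in sequentially. (1 - real i / real n) ^ i / fact i \<le> real (n choose i) / real n ^ i"
    using eventually_gt_at_top[of i]
  proof eventually_elim
    case (elim n)
    then show ?case using choose_diff_ge[of 0 i n] by (simp add: field_simps)
  qed
qed auto

lemma tendsto_of_relative_error:
  fixes f t :: "nat \<Rightarrow> real"
  assumes t: "t \<longlonglongrightarrow> T" and f: "\<And>\<epsilon>. \<epsilon> > 0 \<Longrightarrow> \<forall>\<^sub>F n in sequentially. \<bar>f n - t n\<bar> \<le> \<epsilon> * t n"
  shows "f \<longlonglongrightarrow> T"
proof -
  have "(\<lambda>n. f n - t n) \<longlonglongrightarrow> 0"
  proof (rule tendstoI)
    fix e :: real assume e: "e > 0"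
    define \<epsilon> where "\<epsilon> = e / (2 * (\<bar>T\<bar> + 1))"
    have \<epsilon>: "\<epsilon> > 0" using e by (simp add: \<epsilon>_def)
    have "\<forall>\<^sub>F n in sequentially. t n < \<bar>T\<bar> + 1" using t by (rule order_tendstoD) linarith
    with f[OF \<epsilon>] show "\<forall>\<^sub>F n in sequentially. dist (f n - t n) 0 < e"
    proof eventually_elim
      case (elim n)
      have "\<bar>f n - t n\<bar> \<le> \<epsilon> * (\<bar>T\<bar> + 1)"
        using elim \<epsilon> mult_left_mono[of "t n" "\<bar>T\<bar> + 1" \<epsilon>] by linarith
      also have "\<dots> = e / 2" by (simp add: \<epsilon>_def field_simps)
      finally show ?case using e by (simp add: dist_real_def)
    qed
  qed
  from tendsto_add[OF this t] show ?thesis by simp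
qed

section \<open>The number of nodes of a given degree\<close>

definition degree_count :: "'a set \<Rightarrow> nat \<Rightarrow> ('a \<Rightarrow> 'b set) \<Rightarrow> nat" where
  "degree_count V d S = card {v \<in> V. card (nbh V S {v}) = d}"

lemma degree_count_choose:
  assumes "finite V"
  shows "real (degree_count V d S choose i)
      = (\<Sum>A | A \<subseteq> V \<and> card A = i. of_bool (S \<in> degree_event V A d))"
proof -
  let ?W = "{v \<in> V. card (nbh V S {v}) = d}"
  have "degree_count V d S choose i = card {A. A \<subseteq> ?W \<and> card A = i}"
    unfolding degree_count_def using assms by (intro n_subsets[symmetric]) simp
  also have "{A. A \<subseteq> ?W \<and> card A = i} = {A \<in> {A. A \<subseteq> V \<and> card A = i}. S \<in> degree_event V A d}"
    by (auto simp: degree_event_def)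
  also have "real (card \<dots>) = (\<Sum>A | A \<subseteq> V \<and> card A = i. of_bool (S \<in> degree_event V A d))"
    using assms by (simp add: sum.If_cases of_bool_def Int_def)
  finally show ?thesis .
qed

context object_pool
begin

lemma binomial_moment_degree_count:
  assumes "finite V"
  shows "binomial_moment (objects_pmf V P K) (degree_count V d) i =
    (\<Sum>A | A \<subseteq> V \<and> card A = i. prob (objects_pmf V P K) (degree_event V A d))"
  unfolding binomial_moment_def degree_count_choose[OF assms] prob_eq_expect
  by (rule Bochner_Integration.integral_sum)
     (auto intro!: integrable_measure_pmf_finite finite_set_objects_pmf assms)

lemma binomial_moment_degree_count_estimate:
  assumes V: "finite V"
    and estimate: "\<forall>A\<subseteq>V. card A = i \<longrightarrow> \<bar>prob (objects_pmf V P K) (degree_event V A d) - w\<bar> \<le> \<epsilon> * w"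
  shows "\<bar>binomial_moment (objects_pmf V P K) (degree_count V d) i - real (card V choose i) * w\<bar>
    \<le> \<epsilon> * (real (card V choose i) * w)"
proof -
  let ?I = "{A. A \<subseteq> V \<and> card A = i}"
  have card_I: "card ?I = card V choose i" by (rule n_subsets[OF V])
  have "binomial_moment (objects_pmf V P K) (degree_count V d) i - real (card V choose i) * w
      = (\<Sum>A\<in>?I. prob (objects_pmf V P K) (degree_event V A d) - w)"
    unfolding binomial_moment_degree_count[OF V] sum_subtractf using card_I by simp
  also have "\<bar>\<dots>\<bar> \<le> (\<Sum>A\<in>?I. \<bar>prob (objects_pmf V P K) (degree_event V A d) - w\<bar>)" by (rule sum_abs)
  also have "\<dots> \<le> (\<Sum>A\<in>?I. \<epsilon> * w)" by (rule sum_mono) (use estimate in auto)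
  finally show ?thesis using card_I by (simp add: mult_ac)
qed

end

theorem degree_count_poisson_limit:
  fixes P K :: "nat \<Rightarrow> nat"
  assumes c: "c > 0"
    and sparse: "\<forall>\<^sub>F n in sequentially. sparse_rig (P n) (K n) c n \<and> 1 \<le> mean_degree n (P n) (K n)"
    and weight: "(\<lambda>n. real n * degree_weight d (mean_degree n (P n) (K n))) \<longlonglongrightarrow> \<mu>"
  shows "(\<lambda>n. prob (objects_pmf {..<n} (P n) (K n)) {S. degree_count {..<n} d S = 0}) \<longlonglongrightarrow> exp (- \<mu>)"
proof (rule prob_eq_0_poisson_limit)
  show "\<forall>\<^sub>F n in sequentially. finite (set_pmf (objects_pmf {..<n} (P n) (K n)))"
    using sparse
  proof eventually_elim
    case (elim n)
    then interpret sparse_rig "P n" "K n" c n by simp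
    show ?case by (rule finite_set_objects_pmf) simp
  qed
  fix i
  define w where "w = (\<lambda>n. degree_weight d (mean_degree n (P n) (K n)))"
  show "(\<lambda>n. binomial_moment (objects_pmf {..<n} (P n) (K n)) (degree_count {..<n} d) i)
      \<longlonglongrightarrow> \<mu> ^ i / fact i"
  proof (rule tendsto_of_relative_error)
    have "(\<lambda>n. real (n choose i) / real n ^ i * (real n * w n) ^ i) \<longlonglongrightarrow> 1 / fact i * \<mu> ^ i"
      using weight unfolding w_def by (intro tendsto_mult choose_over_power_tendsto tendsto_power)
    moreover have "\<forall>\<^sub>F n in sequentially. real (n choose i) / real n ^ i * (real n * w n) ^ i
        = real (n choose i) * w n ^ i"
      using eventually_gt_at_top[of 0] by eventually_elim (simp add: power_mult_distrib)
    ultimately show "(\<lambda>n. real (n choose i) * w n ^ i) \<longlonglongrightarrow> \<mu> ^ i / fact i"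
      by (simp add: tendsto_cong)
    fix \<epsilon> :: real assume \<epsilon>: "\<epsilon> > 0"
    show "\<forall>\<^sub>F n in sequentially. \<bar>binomial_moment (objects_pmf {..<n} (P n) (K n)) (degree_count {..<n} d) i
        - real (n choose i) * w n ^ i\<bar> \<le> \<epsilon> * (real (n choose i) * w n ^ i)"
      using sparse prob_degree_event_asymptotic[OF c \<epsilon>, of d i]
    proof eventually_elim
      case (elim n)
      then interpret sparse_rig "P n" "K n" c n by simp
      show ?case
        using binomial_moment_degree_count_estimate[OF finite_lessThan, of n i d "w n ^ i" \<epsilon>] elim
        unfolding w_def by simp
    qed
  qed
qed

theorem degree_count_zero_unlikely:
  fixes c \<epsilon> :: real
  assumes c: "c > 0" and \<epsilon>: "\<epsilon> > 0"
  shows "\<exists>T. \<forall>\<^sub>F n in sequentially. \<forall>P K. sparse_rig P K c n \<and> (d = 0 \<or> 1 \<le> mean_degree n P K) \<and>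
     T \<le> real n * degree_weight d (mean_degree n P K) \<longrightarrow>
     prob (objects_pmf {..<n} P K) {S. degree_count {..<n} d S = 0} \<le> \<epsilon>"
proof -
  define \<delta> where "\<delta> = min (1/2) (\<epsilon> / 24)"
  have \<delta>: "0 < \<delta>" "\<delta> \<le> 1/2" "12 * \<delta> \<le> \<epsilon> / 2" using \<epsilon> by (auto simp: \<delta>_def)
  have "\<forall>\<^sub>F n in sequentially. \<forall>P K. sparse_rig P K c n \<and> (d = 0 \<or> 1 \<le> mean_degree n P K) \<and>
     16 / \<epsilon> \<le> real n * degree_weight d (mean_degree n P K) \<longrightarrow>
     prob (objects_pmf {..<n} P K) {S. degree_count {..<n} d S = 0} \<le> \<epsilon>"
    using prob_degree_event_asymptotic[OF c \<delta>(1), of d 1] prob_degree_event_asymptotic[OF c \<delta>(1), of d 2]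
  proof eventually_elim
    case (elim n)
    show ?case
    proof (intro allI impI)
      fix P K assume P: "sparse_rig P K c n \<and> (d = 0 \<or> 1 \<le> mean_degree n P K) \<and>
        16 / \<epsilon> \<le> real n * degree_weight d (mean_degree n P K)"
      then interpret sparse_rig P K c n by simp
      define w where "w = degree_weight d \<Lambda>"
      define T where "T = real n * w"
      let ?m = "binomial_moment M (degree_count {..<n} d)"
      have T: "16 / \<epsilon> \<le> T" using P by (simp add: T_def w_def)
      then have T_pos: "0 < T" using \<epsilon> by (smt (verit) divide_pos_pos)
      have "\<bar>?m 1 - real (card {..<n} choose 1) * w ^ 1\<bar>
          \<le> \<delta> * (real (card {..<n} choose 1) * w ^ 1)"
        using P elim(1) unfolding w_def by (intro binomial_moment_degree_count_estimate) auto
      then have m1: "(1 - \<delta>) * T \<le> ?m 1" "?m 1 \<le> (1 + \<delta>) * T"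
        by (auto simp: T_def abs_le_iff algebra_simps)
      have "\<bar>?m 2 - real (card {..<n} choose 2) * w ^ 2\<bar>
          \<le> \<delta> * (real (card {..<n} choose 2) * w ^ 2)"
        using P elim(2) unfolding w_def by (intro binomial_moment_degree_count_estimate) auto
      then have "?m 2 \<le> (1 + \<delta>) * (real (n choose 2) * w\<^sup>2)"
        by (auto simp: abs_le_iff algebra_simps)
      also have "\<dots> \<le> (1 + \<delta>) * (real n ^ 2 / 2 * w\<^sup>2)"
        using choose_le_power_fact[of n 2] \<delta> by (intro mult_left_mono mult_right_mono) auto
      finally have m2: "2 * ?m 2 \<le> (1 + \<delta>) * T\<^sup>2" by (simp add: T_def power_mult_distrib)
      have "finite (set_pmf M)" by (rule finite_set_objects_pmf) simp
      then have "prob M {S. degree_count {..<n} d S = 0} \<le> 12 * \<delta> + 8 / T"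
        using T_pos \<delta> m1 m2 by (intro prob_eq_0_le_of_moment_estimates) auto
      also have "8 / T \<le> \<epsilon> / 2" using T T_pos \<epsilon> by (simp add: field_simps)
      finally show "prob M {S. degree_count {..<n} d S = 0} \<le> \<epsilon>" using \<delta>(3) by linarith
    qed
  qed
  then show ?thesis by blast
qed

lemma (in sparse_rig) prob_ex_small_degree_le:
  assumes large: "3 * L / real n * real (q + 1) \<le> 1" "q + 1 \<le> n"
  shows "prob M {S. \<exists>v<n. card (nbh {..<n} S {v}) \<le> q} \<le> 3 * (real n * (4 * L) ^ q * exp (- \<Lambda>))"
proof -
  have "prob M {S. \<exists>v<n. card (nbh {..<n} S {v}) \<le> q}
      \<le> (\<Sum>v\<in>{..<n}. prob M {S. card (nbh {..<n} S {v}) \<le> q})"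
    by (rule prob_union_bound) auto
  also have "\<dots> \<le> (\<Sum>v\<in>{..<n}. (4 * L) ^ q * (3 * exp (- \<Lambda>)))"
  proof (rule sum_mono)
    fix v assume "v \<in> {..<n}"
    then have "prob M {S. card (nbh {..<n} S {v}) \<le> q}
        \<le> (1 + \<Lambda>) ^ q * exp (- (\<theta> * real (n - 1 - q)))"
      using prob_single_small_nbh_le[OF finite_lessThan] by (simp add: mean_degree_def)
    also have "\<dots> \<le> (4 * L) ^ q * (3 * exp (- \<Lambda>))"
    proof (intro mult_mono power_mono)
      show "1 + \<Lambda> \<le> 4 * L" using mean_degree_le ln_ge_1 by linarith
      have "\<theta> * real (q + 1) \<le> 3 * L / real n * real (q + 1)"
        using edge_rate_le by (intro mult_right_mono) auto
      then have "\<theta> * real (q + 1) \<le> 1" using large(1) by linarith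
      moreover have "real (n - 1 - q) = real n - real (q + 1)"
        using large(2) by (simp add: of_nat_diff)
      ultimately have "- (\<theta> * real (n - 1 - q)) \<le> 1 + - \<Lambda>"
        by (simp add: mean_degree_def algebra_simps)
      then have "exp (- (\<theta> * real (n - 1 - q))) \<le> exp 1 * exp (- \<Lambda>)"
        unfolding exp_add[symmetric] by simp
      also have "\<dots> \<le> 3 * exp (- \<Lambda>)" using exp_le by (intro mult_right_mono) auto
      finally show "exp (- (\<theta> * real (n - 1 - q))) \<le> 3 * exp (- \<Lambda>)" .
    qed (use ln_ge_1 in auto)
    finally show "prob M {S. card (nbh {..<n} S {v}) \<le> q} \<le> (4 * L) ^ q * (3 * exp (- \<Lambda>))" .
  qed
  finally show ?thesis by (simp add: mult_ac)
qed

lemma prob_ex_small_degree_eventually_le: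
  "\<forall>\<^sub>F n in sequentially. \<forall>P K. sparse_rig P K c n \<longrightarrow>
     prob (objects_pmf {..<n} P K) {S. \<exists>v<n. card (nbh {..<n} S {v}) \<le> q}
     \<le> 3 * (real n * (4 * ln (real n)) ^ q * exp (- mean_degree n P K))"
proof -
  have "\<forall>\<^sub>F n in sequentially. 3 * ln (real n) / real n * real (q + 1) \<le> 1" by real_asymp
  then show ?thesis
    using eventually_ge_at_top[of "q + 1"]
    by eventually_elim (blast intro: sparse_rig.prob_ex_small_degree_le)
qed

section \<open>Merging objects\<close>

lemma pmf_of_set_eqI:
  assumes "finite A" "set_pmf p \<subseteq> A" and const: "\<And>a b. a \<in> A \<Longrightarrow> b \<in> A \<Longrightarrow> pmf p a = pmf p b"
  shows "p = pmf_of_set A"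
proof (rule pmf_eqI)
  have nonempty: "A \<noteq> {}" using assms(2) set_pmf_not_empty[of p] by blast
  fix a
  show "pmf p a = pmf (pmf_of_set A) a"
  proof (cases "a \<in> A")
    case True
    have "(\<Sum>b\<in>A. pmf p b) = (\<Sum>b\<in>A. pmf p a)" by (rule sum.cong[OF refl]) (use const True in blast)
    then have "real (card A) * pmf p a = 1" using sum_pmf_eq_1[OF assms(1,2)] by simp
    then show ?thesis using True assms(1) nonempty by (simp add: pmf_of_set field_simps)
  next
    case False
    then show ?thesis using assms nonempty by (auto simp: set_pmf_eq)
  qed
qed

lemma image_permutes_mem_object_sets_iff:
  assumes "\<pi> permutes {..<P}"
  shows "\<pi> ` A \<in> object_sets P K \<longleftrightarrow> A \<in> object_sets P K"
proof -
  have "\<pi> ` A \<subseteq> {..<P} \<longleftrightarrow> A \<subseteq> {..<P}" using permutes_in_image[OF assms] by auto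
  moreover have "card (\<pi> ` A) = card A"
    by (rule card_image[OF inj_on_subset[OF permutes_inj[OF assms] subset_UNIV]])
  ultimately show ?thesis by (simp add: object_sets_def)
qed

lemma ex_permutes_image_eq:
  assumes "A \<in> object_sets P K" "A' \<in> object_sets P K"
  shows "\<exists>\<pi>. \<pi> permutes {..<P} \<and> \<pi> ` A = A'"
proof -
  have A: "A \<subseteq> {..<P}" "A' \<subseteq> {..<P}" "card A = card A'" using assms by (auto simp: object_sets_def)
  have fin: "finite A" "finite A'" using A finite_subset by auto
  obtain f where f: "bij_betw f A A'" using fin A by (meson finite_same_card_bij)
  have "card ({..<P} - A) = card ({..<P} - A')" using A fin by (simp add: card_Diff_subset)
  then obtain g where g: "bij_betw g ({..<P} - A) ({..<P} - A')"
    by (meson finite_Diff finite_lessThan finite_same_card_bij)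
  define \<pi> where "\<pi> = (\<lambda>x. if x \<in> A then f x else if x < P then g x else x)"
  have \<pi>_A: "bij_betw \<pi> A A'" using f by (simp add: bij_betw_def \<pi>_def inj_on_def)
  have "bij_betw \<pi> ({..<P} - A) ({..<P} - A')"
    using g by (rule bij_betw_cong[THEN iffD1, rotated]) (auto simp: \<pi>_def)
  with \<pi>_A have "bij_betw \<pi> (A \<union> ({..<P} - A)) (A' \<union> ({..<P} - A'))" by (rule bij_betw_combine) auto
  moreover have "A \<union> ({..<P} - A) = {..<P}" "A' \<union> ({..<P} - A') = {..<P}" using A by auto
  ultimately have "bij_betw \<pi> {..<P} {..<P}" by simp
  then have "\<pi> permutes {..<P}" by (rule bij_imp_permutes) (use A in \<open>auto simp: \<pi>_def\<close>)
  then show ?thesis using \<pi>_A by (auto simp: bij_betw_def)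
qed

text \<open>
  Reducing the objects of a pool of size \<open>m * P\<close> modulo \<open>P\<close> turns a \<open>K\<close>-set into a set of at most
  \<open>K\<close> objects, which is completed to a \<open>K\<close>-set uniformly at random.
\<close>

definition completions :: "nat \<Rightarrow> nat \<Rightarrow> nat set \<Rightarrow> nat set set" where
  "completions P K T = {A \<in> object_sets P K. (\<lambda>w. w mod P) ` T \<subseteq> A}"

abbreviation complete_pmf :: "nat \<Rightarrow> nat \<Rightarrow> nat set \<Rightarrow> nat set pmf" where
  "complete_pmf P K T \<equiv> pmf_of_set (completions P K T)"

definition lift_perm :: "nat \<Rightarrow> (nat \<Rightarrow> nat) \<Rightarrow> nat \<Rightarrow> nat" where
  "lift_perm P \<pi> w = w div P * P + \<pi> (w mod P)"

lemma lift_perm_div_mod: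
  assumes "\<pi> permutes {..<P}" "0 < P"
  shows "lift_perm P \<pi> w div P = w div P" "lift_perm P \<pi> w mod P = \<pi> (w mod P)"
  using permutes_in_image[OF assms(1), of "w mod P"] assms(2) by (auto simp: lift_perm_def)

lemma inj_lift_perm:
  assumes "\<pi> permutes {..<P}" "0 < P"
  shows "inj (lift_perm P \<pi>)"
proof (rule injI)
  fix v w assume "lift_perm P \<pi> v = lift_perm P \<pi> w"
  then have "v div P = w div P" "\<pi> (v mod P) = \<pi> (w mod P)"
    using lift_perm_div_mod[OF assms] by metis+
  moreover from this have "v mod P = w mod P" using permutes_inj[OF assms(1)] by (metis injD)
  ultimately show "v = w" by (metis div_mult_mod_eq)
qed

context object_pool
begin

lemma P_pos: "0 < P"
  using K_pos K_le_P by simp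

lemma finite_completions [simp]: "finite (completions P K T)"
  by (simp add: completions_def)

lemma completions_nonempty:
  assumes "T \<in> object_sets (m * P) K"
  shows "completions P K T \<noteq> {}"
proof -
  have T: "finite T" "card T = K" using assms by (auto simp: object_sets_def intro: finite_subset)
  have sub: "(\<lambda>w. w mod P) ` T \<subseteq> {..<P}" using P_pos by auto
  have "card ((\<lambda>w. w mod P) ` T) \<le> K" using card_image_le[OF T(1)] T(2) by metis
  then obtain C where "(\<lambda>w. w mod P) ` T \<subseteq> C" "C \<subseteq> {..<P}" "card C = K"
    using exists_subset_between[OF _ _ sub, of K] K_le_P by auto
  then show ?thesis by (auto simp: completions_def object_sets_def)
qed

lemma map_lift_perm_object_pmf:
  assumes \<pi>: "\<pi> permutes {..<P}" and "K \<le> m * P"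
  shows "map_pmf (image (lift_perm P \<pi>)) (object_pmf (m * P) K) = object_pmf (m * P) K"
proof (rule map_pmf_of_set_bij_betw)
  note inj = inj_lift_perm[OF \<pi> P_pos]
  have "lift_perm P \<pi> w < m * P \<longleftrightarrow> w < m * P" for w
    using lift_perm_div_mod(1)[OF \<pi> P_pos, of w] P_pos by (metis div_less_iff_less_mult)
  then have "lift_perm P \<pi> ` X \<in> object_sets (m * P) K" if "X \<in> object_sets (m * P) K" for X
    using that card_image[OF inj_on_subset[OF inj subset_UNIV], of X]
    by (auto simp: object_sets_def)
  moreover have "inj_on (image (lift_perm P \<pi>)) (object_sets (m * P) K)"
    by (intro inj_onI) (simp add: inj_image_eq_iff[OF inj])
  ultimately show "bij_betw (image (lift_perm P \<pi>)) (object_sets (m * P) K) (object_sets (m * P) K)"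
    unfolding bij_betw_def by (intro conjI endo_inj_surj) auto
  show "object_sets (m * P) K \<noteq> {}"
    using assms(2) card_object_sets[of "m * P" K] zero_less_binomial[of K "m * P"] by force
qed simp

lemma image_completions:
  assumes \<pi>: "\<pi> permutes {..<P}"
  shows "image \<pi> ` completions P K X = completions P K (lift_perm P \<pi> ` X)"
proof (intro equalityI subsetI)
  have residues: "(\<lambda>w. w mod P) ` lift_perm P \<pi> ` X = \<pi> ` (\<lambda>w. w mod P) ` X"
    using lift_perm_div_mod(2)[OF \<pi> P_pos] by (simp add: image_image)
  {
    fix B assume "B \<in> image \<pi> ` completions P K X"
    then show "B \<in> completions P K (lift_perm P \<pi> ` X)"
      unfolding completions_def residues using image_permutes_mem_object_sets_iff[OF \<pi>] by auto
  next
    fix B assume B: "B \<in> completions P K (lift_perm P \<pi> ` X)"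
    have image_inv: "\<pi> ` (inv \<pi> ` B) = B" using permutes_surj[OF \<pi>] by (simp add: image_f_inv_f)
    have "inv \<pi> ` B \<in> object_sets P K"
      using image_permutes_mem_object_sets_iff[OF \<pi>, of "inv \<pi> ` B" K] image_inv B
      by (simp add: completions_def)
    moreover have "\<pi> ` (\<lambda>w. w mod P) ` X \<subseteq> \<pi> ` (inv \<pi> ` B)"
      using B unfolding completions_def residues image_inv by simp
    then have "(\<lambda>w. w mod P) ` X \<subseteq> inv \<pi> ` B"
      using inj_image_subset_iff[OF permutes_inj[OF \<pi>]] by blast
    ultimately show "B \<in> image \<pi> ` completions P K X"
      using image_inv by (intro image_eqI[of _ _ "inv \<pi> ` B"]) (auto simp: completions_def)
  }
qed

lemma map_permutes_complete_pmf:
  assumes \<pi>: "\<pi> permutes {..<P}" and X: "X \<in> object_sets (m * P) K"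
  shows "map_pmf (image \<pi>) (complete_pmf P K X) = complete_pmf P K (lift_perm P \<pi> ` X)"
proof (rule map_pmf_of_set_bij_betw)
  show "bij_betw (image \<pi>) (completions P K X) (completions P K (lift_perm P \<pi> ` X))"
    unfolding bij_betw_def image_completions[OF \<pi>]
    by (auto simp: inj_on_def inj_image_eq_iff[OF permutes_inj[OF \<pi>]])
qed (use completions_nonempty[OF X] in auto)

lemma map_permutes_bind_complete_pmf:
  assumes \<pi>: "\<pi> permutes {..<P}" and m: "1 \<le> m"
  shows "map_pmf (image \<pi>) (bind_pmf (object_pmf (m * P) K) (complete_pmf P K))
    = bind_pmf (object_pmf (m * P) K) (complete_pmf P K)"
proof -
  interpret merged: object_pool "m * P" K
    using K_pos K_le_P m by unfold_locales (auto intro: order_trans)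
  have "map_pmf (image \<pi>) (bind_pmf (object_pmf (m * P) K) (complete_pmf P K))
      = bind_pmf (object_pmf (m * P) K) (\<lambda>X. map_pmf (image \<pi>) (complete_pmf P K X))"
    by (simp add: map_bind_pmf)
  also have "\<dots> = bind_pmf (object_pmf (m * P) K) (\<lambda>X. complete_pmf P K (lift_perm P \<pi> ` X))"
    using map_permutes_complete_pmf[OF \<pi>] merged.set_object_pmf by (intro bind_pmf_cong) auto
  also have "\<dots>
      = bind_pmf (map_pmf (image (lift_perm P \<pi>)) (object_pmf (m * P) K)) (complete_pmf P K)"
    by (simp add: bind_map_pmf)
  finally show ?thesis unfolding map_lift_perm_object_pmf[OF \<pi> merged.K_le_P] .
qed

lemma bind_complete_pmf:
  assumes m: "1 \<le> m"
  shows "bind_pmf (object_pmf (m * P) K) (complete_pmf P K) = object_pmf P K" (is "?D = _")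
proof (rule pmf_of_set_eqI[OF finite_object_sets])
  interpret merged: object_pool "m * P" K
    using K_pos K_le_P m by unfold_locales (auto intro: order_trans)
  show "set_pmf ?D \<subseteq> object_sets P K"
  proof
    fix A assume "A \<in> set_pmf ?D"
    then obtain X where "X \<in> object_sets (m * P) K" "A \<in> set_pmf (complete_pmf P K X)"
      unfolding set_bind_pmf merged.set_object_pmf by blast
    then show "A \<in> object_sets P K"
      using completions_nonempty by (simp add: completions_def)
  qed
  fix A B assume "A \<in> object_sets P K" "B \<in> object_sets P K"
  then obtain \<pi> where \<pi>: "\<pi> permutes {..<P}" "\<pi> ` A = B" using ex_permutes_image_eq by blast
  have "inj (image \<pi>)" by (intro injI) (simp add: inj_image_eq_iff[OF permutes_inj[OF \<pi>(1)]])
  then have "pmf (map_pmf (image \<pi>) ?D) (\<pi> ` A) = pmf ?D A" by (rule pmf_map_inj')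
  then show "pmf ?D A = pmf ?D B"
    unfolding map_permutes_bind_complete_pmf[OF \<pi>(1) m] \<pi>(2) by simp
qed

end

lemma intersection_edges_image_subset:
  assumes "\<And>i. i < n \<Longrightarrow> h ` S i \<subseteq> S' i"
  shows "intersection_edges n S \<subseteq> intersection_edges n S'"
proof
  fix e assume "e \<in> intersection_edges n S"
  then obtain i j x where e: "e = {i, j}" "i < n" "j < n" "i \<noteq> j" "x \<in> S i" "x \<in> S j"
    by (auto simp: intersection_edges_def)
  then have "h x \<in> S' i \<inter> S' j" using assms by blast
  then show "e \<in> intersection_edges n S'" using e by (auto simp: intersection_edges_def)
qed

lemma prob_bind_pmf_ge:
  assumes "\<And>x. x \<in> set_pmf p \<Longrightarrow> x \<in> A \<Longrightarrow> set_pmf (q x) \<subseteq> B"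
  shows "prob p A \<le> prob (bind_pmf p q) B"
proof -
  have "emeasure p A = (\<integral>\<^sup>+x. indicator A x \<partial>p)" by simp
  also have "\<dots> \<le> (\<integral>\<^sup>+x. emeasure (q x) B \<partial>p)"
  proof (rule nn_integral_mono_AE, unfold AE_measure_pmf_iff, rule ballI)
    fix x assume x: "x \<in> set_pmf p"
    have "emeasure (q x) B = 1" if "x \<in> A"
      using assms[OF x that] by (intro measure_pmf.emeasure_eq_1_AE) (auto simp: AE_measure_pmf_iff)
    then show "indicator A x \<le> emeasure (q x) B" by (cases "x \<in> A") simp_all
  qed
  also have "\<dots> = emeasure (bind_pmf p q) B" by simp
  finally show ?thesis by (simp add: measure_pmf.emeasure_eq_measure)
qed

theorem (in object_pool) prob_mono_merge_objects:
  assumes m: "1 \<le> m" and mono: "\<And>E E'. \<phi> E \<Longrightarrow> E \<subseteq> E' \<Longrightarrow> \<phi> E'"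
  shows "prob (objects_pmf {..<n} (m * P) K) {S. \<phi> (intersection_edges n S)}
    \<le> prob (objects_pmf {..<n} P K) {S. \<phi> (intersection_edges n S)}"
proof -
  interpret merged: object_pool "m * P" K
    using K_pos K_le_P m by unfold_locales (auto intro: order_trans)
  let ?complete = "\<lambda>f. Pi_pmf {..<n} {} (\<lambda>i. complete_pmf P K (f i))"
  have "objects_pmf {..<n} P K = bind_pmf (objects_pmf {..<n} (m * P) K) ?complete"
    using Pi_pmf_bind[of "{..<n}" "{}" "\<lambda>_. object_pmf (m * P) K" "\<lambda>_. complete_pmf P K" "{}"]
    by (simp add: bind_complete_pmf[OF m])
  also have "prob (objects_pmf {..<n} (m * P) K) {S. \<phi> (intersection_edges n S)}
      \<le> prob \<dots> {S. \<phi> (intersection_edges n S)}"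
  proof (rule prob_bind_pmf_ge, rule subsetI)
    fix f S assume f: "f \<in> set_pmf (objects_pmf {..<n} (m * P) K)"
      and \<phi>: "f \<in> {S. \<phi> (intersection_edges n S)}" and S: "S \<in> set_pmf (?complete f)"
    have "(\<lambda>w. w mod P) ` f i \<subseteq> S i" if "i < n" for i
    proof -
      have "f i \<in> object_sets (m * P) K"
        using set_Pi_pmf_component[OF finite_lessThan f] that merged.set_object_pmf by auto
      moreover have "S i \<in> set_pmf (complete_pmf P K (f i))"
        using set_Pi_pmf_component[OF finite_lessThan S] that by auto
      ultimately show ?thesis using completions_nonempty by (simp add: completions_def)
    qed
    then have "intersection_edges n f \<subseteq> intersection_edges n S"
      by (rule intersection_edges_image_subset)
    then show "S \<in> {S. \<phi> (intersection_edges n S)}" using mono \<phi> by blast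
  qed
  finally show ?thesis .
qed

section \<open>The limits\<close>

lemma prob_uniform_rig:
  "prob (uniform_rig n P K) {E. \<phi> E}
      = prob (objects_pmf {..<n} P K) {S. \<phi> (intersection_edges n S)}"
  by (simp add: uniform_rig_def object_sets_def vimage_def)

lemma tendsto_zero_of_eventually_le:
  fixes f :: "nat \<Rightarrow> real"
  assumes nonneg: "\<And>n. 0 \<le> f n" and small: "\<And>\<epsilon>. \<epsilon> > 0 \<Longrightarrow> \<forall>\<^sub>F n in sequentially. f n \<le> \<epsilon>"
  shows "f \<longlonglongrightarrow> 0"
proof (rule tendstoI)
  fix e :: real assume "e > 0"
  then have "\<forall>\<^sub>F n in sequentially. f n \<le> e / 2" by (intro small) simp
  then show "\<forall>\<^sub>F n in sequentially. dist (f n) 0 < e"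
    by eventually_elim (use nonneg \<open>e > 0\<close> in \<open>simp add: dist_real_def field_simps\<close>)
qed

lemma prob_k_connected_ge:
  fixes c \<epsilon> :: real
  assumes c: "c > 0" and \<epsilon>: "\<epsilon> > 0"
  shows "\<forall>\<^sub>F n in sequentially. \<forall>P K. sparse_rig P K c n \<and> ln (real n) \<le> mean_degree n P K \<and>
     3 * (real n * (4 * ln (real n)) ^ (k - 1) * exp (- mean_degree n P K)) \<le> \<epsilon> / 2 \<longrightarrow>
     1 - \<epsilon> \<le> prob (objects_pmf {..<n} P K) {S. k_connected k {..<n} (intersection_edges n S)}"
proof -
  have "\<epsilon> / 2 > 0" using \<epsilon> by simp
  from min_degree_not_connected_unlikely[OF c this, of 0 k]
    prob_ex_small_degree_eventually_le[of c "k - 1"]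
  show ?thesis
  proof eventually_elim
    case (elim n)
    show ?case
    proof (intro allI impI)
      fix P K
      assume hyp: "sparse_rig P K c n \<and> ln (real n) \<le> mean_degree n P K \<and>
        3 * (real n * (4 * ln (real n)) ^ (k - 1) * exp (- mean_degree n P K)) \<le> \<epsilon> / 2"
      let ?M = "objects_pmf {..<n} P K"
      let ?C = "{S. k_connected k {..<n} (intersection_edges n S)}"
      let ?D = "{S. \<exists>v<n. card (nbh {..<n} S {v}) \<le> k - 1}"
      have "1 = prob ?M UNIV" by simp
      also have "\<dots> \<le> prob ?M (?C \<union> (min_degree_not_connected_event n k \<union> ?D))"
        by (rule prob_mono_on_support)
          (auto simp: min_degree_not_connected_event_def not_le)
      also have "\<dots> \<le> prob ?M ?C + (prob ?M (min_degree_not_connected_event n k) + prob ?M ?D)"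
        by (intro order_trans[OF measure_Un_le] add_mono order_refl) auto
      also have "prob ?M (min_degree_not_connected_event n k) \<le> \<epsilon> / 2" using elim(1) hyp by simp
      also have "prob ?M ?D \<le> \<epsilon> / 2" using elim(2) hyp by (meson order_trans)
      finally show "1 - \<epsilon> \<le> prob ?M ?C" by simp
    qed
  qed
qed

text \<open>
  Merging objects only adds edges. So a graph with mean degree above \<open>3 ln n\<close> is compared with the
  one whose pool is larger by a factor \<open>m\<close> that brings the mean degree between \<open>1.5 ln n\<close> and
  \<open>3 ln n\<close>.
\<close>

lemma ex_merge_factor:
  fixes L x :: real
  assumes L: "1 \<le> L" and x: "3 * L < x"
  obtains m :: nat where "1 \<le> m" "3 / 2 * L \<le> x / real m" "x / real m \<le> 3 * L"
proof -
  define z where "z = x / (3 * L)"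
  define m where "m = nat \<lfloor>2 * z\<rfloor>"
  have "1 < z" using x L by (simp add: z_def field_simps)
  then have m: "real m \<le> 2 * z" "z \<le> real m" "1 \<le> m" unfolding m_def by linarith+
  have "x = 3 * L * z" using L by (simp add: z_def)
  then have "3 / 2 * L * real m \<le> x" "x \<le> 3 * L * real m"
    using mult_left_mono[OF m(1), of "3 / 2 * L"] mult_left_mono[OF m(2), of "3 * L"] L by (simp_all add: mult_ac)
  then show thesis using m(3) by (intro that[of m]) (simp_all add: field_simps)
qed

lemma prob_k_connected_dense_ge:
  fixes c \<epsilon> :: real
  assumes c: "c > 0" and \<epsilon>: "\<epsilon> > 0"
  shows "\<forall>\<^sub>F n in sequentially. \<forall>P K. object_pool P K \<and> c * sqrt (ln (real n)) \<le> real K \<and>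
      3 * ln (real n) < mean_degree n P K \<longrightarrow>
     1 - \<epsilon> \<le> prob (objects_pmf {..<n} P K) {S. k_connected k {..<n} (intersection_edges n S)}"
proof -
  have "\<forall>\<^sub>F n in sequentially. ln (real n) \<ge> 1" by real_asymp
  moreover have "\<forall>\<^sub>F n in sequentially.
      3 * (real n * (4 * ln (real n)) ^ (k - 1) * exp (- (3 / 2 * ln (real n)))) \<le> \<epsilon> / 2"
    using \<epsilon> by real_asymp
  ultimately show ?thesis
    using prob_k_connected_ge[OF assms, of k]
  proof eventually_elim
    case (elim n)
    show ?case
    proof (intro allI impI, elim conjE)
      fix P K
      assume pool: "object_pool P K" and K: "c * sqrt (ln (real n)) \<le> real K"
        and dense: "3 * ln (real n) < mean_degree n P K"
      interpret object_pool P K by (fact pool)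
      obtain m where m: "1 \<le> m" "3 / 2 * ln (real n) \<le> mean_degree n P K / real m"
          "mean_degree n P K / real m \<le> 3 * ln (real n)"
        using ex_merge_factor[OF elim(1) dense] .
      have merged: "mean_degree n (m * P) K = mean_degree n P K / real m"
        by (simp add: mean_degree_def edge_rate_def)
      have "K \<le> m * P" using K_le_P mult_le_mono1[OF m(1), of P] by linarith
      then have "sparse_rig (m * P) K c n"
        using K_pos K c elim(1) m(3) by unfold_locales (auto simp: merged)
      moreover have "3 * (real n * (4 * ln (real n)) ^ (k - 1) * exp (- mean_degree n (m * P) K))
          \<le> 3 * (real n * (4 * ln (real n)) ^ (k - 1) * exp (- (3 / 2 * ln (real n))))"
        unfolding merged using m(2) elim(1) by (intro mult_left_mono) auto
      moreover have "ln (real n) \<le> mean_degree n (m * P) K"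
        unfolding merged using m(2) elim(1) by linarith
      ultimately have "1 - \<epsilon>
          \<le> prob (objects_pmf {..<n} (m * P) K) {S. k_connected k {..<n} (intersection_edges n S)}"
        using elim(2,3) by (meson order_trans)
      also have "\<dots>
          \<le> prob (objects_pmf {..<n} P K) {S. k_connected k {..<n} (intersection_edges n S)}"
        using m(1) k_connected_mono by (rule prob_mono_merge_objects)
      finally show "1 - \<epsilon>
          \<le> prob (objects_pmf {..<n} P K) {S. k_connected k {..<n} (intersection_edges n S)}" .
    qed
  qed
qed

locale rig_sequence =
  fixes q :: nat and P K :: "nat \<Rightarrow> nat" and \<alpha> :: "nat \<Rightarrow> real" and c :: real
  assumes c_pos: "0 < c"
    and eventually_object_pool: "\<forall>\<^sub>F n in sequentially. object_pool (P n) (K n)"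
    and eventually_K_ge: "\<forall>\<^sub>F n in sequentially. c * sqrt (ln (real n)) \<le> real (K n)"
    and eventually_mean_degree_eq: "\<forall>\<^sub>F n in sequentially.
      mean_degree n (P n) (K n) = ln (real n) + real q * ln (ln (real n)) + \<alpha> n"
begin

abbreviation \<Lambda> :: "nat \<Rightarrow> real" where "\<Lambda> n \<equiv> mean_degree n (P n) (K n)"
abbreviation M :: "nat \<Rightarrow> (nat \<Rightarrow> nat set) pmf" where "M n \<equiv> objects_pmf {..<n} (P n) (K n)"

abbreviation connected_prob :: "nat \<Rightarrow> real" where
  "connected_prob n \<equiv> prob (M n) {S. k_connected (Suc q) {..<n} (intersection_edges n S)}"

abbreviation min_degree_prob :: "nat \<Rightarrow> real" where
  "min_degree_prob n \<equiv> prob (M n) {S. \<forall>v<n. Suc q \<le> card (nbh {..<n} S {v})}"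

abbreviation no_degree_prob :: "nat \<Rightarrow> nat \<Rightarrow> real" where
  "no_degree_prob d n \<equiv> prob (M n) {S. degree_count {..<n} d S = 0}"

lemma eventually_ln_ge_1: "\<forall>\<^sub>F n in sequentially. 1 \<le> ln (real n)"
  by real_asymp

lemma eventually_exp_mean_degree:
  "\<forall>\<^sub>F n in sequentially. real n * ln (real n) ^ q * exp (- \<Lambda> n) = exp (- \<alpha> n)"
  using eventually_mean_degree_eq eventually_ln_ge_1 eventually_ge_at_top[of 2]
proof eventually_elim
  case (elim n)
  have "exp (- \<Lambda> n) = exp (- \<alpha> n) / (exp (ln (real n)) * exp (real q * ln (ln (real n))))"
    unfolding elim(1) by (simp add: exp_add[symmetric] exp_diff[symmetric])
  also have "exp (real q * ln (ln (real n))) = ln (real n) ^ q"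
    using elim(2) by (simp add: exp_of_nat_mult)
  finally show ?case using elim(2,3) by simp
qed

lemma eventually_sparse_rig:
  assumes "\<forall>\<^sub>F n in sequentially. \<alpha> n \<le> b"
  shows "\<forall>\<^sub>F n in sequentially. sparse_rig (P n) (K n) c n"
proof -
  have "\<forall>\<^sub>F n in sequentially. ln (real n) + real q * ln (ln (real n)) + b \<le> 3 * ln (real n)"
    by real_asymp
  with assms eventually_mean_degree_eq eventually_object_pool eventually_K_ge eventually_ln_ge_1
  show ?thesis
  proof eventually_elim
    case (elim n)
    interpret object_pool "P n" "K n" by (fact elim(3))
    show ?case by unfold_locales (use elim c_pos in auto)
  qed
qed

lemma eventually_mean_degree_ge:
  assumes "\<forall>\<^sub>F n in sequentially. b \<le> \<alpha> n"
  shows "\<forall>\<^sub>F n in sequentially. ln (real n) + b \<le> \<Lambda> n"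
  using assms eventually_mean_degree_eq eventually_ln_ge_1
proof eventually_elim
  case (elim n)
  have "0 \<le> real q * ln (ln (real n))" using elim(3) by simp
  then show ?case using elim(1,2) by linarith
qed

lemma eventually_connected_prob_le: "\<forall>\<^sub>F n in sequentially. connected_prob n \<le> min_degree_prob n"
  using eventually_ge_at_top[of 2]
  by eventually_elim (auto intro!: prob_mono_on_support k_connected_imp_card_nbh_ge)

lemma min_degree_prob_le_no_degree_prob:
  assumes "d \<le> q"
  shows "min_degree_prob n \<le> no_degree_prob d n"
proof (rule prob_mono_on_support)
  fix S :: "nat \<Rightarrow> nat set"
  assume "S \<in> {S. \<forall>v<n. Suc q \<le> card (nbh {..<n} S {v})}"
  then have "{v \<in> {..<n}. card (nbh {..<n} S {v}) = d} = {}" using assms by force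
  then show "S \<in> {S. degree_count {..<n} d S = 0}" by (simp add: degree_count_def)
qed

lemma eventually_expected_degree_count_ge:
  assumes "filterlim \<alpha> at_bot sequentially"
  shows "\<forall>\<^sub>F n in sequentially. 1 \<le> \<Lambda> n \<longrightarrow> T \<le> real n * degree_weight q (\<Lambda> n)"
proof -
  have "filterlim (\<lambda>n. exp (- \<alpha> n)) at_top sequentially"
    by (rule filterlim_compose[OF exp_at_top]) (use assms in \<open>simp add: filterlim_uminus_at_top\<close>)
  then have "\<forall>\<^sub>F n in sequentially. T * fact q * 2 ^ q \<le> exp (- \<alpha> n)"
    by (simp add: filterlim_at_top)
  moreover have "\<forall>\<^sub>F n in sequentially. T * fact q \<le> real n * exp (- (ln (real n) / 2))"
    by real_asymp
  ultimately show ?thesis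
    using eventually_exp_mean_degree eventually_ln_ge_1
  proof eventually_elim
    case (elim n)
    have "T * fact q \<le> real n * (\<Lambda> n ^ q * exp (- \<Lambda> n))" if "1 \<le> \<Lambda> n"
    proof (cases "\<Lambda> n \<le> ln (real n) / 2")
      case True
      have "T * fact q \<le> real n * exp (- (ln (real n) / 2))" by (fact elim(2))
      also have "\<dots> \<le> real n * (1 * exp (- \<Lambda> n))" using True by (intro mult_left_mono) auto
      also have "\<dots> \<le> real n * (\<Lambda> n ^ q * exp (- \<Lambda> n))"
        using that by (intro mult_left_mono mult_right_mono one_le_power) auto
      finally show ?thesis .
    next
      case False
      have "T * fact q \<le> real n * (ln (real n) / 2) ^ q * exp (- \<Lambda> n)"
        using elim(1) unfolding elim(3)[symmetric] by (simp add: power_divide field_simps)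
      also have "\<dots> \<le> real n * \<Lambda> n ^ q * exp (- \<Lambda> n)"
        using False elim(4) by (intro mult_left_mono mult_right_mono power_mono) auto
      finally show ?thesis by (simp add: mult_ac)
    qed
    then show ?case by (simp add: degree_weight_def field_simps)
  qed
qed

lemma min_degree_prob_tendsto_0:
  assumes \<alpha>: "filterlim \<alpha> at_bot sequentially"
  shows "min_degree_prob \<longlonglongrightarrow> 0"
proof (rule tendsto_zero_of_eventually_le)
  fix \<epsilon> :: real assume \<epsilon>: "\<epsilon> > 0"
  obtain T\<^sub>0 where T\<^sub>0: "\<forall>\<^sub>F n in sequentially. \<forall>P K. sparse_rig P K c n \<and> T\<^sub>0
      \<le> real n * degree_weight 0 (mean_degree n P K) \<longrightarrow>
       prob (objects_pmf {..<n} P K) {S. degree_count {..<n} 0 S = 0} \<le> \<epsilon>"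
    using degree_count_zero_unlikely[OF c_pos \<epsilon>, of 0] by auto
  obtain T where T: "\<forall>\<^sub>F n in sequentially. \<forall>P K. sparse_rig P K c n \<and> (q = 0 \<or> 1 \<le> mean_degree n P K) \<and>
       T \<le> real n * degree_weight q (mean_degree n P K) \<longrightarrow>
       prob (objects_pmf {..<n} P K) {S. degree_count {..<n} q S = 0} \<le> \<epsilon>"
    using degree_count_zero_unlikely[OF c_pos \<epsilon>] by blast
  have "\<forall>\<^sub>F n in sequentially. T\<^sub>0 \<le> real n * exp (- 1)" by real_asymp
  moreover have "\<forall>\<^sub>F n in sequentially. \<alpha> n \<le> 0" using \<alpha> by (simp add: filterlim_at_bot)
  note eventually_sparse_rig[OF this]
  ultimately show "\<forall>\<^sub>F n in sequentially. min_degree_prob n \<le> \<epsilon>"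
    using T\<^sub>0 T eventually_expected_degree_count_ge[OF \<alpha>, of T]
  proof eventually_elim
    case (elim n)
    show ?case
    proof (cases "1 \<le> \<Lambda> n")
      case True
      then have "no_degree_prob q n \<le> \<epsilon>" using elim(2,4,5) by blast
      then show ?thesis using min_degree_prob_le_no_degree_prob[of q n] by simp
    next
      case False
      have "real n * exp (- 1) \<le> real n * exp (- \<Lambda> n)" using False by (intro mult_left_mono) auto
      then have "T\<^sub>0 \<le> real n * degree_weight 0 (\<Lambda> n)"
        using elim(1) by (simp add: degree_weight_def)
      then have "no_degree_prob 0 n \<le> \<epsilon>" using elim(2,3) by blast
      then show ?thesis using min_degree_prob_le_no_degree_prob[of 0 n] by simp
    qed
  qed
qed simp

lemma connected_prob_tendsto_0:
  assumes "filterlim \<alpha> at_bot sequentially"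
  shows "connected_prob \<longlonglongrightarrow> 0"
  by (rule tendsto_sandwich[OF _ eventually_connected_prob_le tendsto_const min_degree_prob_tendsto_0[OF assms]])
    simp

lemma connected_prob_tendsto_1:
  assumes \<alpha>: "filterlim \<alpha> at_top sequentially"
  shows "connected_prob \<longlonglongrightarrow> 1"
proof -
  have "(\<lambda>n. 1 - connected_prob n) \<longlonglongrightarrow> 0"
  proof (rule tendsto_zero_of_eventually_le)
    fix \<epsilon> :: real assume \<epsilon>: "\<epsilon> > 0"
    have "((\<lambda>n. exp (- \<alpha> n)) \<longlongrightarrow> 0) sequentially"
      by (rule filterlim_compose[OF exp_at_bot]) (use \<alpha> in \<open>simp add: filterlim_uminus_at_bot\<close>)
    then have "(\<lambda>n. 3 * (4 ^ q * exp (- \<alpha> n))) \<longlonglongrightarrow> 3 * (4 ^ q * 0)" by (intro tendsto_intros)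
    then have "\<forall>\<^sub>F n in sequentially. 3 * (4 ^ q * exp (- \<alpha> n)) < \<epsilon> / 2"
      by (rule order_tendstoD) (use \<epsilon> in simp)
    moreover have "\<forall>\<^sub>F n in sequentially. 0 \<le> \<alpha> n" using \<alpha> by (simp add: filterlim_at_top)
    note eventually_mean_degree_ge[OF this]
    ultimately show "\<forall>\<^sub>F n in sequentially. 1 - connected_prob n \<le> \<epsilon>"
      using eventually_exp_mean_degree eventually_ln_ge_1 eventually_object_pool eventually_K_ge
        prob_k_connected_ge[OF c_pos \<epsilon>, of "Suc q"] prob_k_connected_dense_ge[OF c_pos \<epsilon>, of "Suc q"]
    proof eventually_elim
      case (elim n)
      interpret object_pool "P n" "K n" by (fact elim(5))
      have "1 - \<epsilon> \<le> connected_prob n"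
      proof (cases "\<Lambda> n \<le> 3 * ln (real n)")
        case True
        then have "sparse_rig (P n) (K n) c n" using elim(4,6) c_pos by unfold_locales auto
        moreover have "3 * (real n * (4 * ln (real n)) ^ q * exp (- \<Lambda> n)) \<le> \<epsilon> / 2"
          using elim(1) unfolding elim(3)[symmetric] by (simp add: power_mult_distrib mult_ac)
        ultimately show ?thesis using elim(2,7) by simp
      next
        case False
        then show ?thesis using elim(5,6,8) by simp
      qed
      then show ?case by simp
    qed
  qed simp
  from tendsto_diff[OF tendsto_const[of 1] this] show ?thesis by simp
qed

lemma min_degree_prob_tendsto_1:
  assumes "filterlim \<alpha> at_top sequentially"
  shows "min_degree_prob \<longlonglongrightarrow> 1"
  by (rule tendsto_sandwich[OF eventually_connected_prob_le _ connected_prob_tendsto_1[OF assms] tendsto_const])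
    simp

end

locale critical_rig_sequence = rig_sequence +
  fixes a :: real
  assumes \<alpha>_tendsto: "\<alpha> \<longlonglongrightarrow> a"
begin

abbreviation limit_prob :: real where "limit_prob \<equiv> exp (- (exp (- a) / fact q))"

lemma eventually_sparse: "\<forall>\<^sub>F n in sequentially. sparse_rig (P n) (K n) c n"
proof (rule eventually_sparse_rig)
  have "\<forall>\<^sub>F n in sequentially. \<alpha> n < a + 1" by (rule order_tendstoD[OF \<alpha>_tendsto]) simp
  then show "\<forall>\<^sub>F n in sequentially. \<alpha> n \<le> a + 1" by eventually_elim simp
qed

lemma eventually_mean_degree_near_ln: "\<forall>\<^sub>F n in sequentially. ln (real n) + (a - 1) \<le> \<Lambda> n"
proof (rule eventually_mean_degree_ge)
  have "\<forall>\<^sub>F n in sequentially. a - 1 < \<alpha> n" by (rule order_tendstoD[OF \<alpha>_tendsto]) simp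
  then show "\<forall>\<^sub>F n in sequentially. a - 1 \<le> \<alpha> n" by eventually_elim simp
qed

lemma mean_degree_div_ln_tendsto: "(\<lambda>n. \<Lambda> n / ln (real n)) \<longlonglongrightarrow> 1"
proof -
  have "(\<lambda>n. (ln (real n) + real q * ln (ln (real n))) / ln (real n)) \<longlonglongrightarrow> 1" by real_asymp
  moreover have "(\<lambda>n. 1 / ln (real n)) \<longlonglongrightarrow> 0" by real_asymp
  ultimately have "(\<lambda>n. (ln (real n) + real q * ln (ln (real n))) / ln (real n) + \<alpha> n * (1 / ln (real n)))
      \<longlonglongrightarrow> 1 + a * 0"
    by (intro tendsto_add tendsto_mult \<alpha>_tendsto)
  moreover have "\<forall>\<^sub>F n in sequentially.
      (ln (real n) + real q * ln (ln (real n))) / ln (real n) + \<alpha> n * (1 / ln (real n)) = \<Lambda> n / ln (real n)"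
    using eventually_mean_degree_eq by eventually_elim (simp add: add_divide_distrib)
  ultimately show ?thesis by (simp add: tendsto_cong)
qed

lemma expected_degree_count_tendsto:
  "(\<lambda>n. real n * degree_weight q (\<Lambda> n)) \<longlonglongrightarrow> exp (- a) / fact q"
proof -
  have "(\<lambda>n. (\<Lambda> n / ln (real n)) ^ q * exp (- \<alpha> n) / fact q) \<longlonglongrightarrow> 1 ^ q * exp (- a) / fact q"
    by (intro tendsto_intros mean_degree_div_ln_tendsto \<alpha>_tendsto) simp
  moreover have "\<forall>\<^sub>F n in sequentially.
      (\<Lambda> n / ln (real n)) ^ q * exp (- \<alpha> n) / fact q = real n * degree_weight q (\<Lambda> n)"
    using eventually_exp_mean_degree eventually_ln_ge_1
  proof eventually_elim
    case (elim n)
    show ?case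
      unfolding elim(1)[symmetric] degree_weight_def using elim(2) by (simp add: power_divide)
  qed
  ultimately show ?thesis by (simp add: tendsto_cong)
qed

lemma no_degree_prob_tendsto: "no_degree_prob q \<longlonglongrightarrow> limit_prob"
proof (rule degree_count_poisson_limit[OF c_pos _ expected_degree_count_tendsto])
  have "\<forall>\<^sub>F n in sequentially. 1 \<le> ln (real n) + (a - 1)" by real_asymp
  with eventually_sparse eventually_mean_degree_near_ln
  show "\<forall>\<^sub>F n in sequentially. sparse_rig (P n) (K n) c n \<and> 1 \<le> \<Lambda> n"
    by eventually_elim simp
qed

lemma prob_ex_degree_less_tendsto_0:
  "(\<lambda>n. prob (M n) {S. \<exists>v<n. card (nbh {..<n} S {v}) < q}) \<longlonglongrightarrow> 0"
proof (cases q)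
  case 0
  then show ?thesis by simp
next
  case (Suc l)
  have "(\<lambda>n. 1 / ln (real n)) \<longlonglongrightarrow> 0" by real_asymp
  then have "(\<lambda>n. 3 * 4 ^ l * (exp (- \<alpha> n) * (1 / ln (real n)))) \<longlonglongrightarrow> 3 * 4 ^ l * (exp (- a) * 0)"
    by (intro tendsto_intros \<alpha>_tendsto)
  then have bound: "(\<lambda>n. 3 * 4 ^ l * (exp (- \<alpha> n) * (1 / ln (real n)))) \<longlonglongrightarrow> 0" by simp
  show ?thesis
  proof (rule tendsto_sandwich[OF _ _ tendsto_const bound])
    show "\<forall>\<^sub>F n in sequentially. prob (M n) {S. \<exists>v<n. card (nbh {..<n} S {v}) < q}
        \<le> 3 * 4 ^ l * (exp (- \<alpha> n) * (1 / ln (real n)))"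
      using prob_ex_small_degree_eventually_le[of c l] eventually_sparse
        eventually_exp_mean_degree eventually_ln_ge_1
    proof eventually_elim
      case (elim n)
      have "prob (M n) {S. \<exists>v<n. card (nbh {..<n} S {v}) < q}
          \<le> 3 * (real n * (4 * ln (real n)) ^ l * exp (- \<Lambda> n))"
        using elim(1,2) by (simp add: Suc less_Suc_eq_le)
      also have "\<dots> = 3 * 4 ^ l * ((real n * ln (real n) ^ q * exp (- \<Lambda> n)) * (1 / ln (real n)))"
        using elim(4) by (simp add: Suc power_mult_distrib)
      finally show ?case unfolding elim(3) .
    qed
  qed simp
qed

lemma min_degree_prob_tendsto: "min_degree_prob \<longlonglongrightarrow> limit_prob"
proof -
  let ?Y = "\<lambda>n. prob (M n) {S. \<exists>v<n. card (nbh {..<n} S {v}) < q}"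
  have lower: "no_degree_prob q n - ?Y n \<le> min_degree_prob n" for n
  proof -
    have "no_degree_prob q n
        \<le> prob (M n) ({S. \<forall>v<n. Suc q \<le> card (nbh {..<n} S {v})} \<union> {S. \<exists>v<n. card (nbh {..<n} S {v}) < q})"
    proof (rule prob_mono_on_support)
      fix S :: "nat \<Rightarrow> nat set" assume "S \<in> {S. degree_count {..<n} q S = 0}"
      then have "\<forall>v<n. card (nbh {..<n} S {v}) \<noteq> q" by (auto simp: degree_count_def)
      then have "\<forall>v<n. card (nbh {..<n} S {v}) < q \<or> Suc q \<le> card (nbh {..<n} S {v})"
        by (metis Suc_leI nat_neq_iff)
      then show "S \<in> {S. \<forall>v<n. Suc q \<le> card (nbh {..<n} S {v})}
          \<union> {S. \<exists>v<n. card (nbh {..<n} S {v}) < q}"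
        by blast
    qed
    also have "\<dots> \<le> min_degree_prob n + ?Y n" by (rule measure_Un_le) auto
    finally show ?thesis by simp
  qed
  have "(\<lambda>n. no_degree_prob q n - ?Y n) \<longlonglongrightarrow> limit_prob"
    using tendsto_diff[OF no_degree_prob_tendsto prob_ex_degree_less_tendsto_0] by simp
  then show ?thesis
    by (rule tendsto_sandwich[OF always_eventually[OF allI] always_eventually[OF allI] _ no_degree_prob_tendsto,
          OF lower min_degree_prob_le_no_degree_prob[OF order_refl]])
qed

lemma min_degree_not_connected_prob_tendsto_0:
  "(\<lambda>n. prob (M n) (min_degree_not_connected_event n (Suc q))) \<longlonglongrightarrow> 0"
proof (rule tendsto_zero_of_eventually_le)
  fix \<epsilon> :: real assume "\<epsilon> > 0"
  then have "\<forall>\<^sub>F n in sequentially. \<forall>P K. sparse_rig P K c n \<and> ln (real n) - (1 - a)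
      \<le> mean_degree n P K \<longrightarrow>
      prob (objects_pmf {..<n} P K) (min_degree_not_connected_event n (Suc q)) \<le> \<epsilon>"
    by (intro min_degree_not_connected_unlikely c_pos) simp_all
  then show "\<forall>\<^sub>F n in sequentially. prob (M n) (min_degree_not_connected_event n (Suc q)) \<le> \<epsilon>"
    using eventually_sparse eventually_mean_degree_near_ln by eventually_elim simp
qed simp

lemma connected_prob_tendsto: "connected_prob \<longlonglongrightarrow> limit_prob"
proof -
  let ?B = "\<lambda>n. prob (M n) (min_degree_not_connected_event n (Suc q))"
  have lower: "min_degree_prob n - ?B n \<le> connected_prob n" for n
  proof -
    have "min_degree_prob n \<le> prob (M n)
        ({S. k_connected (Suc q) {..<n} (intersection_edges n S)} \<union> min_degree_not_connected_event n (Suc q))"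
      by (intro prob_mono_on_support) (auto simp: min_degree_not_connected_event_def)
    also have "\<dots> \<le> connected_prob n + ?B n" by (rule measure_Un_le) auto
    finally show ?thesis by simp
  qed
  have "(\<lambda>n. min_degree_prob n - ?B n) \<longlonglongrightarrow> limit_prob"
    using tendsto_diff[OF min_degree_prob_tendsto min_degree_not_connected_prob_tendsto_0] by simp
  then show ?thesis
    by (rule tendsto_sandwich[OF always_eventually[OF allI] eventually_connected_prob_le _ min_degree_prob_tendsto,
          OF lower])
qed

end

lemma ex_rig_sequence:
  fixes P K :: "nat \<Rightarrow> nat" and \<alpha> :: "nat \<Rightarrow> real"
  assumes k: "k \<ge> 1"
    and K: "\<And>n. n \<ge> 1 \<Longrightarrow> 1 \<le> K n \<and> K n \<le> P n"
    and edge: "\<And>n. n \<ge> 2 \<Longrightarrow>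
      (real (K n))\<^sup>2 / real (P n) = (ln (real n) + (real k - 1) * ln (ln (real n)) + \<alpha> n) / real n"
    and \<Omega>: "(\<lambda>n. real (K n)) \<in> \<Omega>(\<lambda>n. sqrt (ln (real n)))"
  obtains c where "rig_sequence (k - 1) P K \<alpha> c"
proof -
  obtain c where c: "0 < c" "\<forall>\<^sub>F n in sequentially. c * norm (sqrt (ln (real n)))
      \<le> norm (real (K n))"
    using landau_omega.bigE[OF \<Omega>] by blast
  have "rig_sequence (k - 1) P K \<alpha> c"
  proof
    show "\<forall>\<^sub>F n in sequentially. object_pool (P n) (K n)"
      using eventually_ge_at_top[of 1]
      by eventually_elim (use K in \<open>blast intro: object_pool.intro\<close>)
    show "\<forall>\<^sub>F n in sequentially. c * sqrt (ln (real n)) \<le> real (K n)"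
      using c(2) eventually_ge_at_top[of 1] by eventually_elim simp
    show "\<forall>\<^sub>F n in sequentially.
        mean_degree n (P n) (K n) = ln (real n) + real (k - 1) * ln (ln (real n)) + \<alpha> n"
      using eventually_ge_at_top[of 2]
      by eventually_elim (use k in \<open>simp add: mean_degree_def edge_rate_def edge of_nat_diff\<close>)
  qed (fact c(1))
  then show thesis by (rule that)
qed

theorem theorem2:
  fixes k :: nat and P K :: "nat \<Rightarrow> nat" and \<alpha> :: "nat \<Rightarrow> real"
  assumes "k \<ge> 1"
    and "\<And>n. n \<ge> 1 \<Longrightarrow> 1 \<le> K n \<and> K n \<le> P n"
    and "\<And>n. n \<ge> 2 \<Longrightarrow>
           (real (K n))\<^sup>2 / real (P n) =
             (ln (real n) + (real k - 1) * ln (ln (real n)) + \<alpha> n) / real n"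
    and "(\<lambda>n. real (K n)) \<in> \<Omega>(\<lambda>n. sqrt (ln (real n)))"
  shows
    "((filterlim \<alpha> at_bot sequentially \<longrightarrow>
        (\<lambda>n. measure_pmf.prob (uniform_rig n (P n) (K n)) {E. k_connected k {..<n} E})
          \<longlonglongrightarrow> 0) \<and>
      (filterlim \<alpha> at_top sequentially \<longrightarrow>
        (\<lambda>n. measure_pmf.prob (uniform_rig n (P n) (K n)) {E. k_connected k {..<n} E})
          \<longlonglongrightarrow> 1) \<and>
      (\<forall>a::real. \<alpha> \<longlonglongrightarrow> a \<longrightarrow>
        (\<lambda>n. measure_pmf.prob (uniform_rig n (P n) (K n)) {E. k_connected k {..<n} E})
          \<longlonglongrightarrow> exp (- (exp (- a) / fact (k - 1))))) \<and>
     ((filterlim \<alpha> at_bot sequentially \<longrightarrow>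
        (\<lambda>n. measure_pmf.prob (uniform_rig n (P n) (K n)) {E. min_degree {..<n} E \<ge> k})
          \<longlonglongrightarrow> 0) \<and>
      (filterlim \<alpha> at_top sequentially \<longrightarrow>
        (\<lambda>n. measure_pmf.prob (uniform_rig n (P n) (K n)) {E. min_degree {..<n} E \<ge> k})
          \<longlonglongrightarrow> 1) \<and>
      (\<forall>a::real. \<alpha> \<longlonglongrightarrow> a \<longrightarrow>
        (\<lambda>n. measure_pmf.prob (uniform_rig n (P n) (K n)) {E. min_degree {..<n} E \<ge> k})
          \<longlonglongrightarrow> exp (- (exp (- a) / fact (k - 1)))))"
proof -
  obtain c where "rig_sequence (k - 1) P K \<alpha> c" using ex_rig_sequence[OF assms] .
  then interpret rig_sequence "k - 1" P K \<alpha> c .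
  have Suc_k: "Suc (k - 1) = k" using assms(1) by simp
  have connected: "prob (uniform_rig n (P n) (K n)) {E. k_connected k {..<n} E} = connected_prob n"
    for n
    unfolding prob_uniform_rig Suc_k ..
  have "\<forall>\<^sub>F n in sequentially.
      prob (uniform_rig n (P n) (K n)) {E. min_degree {..<n} E \<ge> k} = min_degree_prob n"
    using eventually_ge_at_top[of 1]
    by eventually_elim (simp only: prob_uniform_rig min_degree_intersection_edges_ge_iff Suc_k)
  note min_degree = tendsto_cong[OF this]
  have critical: "connected_prob \<longlonglongrightarrow> exp (- (exp (- a) / fact (k - 1)))"
    "min_degree_prob \<longlonglongrightarrow> exp (- (exp (- a) / fact (k - 1)))" if "\<alpha> \<longlonglongrightarrow> a" for a
  proof -
    interpret critical_rig_sequence "k - 1" P K \<alpha> c a by unfold_locales (fact that)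
    show "connected_prob \<longlonglongrightarrow> exp (- (exp (- a) / fact (k - 1)))"
      "min_degree_prob \<longlonglongrightarrow> exp (- (exp (- a) / fact (k - 1)))"
      by (fact connected_prob_tendsto, fact min_degree_prob_tendsto)
  qed
  show ?thesis
    unfolding connected min_degree
    using connected_prob_tendsto_0 connected_prob_tendsto_1 min_degree_prob_tendsto_0
      min_degree_prob_tendsto_1 critical by blast
qed

end
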